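(* Let $\Phi_1(r)=\dfrac{r}{\sqrt{r^2+4}}$ and let $\mathcal{L}_1$ be the linearized complex sine-Gordon II operator at the degree-1 vortex $\Psi_1=\Phi_1(r)e^{i\theta}$, as given in the context. If there exist $\lambda>0$ and $\phi\in H^1_0(\mathbb{R}^2;\mathbb{C})$ such that $\mathcal{L}_1\phi=-\lambda\phi$, then $\phi=0$.
   Context: In polar coordinates $(r,\theta)$ on $\mathbb{R}^2$, the real-linear operator $\mathcal{L}_1$ acts on complex-valued functions $\phi(r,\theta)$ by $$\begin{aligned}\mathcal{L}_1\phi={}&-\partial_r^2\phi-\frac1r\partial_r\phi-\frac1{r^2}\partial_\theta^2\phi-\frac{2\Phi_1\Phi_1'}{2-\Phi_1^2}\partial_r\phi-\frac{4i}{r^2}\frac1{2-\Phi_1^2}\partial_\theta\phi\\&+\left[\frac{4/r^2-(\Phi_1')^2\Phi_1^2}{(2-\Phi_1^2)^2}-\frac32\Phi_1^4+3\Phi_1^2-1\right]\phi\\&+\left[\frac{(2/r^2)\Phi_1^2-2(\Phi_1')^2}{(2-\Phi_1^2)^2}-\Phi_1^4+\frac32\Phi_1^2\right]\bar\phi .\end{aligned}$$ It is obtained by linearizing $-\Delta\psi-\frac{(\nabla\psi)^2\bar\psi}{2-|\psi|^2}-\frac12\psi(1-|\psi|^2)(2-|\psi|^2)$ at $\Psi_1$ along perturbations $\psi=(\Phi_1+\varepsilon\phi)e^{i\theta}$ and factoring out $e^{i\theta}$. The space $H^1_0(\mathbb{R}^2;\mathbb{C})$ is the closure of $C_c^\infty(\mathbb{R}^2;\mathbb{C})$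 in $H^1$. *)

theory Defs
  imports "HOL-Analysis.Analysis"
begin

section \<open>Test functions, weak derivatives and Sobolev spaces\<close>

definition partial_deriv ::
    "'a \<Rightarrow> ('a::euclidean_space \<Rightarrow> complex) \<Rightarrow> 'a \<Rightarrow> complex" where
  "partial_deriv b f x = frechet_derivative f (at x) b"

primrec Ck :: "nat \<Rightarrow> ('a::euclidean_space \<Rightarrow> complex) \<Rightarrow> bool" where
  "Ck 0 f \<longleftrightarrow> continuous_on UNIV f"
| "Ck (Suc k) f \<longleftrightarrow>
     (\<forall>x. f differentiable (at x)) \<and> (\<forall>b\<in>Basis. Ck k (partial_deriv b f))"

text \<open>The space of smooth functions whose support is a compact subset of \<open>\<Omega>\<close>.\<close>

definition test_functions :: "'a::euclidean_space set \<Rightarrow> ('a \<Rightarrow> complex) set" where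
  "test_functions \<Omega> = {\<eta>. (\<forall>k. Ck k \<eta>) \<and>
     compact (closure {x. \<eta> x \<noteq> 0}) \<and> closure {x. \<eta> x \<noteq> 0} \<subseteq> \<Omega>}"

definition locally_integrable :: "('a::euclidean_space \<Rightarrow> complex) \<Rightarrow> bool" where
  "locally_integrable f \<longleftrightarrow> (\<forall>K. compact K \<longrightarrow> set_integrable lborel K f)"

definition square_integrable :: "('a::euclidean_space \<Rightarrow> complex) \<Rightarrow> bool" where
  "square_integrable f \<longleftrightarrow>
     f \<in> borel_measurable lborel \<and> integrable lborel (\<lambda>x. (norm (f x))\<^sup>2)"

definition has_weak_deriv ::
    "'a::euclidean_space \<Rightarrow> ('a \<Rightarrow> complex) \<Rightarrow> ('a \<Rightarrow> complex) \<Rightarrow> bool" where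
  "has_weak_deriv b f g \<longleftrightarrow> locally_integrable f \<and> locally_integrable g \<and>
     (\<forall>\<eta>\<in>test_functions UNIV.
        (LINT x|lborel. f x * partial_deriv b \<eta> x) = - (LINT x|lborel. g x * \<eta> x))"

text \<open>Elements of function spaces are represented by functions, not by classes modulo null sets.
  A weak derivative is unique up to null sets, so the choice below is immaterial under integrals.\<close>

definition weak_deriv ::
    "'a::euclidean_space \<Rightarrow> ('a \<Rightarrow> complex) \<Rightarrow> 'a \<Rightarrow> complex" where
  "weak_deriv b f = (SOME g. has_weak_deriv b f g)"

definition H1 :: "('a::euclidean_space \<Rightarrow> complex) set" where
  "H1 = {f. square_integrable f \<and>
     (\<forall>b\<in>Basis. \<exists>g. has_weak_deriv b f g \<and> square_integrable g)}"

definition H1_norm :: "('a::euclidean_space \<Rightarrow> complex) \<Rightarrow> real" where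
  "H1_norm f = sqrt ((LINT x|lborel. (norm (f x))\<^sup>2) +
     (\<Sum>b\<in>Basis. LINT x|lborel. (norm (weak_deriv b f x))\<^sup>2))"

definition H1_0 :: "('a::euclidean_space \<Rightarrow> complex) set" where
  "H1_0 = {f \<in> H1. \<forall>\<epsilon>>0. \<exists>\<eta>\<in>test_functions UNIV. H1_norm (\<lambda>x. f x - \<eta> x) < \<epsilon>}"


section \<open>The linearized operator at the vortex\<close>

definition Phi1 :: "real \<Rightarrow> real" where
  "Phi1 r = r / sqrt (r\<^sup>2 + 4)"

text \<open>The polar derivatives \<open>\<partial>\<^sub>r = (x \<partial>\<^sub>x + y \<partial>\<^sub>y) / r\<close> and \<open>\<partial>\<^sub>\<theta> = x \<partial>\<^sub>y - y \<partial>\<^sub>x\<close>,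
  with respect to a notion \<open>D\<close> of directional derivative
  (\<^const>\<open>weak_deriv\<close> or \<^const>\<open>partial_deriv\<close>).\<close>

definition radial_deriv ::
    "(real^2 \<Rightarrow> (real^2 \<Rightarrow> complex) \<Rightarrow> real^2 \<Rightarrow> complex) \<Rightarrow>
     (real^2 \<Rightarrow> complex) \<Rightarrow> real^2 \<Rightarrow> complex" where
  "radial_deriv D f x =
     (of_real (x$1) * D (axis 1 1) f x + of_real (x$2) * D (axis 2 1) f x) / of_real (norm x)"

definition angular_deriv ::
    "(real^2 \<Rightarrow> (real^2 \<Rightarrow> complex) \<Rightarrow> real^2 \<Rightarrow> complex) \<Rightarrow>
     (real^2 \<Rightarrow> complex) \<Rightarrow> real^2 \<Rightarrow> complex" where
  "angular_deriv D f x =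
     of_real (x$1) * D (axis 2 1) f x - of_real (x$2) * D (axis 1 1) f x"

definition L1_drift :: "real \<Rightarrow> real" where
  "L1_drift r = - (2 * Phi1 r * deriv Phi1 r) / (2 - (Phi1 r)\<^sup>2)"

definition L1_rot :: "real \<Rightarrow> complex" where
  "L1_rot r = - (4 * \<i> / of_real (r\<^sup>2)) * of_real (1 / (2 - (Phi1 r)\<^sup>2))"

definition L1_pot :: "real \<Rightarrow> real" where
  "L1_pot r = (4 / r\<^sup>2 - (deriv Phi1 r)\<^sup>2 * (Phi1 r)\<^sup>2) / (2 - (Phi1 r)\<^sup>2)\<^sup>2
     - 3/2 * (Phi1 r)^4 + 3 * (Phi1 r)\<^sup>2 - 1"

definition L1_conj_pot :: "real \<Rightarrow> real" where
  "L1_conj_pot r = ((2 / r\<^sup>2) * (Phi1 r)\<^sup>2 - 2 * (deriv Phi1 r)\<^sup>2) / (2 - (Phi1 r)\<^sup>2)\<^sup>2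
     - (Phi1 r)^4 + 3/2 * (Phi1 r)\<^sup>2"

text \<open>The terms of the operator of order at most one.\<close>

definition L1_lower :: "(real^2 \<Rightarrow> complex) \<Rightarrow> real^2 \<Rightarrow> complex" where
  "L1_lower \<phi> x =
     of_real (L1_drift (norm x)) * radial_deriv weak_deriv \<phi> x
     + L1_rot (norm x) * angular_deriv weak_deriv \<phi> x
     + of_real (L1_pot (norm x)) * \<phi> x
     + of_real (L1_conj_pot (norm x)) * cnj (\<phi> x)"

text \<open>For \<open>\<phi>\<close> in \<open>H\<^sup>1\<close>, the image of \<open>\<phi>\<close> under the operator is a distribution; this is its
  (complex bilinear) pairing with a test function \<open>\<eta>\<close>. The second-order part
  \<open>- \<partial>\<^sub>r\<^sup>2 \<phi> - (1/r) \<partial>\<^sub>r \<phi> - (1/r\<^sup>2) \<partial>\<^sub>\<theta>\<^sup>2 \<phi>\<close>, integrated by parts once against \<open>\<eta>\<close>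
  with respect to \<open>r dr d\<theta>\<close> (Lebesgue measure on the plane), yields the first two terms of the integrand.\<close>

definition L1_pairing :: "(real^2 \<Rightarrow> complex) \<Rightarrow> (real^2 \<Rightarrow> complex) \<Rightarrow> complex" where
  "L1_pairing \<phi> \<eta> = (LINT x|lborel.
     radial_deriv weak_deriv \<phi> x * radial_deriv partial_deriv \<eta> x
     + angular_deriv weak_deriv \<phi> x * angular_deriv partial_deriv \<eta> x / of_real ((norm x)\<^sup>2)
     + L1_lower \<phi> x * \<eta> x)"

text \<open>The equation \<open>L \<phi> = \<mu> \<phi>\<close> in the sense of distributions. The coefficients are of size
  \<open>1/r\<^sup>2\<close> at the origin, which is not locally integrable on the plane, so the equation is
  read on the punctured plane, where polar coordinates are defined. Admitting only test functions
  that vanish near the origin makes this the weakest notion of solution.\<close>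

definition L1_eigen_eq :: "(real^2 \<Rightarrow> complex) \<Rightarrow> real \<Rightarrow> bool" where
  "L1_eigen_eq \<phi> \<mu> \<longleftrightarrow> (\<forall>\<eta>\<in>test_functions (- {0}).
     L1_pairing \<phi> \<eta> = of_real \<mu> * (LINT x|lborel. \<phi> x * \<eta> x))"

end

theory Submission
  imports Defs
begin

text \<open>The operator is \<open>2 - \<Phi>\<^sup>2\<close> times a symmetric one. Testing the equation with
  \<open>\<chi>\<^sup>2 / (2 - \<Phi>\<^sup>2)\<close> times the conjugate of \<open>\<phi>\<close>, for a radial cutoff \<open>\<chi>\<close> supported away from the
  origin and from infinity, bounds \<open>\<lambda> \<integral> \<chi>\<^sup>2 \<bar>\<phi>\<bar>\<^sup>2 / (2 - \<Phi>\<^sup>2)\<close> by \<open>\<integral> \<bar>\<nabla>\<chi>\<bar>\<^sup>2 \<bar>\<phi>\<bar>\<^sup>2 / (2 - \<Phi>\<^sup>2)\<close>, provided that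
  the quadratic form of the second variation of the energy is nonnegative at \<open>\<chi>\<phi>\<close>. By density it is
  enough to know this for \<open>\<chi>\<close> times a polynomial in \<open>x + \<i>y\<close> and \<open>x - \<i>y\<close>, a finite sum of angular modes. The form
  only couples the modes \<open>m\<close> and \<open>-m\<close>, and on each such pair it is nonnegative by Picone's argument,
  with explicit positive supersolutions of the radial system; for \<open>m = 1\<close> the supersolution is the
  zero mode \<open>(\<Phi>', \<Phi> / r)\<close> generated by translations. Finally \<open>\<chi> = \<psi> (ln r\<^sup>2 / L)\<close> with \<open>L\<close> tending to infinity makes the
  bound vanish: a point has capacity zero in the plane, which enters through Hardy's logarithmic
  inequality.\<close>

section \<open>Smooth functions and test functions\<close>

text \<open>An eigenfunction is only in \<open>H1_0\<close>, so its conjugate times a cutoff is not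
  an admissible test function. The equation is therefore tested with a cut-off polynomial
  \<open>p\<close> in its place. The form is additive in its first argument, so the tested value
  differs from the form at \<open>p\<close> by the form at \<open>\<phi> - p\<close>, which is small
  on the annulus where the cutoff lives. Polynomials take the place of Fourier series because each
  is a finite sum of modes, so orthogonality raises no question of convergence.

  Conjugation sends frequency \<open>m\<close> to \<open>- m\<close>. Passing to the sum and the
  difference of the mode \<open>m\<close> and the conjugate of the mode \<open>- m\<close> leaves a
  single cross term, proportional to \<open>m\<close>; what remains is a symmetric radial 2 by 2
  system.

  Test functions must vanish near the origin, where \<phi> need not be bounded. The gradient of the
  cutoff costs \<open>1 / (L^2 r^2)\<close> times \<open>|\<phi>|^2\<close>, which square
  integrability of \<phi> does not control uniformly in \<open>L\<close>; the weight
  \<open>1 / (r^2 log^2 r)\<close> of Hardy's inequality is just large enough to do so.\<close>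

abbreviation r2 :: "'a::real_inner \<Rightarrow> real" where "r2 x \<equiv> x \<bullet> x"

abbreviation pd1 :: "(real^2 \<Rightarrow> complex) \<Rightarrow> real^2 \<Rightarrow> complex" where "pd1 \<equiv> partial_deriv (axis 1 1)"

abbreviation pd2 :: "(real^2 \<Rightarrow> complex) \<Rightarrow> real^2 \<Rightarrow> complex" where "pd2 \<equiv> partial_deriv (axis 2 1)"

text \<open>The derivatives \<open>r \<partial>\<^sub>r\<close> and \<open>\<partial>\<^sub>\<theta>\<close> in terms of the Cartesian derivatives \<open>p1\<close>, \<open>p2\<close>.\<close>

abbreviation rdr :: "(real^2 \<Rightarrow> complex) \<Rightarrow> (real^2 \<Rightarrow> complex) \<Rightarrow> real^2 \<Rightarrow> complex" where
  "rdr p1 p2 x \<equiv> of_real (x$1) * p1 x + of_real (x$2) * p2 x"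

abbreviation dth :: "(real^2 \<Rightarrow> complex) \<Rightarrow> (real^2 \<Rightarrow> complex) \<Rightarrow> real^2 \<Rightarrow> complex" where
  "dth p1 p2 x \<equiv> of_real (x$1) * p2 x - of_real (x$2) * p1 x"

section \<open>Smooth functions of one real variable\<close>

text \<open>The classical flat function, with a power of \<open>x\<close> in the denominator so that
  the family spans a space closed under differentiation.\<close>

definition flat :: "real \<Rightarrow> nat \<Rightarrow> real \<Rightarrow> real" where
  "flat c k x = (if x > 0 then exp (- c / x) / x ^ k else 0)"

lemma flat_tendsto_0:
  assumes "c > 0"
  shows "(flat c k \<longlongrightarrow> 0) (at_right 0)"
proof -
  have "filterlim (\<lambda>x. c * inverse x) at_top (at_right (0::real))"
    by (intro filterlim_tendsto_pos_mult_at_top[OF tendsto_const assms] filterlim_inverse_at_top_right)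
  then have "((\<lambda>x. (c * inverse x) ^ k / exp (c * inverse x)) \<longlongrightarrow> 0) (at_right 0)"
    by (rule filterlim_compose[OF tendsto_power_div_exp_0])
  then have "((\<lambda>x. inverse (c ^ k) * ((c * inverse x) ^ k / exp (c * inverse x))) \<longlongrightarrow> inverse (c ^ k) * 0) (at_right 0)"
    by (intro tendsto_mult tendsto_const)
  moreover have "\<forall>\<^sub>F x in at_right 0. inverse (c ^ k) * ((c * inverse x) ^ k / exp (c * inverse x)) = flat c k x"
    using assms
    by (intro eventually_at_rightI[of 0 1])
       (auto simp: flat_def field_simps exp_minus power_mult_distrib simp flip: exp_add)
  ultimately show ?thesis
    by (simp add: tendsto_cong)
qed

lemma flat_has_derivative:
  assumes "c > 0"
  shows "(flat c k has_real_derivative (c * flat c (k + 2) x - real k * flat c (k + 1) x)) (at x)"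
proof (cases "x = 0")
  case False
  consider "x > 0" | "x < 0" using False by linarith
  then show ?thesis
  proof cases
    case 1
    have "((\<lambda>x. exp (- c / x) / x ^ k) has_real_derivative
        (c * flat c (k + 2) x - real k * flat c (k + 1) x)) (at x)"
      using 1 by (auto intro!: derivative_eq_intros simp: flat_def field_simps power2_eq_square power_Suc
          split: nat.splits) (cases k; simp add: field_simps)
    then show ?thesis
      by (rule has_field_derivative_transform_within_open[where S="{0<..}"]) (use 1 in \<open>auto simp: flat_def\<close>)
  next
    case 2
    have "((\<lambda>x. 0) has_real_derivative 0) (at x)" by simp
    then have "(flat c k has_real_derivative 0) (at x)"
      by (rule has_field_derivative_transform_within_open[where S="{..<0}"]) (use 2 in \<open>auto simp: flat_def\<close>)
    then show ?thesis using 2 by (simp add: flat_def)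
  qed
next
  case True
  have R: "((\<lambda>y. (flat c k y - flat c k 0) / (y - 0)) \<longlongrightarrow> 0) (at_right 0)"
    by (rule Lim_transform_eventually[OF flat_tendsto_0[OF assms, of "Suc k"]])
       (auto intro!: eventually_at_rightI[of 0 1] simp: flat_def)
  have L: "((\<lambda>y. (flat c k y - flat c k 0) / (y - 0)) \<longlongrightarrow> 0) (at_left 0)"
    by (rule Lim_transform_eventually[OF tendsto_const])
       (auto intro!: eventually_at_leftI[of "-1" 0] simp: flat_def)
  have "((\<lambda>y. (flat c k y - flat c k 0) / (y - 0)) \<longlongrightarrow> 0) (at 0)"
    using filterlim_split_at[OF L R] .
  then have "(flat c k has_real_derivative 0) (at 0)"
    by (simp add: has_field_derivative_iff)
  then show ?thesis using True by (simp add: flat_def)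
qed

text \<open>A class of formulas closed under differentiation, so that derivatives of every order
  exist by induction and never have to be computed. The last rule serves cutoffs in
  \<open>ln t\<close>: the powers of \<open>t\<close> come from differentiating \<open>ln\<close>,
  those of \<open>t + 8\<close> from the denominator of \<open>W\<close>, and the vanishing of
  \<open>f\<close> below \<open>M\<close> makes the function zero near \<open>t = 0\<close>.\<close>

inductive smooth_real :: "(real \<Rightarrow> real) \<Rightarrow> bool" where
  smooth_const: "smooth_real (\<lambda>_. c)"
| smooth_id: "smooth_real (\<lambda>x. x)"
| smooth_flat: "c > 0 \<Longrightarrow> smooth_real (\<lambda>x. flat c k (p * x + q))"
| smooth_add: "smooth_real f \<Longrightarrow> smooth_real g \<Longrightarrow> smooth_real (\<lambda>x. f x + g x)"
| smooth_mult: "smooth_real f \<Longrightarrow> smooth_real g \<Longrightarrow> smooth_real (\<lambda>x. f x * g x)"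
| smooth_ln: "smooth_real f \<Longrightarrow> (\<And>y. y < M \<Longrightarrow> f y = 0) \<Longrightarrow>
    smooth_real (\<lambda>t. if t > 0 then f (ln t) / (t ^ j * (t + 8) ^ m) else 0)"

lemma smooth_real_deriv:
  assumes "smooth_real f"
  shows "\<exists>f'. smooth_real f' \<and> (\<forall>x. (f has_real_derivative f' x) (at x))"
  using assms
proof induction
  case (smooth_const c)
  show ?case by (rule exI[of _ "\<lambda>_. 0"]) (auto intro: smooth_real.intros)
next
  case smooth_id
  show ?case by (rule exI[of _ "\<lambda>_. 1"]) (auto intro: smooth_real.intros)
next
  case (smooth_flat c k p q)
  have *: "((\<lambda>x. flat c k (p * x + q)) has_real_derivative
      (c * p) * flat c (k + 2) (p * x + q) + (- real k * p) * flat c (k + 1) (p * x + q)) (at x)" for x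
  proof -
    have "((\<lambda>x. p * x + q) has_real_derivative p) (at x)"
      by (auto intro!: derivative_eq_intros)
    from DERIV_chain2[OF flat_has_derivative[OF smooth_flat] this] show ?thesis
      by (simp add: algebra_simps)
  qed
  show ?case
    by (rule exI[of _ "\<lambda>x. (c * p) * flat c (k + 2) (p * x + q) + (- real k * p) * flat c (k + 1) (p * x + q)"],
       intro conjI allI *) (intro smooth_real.intros smooth_flat)
next
  case (smooth_add f g)
  then obtain f' g' where "smooth_real f'" "smooth_real g'"
    "\<And>x. (f has_real_derivative f' x) (at x)" "\<And>x. (g has_real_derivative g' x) (at x)" by blast
  then show ?case
    by (intro exI[of _ "\<lambda>x. f' x + g' x"]) (auto intro!: smooth_real.intros derivative_intros)
next
  case (smooth_mult f g)
  then obtain f' g' where fg: "smooth_real f'" "smooth_real g'"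
    "\<And>x. (f has_real_derivative f' x) (at x)" "\<And>x. (g has_real_derivative g' x) (at x)" by blast
  show ?case
    by (intro exI[of _ "\<lambda>x. f' x * g x + g' x * f x"] conjI allI)
       (use fg smooth_mult in \<open>auto intro!: smooth_real.intros DERIV_mult\<close>)
next
  case (smooth_ln f M j m)
  then obtain f' where f': "smooth_real f'" "\<And>x. (f has_real_derivative f' x) (at x)" by blast
  \<comment> \<open>The side condition of \<open>smooth_ln\<close> must pass to the derivative, or
    the class would not be closed.\<close>
  have f'0: "f' y = 0" if "y < M" for y
  proof -
    have "(f has_real_derivative 0) (at y)"
      by (rule has_field_derivative_transform_within_open[where S="{..<M}" and f="\<lambda>_. 0"])
         (use that smooth_ln in auto)
    with f'(2) show ?thesis using DERIV_unique by blast
  qed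
  let ?G = "\<lambda>f j m t. if t > 0 then f (ln t) / (t ^ j * (t + 8) ^ m) else (0::real)"
  define h where "h t = ?G f' (j+1) m t + ((- real j) * ?G f (j+1) m t + (- real m) * ?G f j (m+1) t)" for t
  have "smooth_real h"
    unfolding h_def using smooth_ln f' f'0 by (intro smooth_real.intros(4,5,1) smooth_real.smooth_ln[of _ M])
  moreover have "(?G f j m has_real_derivative h x) (at x)" for x
  proof (cases "x > 0")
    case True
    have "((\<lambda>t. f (ln t) / (t ^ j * (t + 8) ^ m)) has_real_derivative
       (f' (ln x) / x * (x ^ j * (x + 8) ^ m) -
        f (ln x) * (real j * x ^ (j - 1) * (x + 8) ^ m + real m * (x + 8) ^ (m - 1) * x ^ j)) / (x ^ j * (x + 8) ^ m)\<^sup>2) (at x)"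
      by (rule derivative_eq_intros DERIV_chain'[OF _ f'(2)] refl | (use True in \<open>simp; fail\<close>))+
         (use True in \<open>simp add: power2_eq_square field_simps\<close>)
    also have "(f' (ln x) / x * (x ^ j * (x + 8) ^ m) -
        f (ln x) * (real j * x ^ (j - 1) * (x + 8) ^ m + real m * (x + 8) ^ (m - 1) * x ^ j)) / (x ^ j * (x + 8) ^ m)\<^sup>2 = h x"
      using True by (cases j; cases m; simp add: h_def power2_eq_square divide_simps) (simp_all add: algebra_simps)
    finally show ?thesis
      by (rule has_field_derivative_transform_within_open[where S="{0<..}"]) (use True in auto)
  next
    case False
    \<comment> \<open>The function vanishes on the whole half line below \<open>exp M\<close>, since
      \<open>ln t < M\<close> for positive \<open>t\<close> there; this is an open neighbourhood of
      any \<open>x \<le> 0\<close>.\<close>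
    have "((\<lambda>x. 0) has_real_derivative 0) (at x)" by simp
    then have "(?G f j m has_real_derivative 0) (at x)"
    proof (rule has_field_derivative_transform_within_open[where S="{..<exp M}"])
      show "0 = ?G f j m t" if "t \<in> {..<exp M}" for t
      proof (cases "t > 0")
        case True
        then have "exp (ln t) < exp M" using that by simp
        then have "ln t < M" by (simp only: exp_less_cancel_iff)
        then show ?thesis using smooth_ln(2) by simp
      qed simp
    qed (use False le_less_trans[of x 0 "exp M"] in auto)
    then show ?thesis using False by (simp add: h_def)
  qed
  ultimately show ?case by blast
qed

section \<open>Functions on the plane with explicit gradients\<close>

text \<open>Total differentiability with the two partial derivatives named, so that gradients are
  computed by rules and \<open>frechet_derivative\<close> appears only in the translation to
  \<open>partial_deriv\<close>.\<close>

definition has_grad :: "(real^2 \<Rightarrow> complex) \<Rightarrow> (real^2 \<Rightarrow> complex) \<Rightarrow> (real^2 \<Rightarrow> complex) \<Rightarrow> bool" where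
  "has_grad f f1 f2 \<longleftrightarrow>
     (\<forall>x. (f has_derivative (\<lambda>h. of_real (h$1) * f1 x + of_real (h$2) * f2 x)) (at x))"

lemma Basis_plane: "(Basis :: (real^2) set) = {axis 1 1, axis 2 1}"
  by (auto simp: Basis_vec_def UNIV_2)

lemma inner_plane: "x \<bullet> y = x$1 * y$1 + x$2 * y$2" for x y :: "real^2"
  by (simp add: inner_vec_def UNIV_2)

lemma axis_plane [simp]:
  "(axis 1 1 :: real^2)$1 = 1" "(axis 1 1 :: real^2)$2 = 0"
  "(axis 2 1 :: real^2)$1 = 0" "(axis 2 1 :: real^2)$2 = 1"
  by (auto simp: axis_def)

lemma has_gradD: "has_grad f f1 f2 \<Longrightarrow>
    (f has_derivative (\<lambda>h. of_real (h$1) * f1 x + of_real (h$2) * f2 x)) (at x)"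
  by (simp add: has_grad_def)

lemma has_grad_partial_deriv:
  assumes "has_grad f f1 f2"
  shows "pd1 f = f1" "pd2 f = f2"
proof -
  have "frechet_derivative f (at x) = (\<lambda>h. of_real (h$1) * f1 x + of_real (h$2) * f2 x)" for x
    using frechet_derivative_at[OF has_gradD[OF assms]] by simp
  then show "pd1 f = f1" "pd2 f = f2"
    by (simp_all add: partial_deriv_def fun_eq_iff)
qed

lemma has_grad_differentiable: "has_grad f f1 f2 \<Longrightarrow> f differentiable (at x)"
  using has_gradD unfolding differentiable_def by blast

lemma has_grad_continuous: "has_grad f f1 f2 \<Longrightarrow> continuous_on A f"
  by (meson continuous_at_imp_continuous_on differentiable_imp_continuous_within has_grad_differentiable)

lemma has_grad_const: "has_grad (\<lambda>_. c) (\<lambda>_. 0) (\<lambda>_. 0)"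
  by (simp add: has_grad_def)

lemma has_grad_add:
  assumes "has_grad f f1 f2" "has_grad g g1 g2"
  shows "has_grad (\<lambda>x. f x + g x) (\<lambda>x. f1 x + g1 x) (\<lambda>x. f2 x + g2 x)"
  unfolding has_grad_def
  by (intro allI has_derivative_eq_rhs[OF has_derivative_add[OF assms[THEN has_gradD]]])
     (auto simp: algebra_simps)

lemma has_grad_mult:
  assumes "has_grad f f1 f2" "has_grad g g1 g2"
  shows "has_grad (\<lambda>x. f x * g x) (\<lambda>x. f x * g1 x + f1 x * g x) (\<lambda>x. f x * g2 x + f2 x * g x)"
  unfolding has_grad_def
  by (intro allI has_derivative_eq_rhs[OF has_derivative_mult[OF assms[THEN has_gradD]]])
     (auto simp: algebra_simps)

lemma has_grad_cnj:
  assumes "has_grad f f1 f2"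
  shows "has_grad (\<lambda>x. cnj (f x)) (\<lambda>x. cnj (f1 x)) (\<lambda>x. cnj (f2 x))"
  unfolding has_grad_def
  by (intro allI has_derivative_eq_rhs[OF has_derivative_cnj[OF assms[THEN has_gradD]]]) auto

lemma has_derivative_coord: "((\<lambda>x::real^2. x $ i) has_derivative (\<lambda>h. h $ i)) F"
  by (rule bounded_linear_imp_has_derivative) (rule bounded_linear_vec_nth)

lemma has_grad_coord:
  assumes "\<And>x. (h has_real_derivative h' x) (at x)"
  shows "has_grad (\<lambda>x. of_real (h (x $ i))) (\<lambda>x. of_real (if i = 1 then h' (x $ i) else 0))
    (\<lambda>x. of_real (if i = 2 then h' (x $ i) else 0))"
  unfolding has_grad_def
proof
  fix x :: "real^2"
  have "((\<lambda>x. h (x $ i)) has_derivative (\<lambda>k. k $ i * h' (x $ i))) (at x)"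
    using has_derivative_compose[OF has_derivative_coord assms[unfolded has_field_derivative_def], of i x]
    by (simp add: mult.commute)
  from has_derivative_of_real[OF this]
  show "((\<lambda>x. complex_of_real (h (x $ i))) has_derivative
    (\<lambda>k. of_real (k $ 1) * of_real (if i = 1 then h' (x $ i) else 0) + of_real (k $ 2) * of_real (if i = 2 then h' (x $ i) else 0))) (at x)"
    by (rule has_derivative_eq_rhs) (use exhaust_2[of i] in \<open>auto simp: fun_eq_iff\<close>)
qed

lemma has_grad_radial:
  assumes "\<And>x. (h has_real_derivative h' x) (at x)"
  shows "has_grad (\<lambda>x. of_real (h (r2 x))) (\<lambda>x. of_real (h' (r2 x)) * of_real (2 * x$1))
    (\<lambda>x. of_real (h' (r2 x)) * of_real (2 * x$2))"
  unfolding has_grad_def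
proof
  fix x :: "real^2"
  have "((\<lambda>x. x \<bullet> x) has_derivative (\<lambda>k. 2 * (x \<bullet> k))) (at x)"
    by (rule has_derivative_eq_rhs, rule has_derivative_inner[OF has_derivative_ident has_derivative_ident])
       (auto simp: inner_commute)
  then have "((\<lambda>x. h (r2 x)) has_derivative (\<lambda>k. h' (r2 x) * (2 * (x \<bullet> k)))) (at x)"
    using has_derivative_compose[OF _ assms[unfolded has_field_derivative_def]] by blast
  from has_derivative_of_real[OF this]
  show "((\<lambda>x. complex_of_real (h (r2 x))) has_derivative
    (\<lambda>k. of_real (k $ 1) * (of_real (h' (r2 x)) * of_real (2 * x$1)) +
         of_real (k $ 2) * (of_real (h' (r2 x)) * of_real (2 * x$2)))) (at x)"
    by (rule has_derivative_eq_rhs) (auto simp: fun_eq_iff inner_plane algebra_simps)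
qed

text \<open>The planar counterpart of \<open>smooth_real\<close>, again closed under partial
  derivatives. Radial functions are taken in the variable \<open>r^2\<close>, which is smooth at the
  origin, unlike \<open>r\<close>.\<close>

inductive smooth_plane :: "(real^2 \<Rightarrow> complex) \<Rightarrow> bool" where
  smooth_plane_const: "smooth_plane (\<lambda>_. c)"
| smooth_plane_coord: "smooth_real h \<Longrightarrow> smooth_plane (\<lambda>x. of_real (h (x $ i)))"
| smooth_plane_radial: "smooth_real h \<Longrightarrow> smooth_plane (\<lambda>x. of_real (h (r2 x)))"
| smooth_plane_add: "smooth_plane f \<Longrightarrow> smooth_plane g \<Longrightarrow> smooth_plane (\<lambda>x. f x + g x)"
| smooth_plane_mult: "smooth_plane f \<Longrightarrow> smooth_plane g \<Longrightarrow> smooth_plane (\<lambda>x. f x * g x)"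

lemma smooth_plane_grad:
  assumes "smooth_plane f"
  shows "\<exists>f1 f2. smooth_plane f1 \<and> smooth_plane f2 \<and> has_grad f f1 f2"
  using assms
proof induction
  case (smooth_plane_const c)
  then show ?case using has_grad_const smooth_plane.intros(1) by blast
next
  case (smooth_plane_coord h i)
  then obtain h' where h': "smooth_real h'" "\<And>x. (h has_real_derivative h' x) (at x)"
    using smooth_real_deriv by blast
  have z: "smooth_plane (\<lambda>x. of_real (if P then h' (x $ i) else 0))" for P
    using smooth_plane.intros(1)[of 0] smooth_plane.intros(2)[OF h'(1)] by (cases P) auto
  show ?case using z[of "i = 1"] z[of "i = 2"] has_grad_coord[OF h'(2), of i] by blast
next
  case (smooth_plane_radial h)
  then obtain h' where h': "smooth_real h'" "\<And>x. (h has_real_derivative h' x) (at x)"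
    using smooth_real_deriv by blast
  have c: "smooth_plane (\<lambda>x. of_real (2 * x $ i))" for i
    using smooth_plane.intros(2)[OF smooth_mult[OF smooth_const[of 2] smooth_id]] by simp
  show ?case using has_grad_radial[OF h'(2)] smooth_plane.intros(5)[OF smooth_plane.intros(3)[OF h'(1)] c]
    by blast
next
  case (smooth_plane_add f g)
  then obtain f1 f2 g1 g2 where fg: "smooth_plane f1" "smooth_plane f2" "has_grad f f1 f2"
    "smooth_plane g1" "smooth_plane g2" "has_grad g g1 g2" by blast
  show ?case
    using smooth_plane.intros(4)[OF fg(1,4)] smooth_plane.intros(4)[OF fg(2,5)]
      has_grad_add[OF fg(3,6)] by blast
next
  case (smooth_plane_mult f g)
  then obtain f1 f2 g1 g2 where fg: "smooth_plane f1" "smooth_plane f2" "has_grad f f1 f2"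
    "smooth_plane g1" "smooth_plane g2" "has_grad g g1 g2" by blast
  have p: "smooth_plane (\<lambda>x. f x * g' x + f' x * g x)" if "smooth_plane f'" "smooth_plane g'" for f' g'
    using smooth_plane_mult.hyps that by (intro smooth_plane.intros(4,5))
  show ?case
    using p[OF fg(1,4)] p[OF fg(2,5)] has_grad_mult[OF fg(3,6)] by blast
qed

lemma smooth_plane_Ck: "smooth_plane f \<Longrightarrow> Ck k f"
proof (induction k arbitrary: f)
  case 0
  then show ?case using smooth_plane_grad has_grad_continuous by (metis Ck.simps(1))
next
  case (Suc k)
  obtain f1 f2 where f: "smooth_plane f1" "smooth_plane f2" "has_grad f f1 f2"
    using smooth_plane_grad[OF Suc.prems] by blast
  then show ?case
    using Suc.IH has_grad_differentiable[OF f(3)] by (simp add: Basis_plane has_grad_partial_deriv[OF f(3)])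
qed

lemma smooth_plane_test_function:
  assumes "smooth_plane f" "closed K" "bounded K" "K \<subseteq> \<Omega>" "\<And>x. x \<notin> K \<Longrightarrow> f x = 0"
  shows "f \<in> test_functions \<Omega>"
proof -
  have "closure {x. f x \<noteq> 0} \<subseteq> K"
    using assms by (intro closure_minimal) auto
  then show ?thesis
    using assms smooth_plane_Ck[OF assms(1)] unfolding test_functions_def
    by (auto intro: bounded_subset simp: compact_eq_bounded_closed)
qed

lemma has_grad_partials:
  fixes f :: "real^2 \<Rightarrow> complex"
  assumes "\<And>x. f differentiable (at x)"
  shows "has_grad f (pd1 f) (pd2 f)"
  unfolding has_grad_def
proof
  fix x
  let ?D = "frechet_derivative f (at x)"
  have D: "(f has_derivative ?D) (at x)"
    using assms frechet_derivative_works by blast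
  then interpret bounded_linear ?D by (rule has_derivative_bounded_linear)
  have "?D h = of_real (h$1) * pd1 f x + of_real (h$2) * pd2 f x" for h
  proof -
    have "h = h$1 *\<^sub>R axis 1 1 + h$2 *\<^sub>R axis 2 1"
      by (auto simp: vec_eq_iff forall_2)
    then have "?D h = ?D (h$1 *\<^sub>R axis 1 1 + h$2 *\<^sub>R axis 2 1)" by (rule arg_cong)
    also have "\<dots> = h$1 *\<^sub>R ?D (axis 1 1) + h$2 *\<^sub>R ?D (axis 2 1)" by (simp only: add scaleR)
    finally show ?thesis by (simp only: partial_deriv_def scaleR_conv_of_real)
  qed
  then have "?D = (\<lambda>h. of_real (h$1) * pd1 f x + of_real (h$2) * pd2 f x)"
    by blast
  with D show "(f has_derivative (\<lambda>h. of_real (h$1) * pd1 f x +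
      of_real (h$2) * pd2 f x)) (at x)"
    by (simp only:)
qed

lemma Ck_Suc_D:
  assumes "Ck (Suc k) (f :: real^2 \<Rightarrow> complex)"
  shows "has_grad f (pd1 f) (pd2 f)"
    "Ck k (pd1 f)" "Ck k (pd2 f)"
  using assms has_grad_partials by (auto simp: Basis_plane)

lemma test_functionD:
  assumes "\<eta> \<in> test_functions (UNIV :: (real^2) set)"
  shows "has_grad \<eta> (pd1 \<eta>) (pd2 \<eta>)"
    "Ck k \<eta>" "Ck k (pd1 \<eta>)" "Ck k (pd2 \<eta>)"
    "\<exists>R. \<forall>x. norm x > R \<longrightarrow> \<eta> x = 0"
proof -
  have c: "Ck k \<eta>" for k using assms by (auto simp: test_functions_def)
  from c Ck_Suc_D[of k \<eta>] show "Ck k \<eta>" "Ck k (pd1 \<eta>)" "Ck k (pd2 \<eta>)"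
    "has_grad \<eta> (pd1 \<eta>) (pd2 \<eta>)" by auto
  have "bounded (closure {x. \<eta> x \<noteq> 0})"
    using assms by (auto simp: test_functions_def compact_imp_bounded)
  then obtain R where "\<And>x. x \<in> closure {x. \<eta> x \<noteq> 0} \<Longrightarrow> norm x \<le> R"
    by (auto simp: bounded_iff)
  then show "\<exists>R. \<forall>x. norm x > R \<longrightarrow> \<eta> x = 0"
    by (intro exI[of _ R]) (metis (mono_tags, lifting) closure_subset mem_Collect_eq not_le subsetD)
qed

section \<open>Divergence theorem in polar form\<close>

lemma integrable_continuous_support:
  fixes g :: "'a::euclidean_space \<Rightarrow> 'b::{banach, second_countable_topology}"
  assumes "continuous_on UNIV g" "\<And>x. norm x > R \<Longrightarrow> g x = 0"
  shows "integrable lborel g"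
proof -
  have "integrable lborel (\<lambda>x. indicator (cball 0 R) x *\<^sub>R g x)"
    by (rule borel_integrable_compact[OF compact_cball continuous_on_subset[OF assms(1)]]) auto
  also have "(\<lambda>x. indicator (cball 0 R) x *\<^sub>R g x) = g"
    using assms(2) by (auto simp: fun_eq_iff indicator_def)
  finally show ?thesis .
qed

lemma lborel_integral_translation:
  fixes F :: "'a::euclidean_space \<Rightarrow> 'b::{banach, second_countable_topology}"
  assumes "F \<in> borel_measurable borel"
  shows "(LINT x|lborel. F (c + x)) = (LINT x|lborel. F x)"
    and "integrable lborel F \<Longrightarrow> integrable lborel (\<lambda>x. F (c + x))"
proof -
  show "(LINT x|lborel. F (c + x)) = (LINT x|lborel. F x)"
    using integral_distr[of "(+) c" lborel borel F] assms by (simp add: lborel_distr_plus)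
  show "integrable lborel (\<lambda>x. F (c + x))" if "integrable lborel F"
    using integrable_distr_eq[of "(+) c" lborel borel F] assms that by (simp add: lborel_distr_plus)
qed

lemma has_derivative_directional_limit:
  fixes F :: "'a::real_normed_vector \<Rightarrow> 'b::real_normed_vector"
  assumes D: "(F has_derivative F') (at x)"
  shows "((\<lambda>\<tau>. (F (\<tau> *\<^sub>R b + x) - F x) /\<^sub>R \<tau>) \<longlongrightarrow> F' b) (at 0)"
proof -
  have "((\<lambda>\<tau>. F (\<tau> *\<^sub>R b + x)) has_derivative (\<lambda>\<sigma>. F' (\<sigma> *\<^sub>R b))) (at 0)"
    by (rule has_derivative_compose[of _ _ 0 UNIV F F']) (use D in \<open>auto intro!: derivative_eq_intros\<close>)
  then have "((\<lambda>\<tau>. F (\<tau> *\<^sub>R b + x)) has_derivative (\<lambda>\<sigma>. \<sigma> *\<^sub>R F' b)) (at 0)"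
    using linear_scale[OF has_derivative_linear[OF D]] by simp
  then have A: "((\<lambda>\<tau>. norm (F (\<tau> *\<^sub>R b + x) - F x - \<tau> *\<^sub>R F' b) / norm \<tau>) \<longlongrightarrow> 0) (at 0)"
    by (simp add: has_derivative_at)
  have B: "norm (F (\<tau> *\<^sub>R b + x) - F x - \<tau> *\<^sub>R F' b) / norm \<tau> =
      norm ((F (\<tau> *\<^sub>R b + x) - F x) /\<^sub>R \<tau> - F' b)" if "\<tau> \<noteq> 0" for \<tau>
  proof -
    have "(F (\<tau> *\<^sub>R b + x) - F x) /\<^sub>R \<tau> - F' b = (F (\<tau> *\<^sub>R b + x) - F x - \<tau> *\<^sub>R F' b) /\<^sub>R \<tau>"
      using that by (simp add: scaleR_diff_right)
    then show ?thesis by (simp add: divide_inverse_commute)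
  qed
  have "((\<lambda>\<tau>. norm ((F (\<tau> *\<^sub>R b + x) - F x) /\<^sub>R \<tau> - F' b)) \<longlongrightarrow> 0) (at 0)"
    by (rule Lim_transform_eventually[OF A]) (use B in \<open>auto simp: eventually_at_filter\<close>)
  then show ?thesis by (simp only: LIM_zero_iff tendsto_norm_zero_iff)
qed

lemma norm_increment_le:
  fixes F :: "'a::real_normed_vector \<Rightarrow> 'b::real_inner"
  assumes D: "\<And>z. (F has_derivative F' z) (at z)"
    and C: "\<And>\<tau>. 0 < \<tau> \<Longrightarrow> \<tau> < 1 \<Longrightarrow> norm (F' (x + \<tau> *\<^sub>R v) v) \<le> C"
  shows "norm (F (x + v) - F x) \<le> C"
proof -
  have dd: "((\<lambda>\<tau>. F (x + \<tau> *\<^sub>R v)) has_derivative (\<lambda>\<sigma>. F' (x + \<tau> *\<^sub>R v) (\<sigma> *\<^sub>R v))) (at \<tau>)" for \<tau> :: real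
    by (rule has_derivative_compose[OF _ D]) (auto intro!: derivative_eq_intros)
  have "\<exists>\<tau>\<in>{0<..<1}. norm (F (x + 1 *\<^sub>R v) - F (x + 0 *\<^sub>R v)) \<le> norm (F' (x + \<tau> *\<^sub>R v) ((1 - 0) *\<^sub>R v))"
    by (rule mvt_general)
       (use dd in \<open>auto intro!: continuous_at_imp_continuous_on has_derivative_continuous\<close>)
  then show ?thesis using C by (force intro: order_trans)
qed

text \<open>By translation invariance every difference quotient of \<open>F\<close> has integral
  zero. The mean value inequality and the bounded support dominate these quotients, so the limit may
  be taken under the integral.\<close>

lemma integral_directional_derivative:
  fixes F :: "'a::euclidean_space \<Rightarrow> complex"
  assumes D: "\<And>x. (F has_derivative F' x) (at x)"
    and cont: "continuous_on UNIV (\<lambda>x. F' x b)"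
    and supp: "\<And>x. norm x > R \<Longrightarrow> F x = 0"
  shows "integrable lborel (\<lambda>x. F' x b)" "(LINT x|lborel. F' x b) = 0"
proof -
  have F0: "F' x b = 0" if "norm x > R" for x
  proof -
    have "((\<lambda>_. 0) has_derivative (\<lambda>_. 0)) (at x)" by simp
    then have "(F has_derivative (\<lambda>_. 0)) (at x)"
      by (rule has_derivative_transform_within_open[where s="- cball 0 R"]) (use that supp in auto)
    then show ?thesis using has_derivative_unique[OF D] by (metis (no_types, lifting))
  qed
  show int: "integrable lborel (\<lambda>x. F' x b)"
    by (rule integrable_continuous_support[OF cont F0])
  have contF: "continuous_on UNIV F"
    using D by (meson continuous_at_imp_continuous_on has_derivative_continuous)
  then have Fm: "F \<in> borel_measurable borel" by (rule borel_measurable_continuous_onI)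
  have intF: "integrable lborel F"
    by (rule integrable_continuous_support[OF contF supp])
  have "compact ((\<lambda>x. F' x b) ` cball 0 R)"
    by (intro compact_continuous_image continuous_on_subset[OF cont]) auto
  then obtain M where "\<forall>x\<in>cball 0 R. norm (F' x b) \<le> M"
    by (auto dest!: compact_imp_bounded simp: bounded_iff)
  then have M: "\<And>x. norm x \<le> R \<Longrightarrow> norm (F' x b) \<le> M" by simp
  define M' where "M' = max M 0"
  have M': "norm (F' x b) \<le> M'" for x
    using M[of x] F0[of x] by (cases "norm x \<le> R") (auto simp: M'_def)
  define h where "h n = 1 / real (Suc n)" for n
  have h: "h n > 0" "h n \<le> 1" for n by (auto simp: h_def)
  define s where "s n x = (F (h n *\<^sub>R b + x) - F x) /\<^sub>R h n" for n x
  have s_bound: "norm (s n x) \<le> M'" for n x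
  proof -
    have "norm (F (x + h n *\<^sub>R b) - F x) \<le> h n * M'"
    proof (rule norm_increment_le[OF D])
      fix \<tau> :: real
      show "norm (F' (x + \<tau> *\<^sub>R h n *\<^sub>R b) (h n *\<^sub>R b)) \<le> h n * M'"
        using M' h(1)[of n] linear_scale[OF has_derivative_linear[OF D]] by (simp add: mult_left_mono)
    qed
    then show ?thesis using h(1)[of n] unfolding s_def norm_scaleR by (simp add: field_simps)
  qed
  have s_supp: "s n x = 0" if "norm x > R + norm b" for n x
  proof -
    have "norm x - norm (h n *\<^sub>R b) \<le> norm (h n *\<^sub>R b + x)"
      by (metis add.commute norm_diff_ineq)
    moreover have "norm (h n *\<^sub>R b) \<le> norm b"
      using h[of n] mult_right_mono[of "h n" 1 "norm b"] by simp
    ultimately have "norm (h n *\<^sub>R b + x) > R" using that by linarith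
    moreover have "norm x > R" using that norm_ge_zero[of b] by linarith
    ultimately show ?thesis by (simp add: s_def supp)
  qed
  have "(\<lambda>n. LINT x|lborel. s n x) \<longlonglongrightarrow> (LINT x|lborel. F' x b)"
  proof (rule integral_dominated_convergence)
    show "(\<lambda>x. F' x b) \<in> borel_measurable lborel" using int by auto
    show "s n \<in> borel_measurable lborel" for n
      unfolding s_def using Fm by measurable
    show "integrable lborel (\<lambda>x. indicator (cball 0 (R + norm b)) x *\<^sub>R M')"
      by (rule borel_integrable_compact) auto
    show "AE x in lborel. norm (s n x) \<le> indicator (cball 0 (R + norm b)) x *\<^sub>R M'" for n
      using s_bound s_supp by (auto simp: indicator_def not_le)
    show "AE x in lborel. (\<lambda>n. s n x) \<longlonglongrightarrow> F' x b"
    proof (intro AE_I2)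
      fix x
      note * = has_derivative_directional_limit[OF D, of b x]
      have "filterlim h (at 0) sequentially"
        unfolding filterlim_at using h(1) LIMSEQ_inverse_real_of_nat
        by (auto simp: h_def[abs_def] inverse_eq_divide less_imp_neq[symmetric] intro!: eventuallyI)
      from filterlim_compose[OF * this] show "(\<lambda>n. s n x) \<longlonglongrightarrow> F' x b"
        by (simp add: s_def)
    qed
  qed
  moreover have "(LINT x|lborel. s n x) = 0" for n
    unfolding s_def using lborel_integral_translation[OF Fm, of "h n *\<^sub>R b"] intF by simp
  ultimately show "(LINT x|lborel. F' x b) = 0"
    using LIMSEQ_unique[OF _ tendsto_const] by simp
qed

text \<open>\<open>f\<close> vanishes near the origin and near infinity and is continuously differentiable, with
  \<open>e = r \<partial>\<^sub>r f\<close> and \<open>a = \<partial>\<^sub>\<theta> f\<close>.\<close>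

definition polar_C1 :: "(real^2 \<Rightarrow> complex) \<Rightarrow> (real^2 \<Rightarrow> complex) \<Rightarrow> (real^2 \<Rightarrow> complex) \<Rightarrow> bool" where
  "polar_C1 f e a \<longleftrightarrow>
     (\<exists>d>0. \<exists>R. \<forall>x. norm x < d \<or> norm x > R \<longrightarrow> f x = 0 \<and> e x = 0 \<and> a x = 0) \<and>
     continuous_on UNIV e \<and> continuous_on UNIV a \<and>
     (\<forall>x. x \<noteq> 0 \<longrightarrow> (f has_derivative (\<lambda>h. (of_real (x \<bullet> h) * e x +
        of_real (x$1 * h$2 - x$2 * h$1) * a x) / of_real (r2 x))) (at x))"

lemma continuous_on_zero_near_0:
  fixes g :: "'a::real_normed_vector \<Rightarrow> 'b::real_normed_vector"
  assumes "continuous_on (- {0}) g" "d > 0" "\<And>x. norm x < d \<Longrightarrow> g x = 0"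
  shows "continuous_on UNIV g"
proof -
  have "continuous_on (ball 0 d) g"
    by (rule continuous_on_eq[OF continuous_on_const[of _ 0]]) (use assms in auto)
  then have "continuous_on (ball 0 d \<union> - {0}) g"
    by (intro continuous_on_open_Un assms) auto
  also have "ball 0 d \<union> - {0} = (UNIV::'a set)" using assms by auto
  finally show ?thesis .
qed

lemma polar_C1_continuous:
  assumes "polar_C1 f e a"
  shows "continuous_on UNIV f"
proof -
  obtain d where d: "d > 0" "\<And>x. norm x < d \<Longrightarrow> f x = 0"
    using assms unfolding polar_C1_def by blast
  have "continuous_on (- {0}) f"
    using assms unfolding polar_C1_def
    by (intro continuous_at_imp_continuous_on ballI) (auto dest!: has_derivative_continuous)
  from continuous_on_zero_near_0[OF this d] show ?thesis by simp
qed

lemma polar_C1_support: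
  assumes "polar_C1 f e a"
  obtains d R where "d > 0" "\<And>x. norm x < d \<Longrightarrow> f x = 0 \<and> e x = 0 \<and> a x = 0"
    "\<And>x. norm x > R \<Longrightarrow> f x = 0 \<and> e x = 0 \<and> a x = 0"
  using assms unfolding polar_C1_def by blast

lemma polar_C1_derivative:
  "polar_C1 f e a \<Longrightarrow> x \<noteq> 0 \<Longrightarrow> (f has_derivative (\<lambda>h. (of_real (x \<bullet> h) * e x +
        of_real (x$1 * h$2 - x$2 * h$1) * a x) / of_real (r2 x))) (at x)"
  by (simp add: polar_C1_def)

lemma polar_C1_continuous_ea:
  "polar_C1 f e a \<Longrightarrow> continuous_on UNIV e" "polar_C1 f e a \<Longrightarrow> continuous_on UNIV a"
  by (auto simp: polar_C1_def)

text \<open>\<open>I\<close> is the derivative of the product \<open>u f\<close> in the direction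
  \<open>b\<close>, written in polar quantities. The weight \<open>u\<close> may be singular at the
  origin because \<open>f\<close> vanishes near it.\<close>

lemma polar_C1_weighted_integral:
  fixes u :: "real^2 \<Rightarrow> real"
  assumes f: "polar_C1 f e a"
    and u: "\<And>x. x \<noteq> 0 \<Longrightarrow> (u has_derivative u' x) (at x)"
    and u'b: "continuous_on (- {0}) (\<lambda>x. u' x b)"
    and I: "\<And>x. x \<noteq> 0 \<Longrightarrow> I x = of_real (u x) * ((of_real (x \<bullet> b) * e x +
        of_real (x$1 * b$2 - x$2 * b$1) * a x) / of_real (r2 x)) + of_real (u' x b) * f x"
    and I0: "I 0 = 0"
  shows "integrable lborel I" "(LINT x|lborel. I x) = 0"
proof -
  obtain d R where d: "d > 0" "\<And>x. norm x < d \<Longrightarrow> f x = 0 \<and> e x = 0 \<and> a x = 0"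
    and R: "\<And>x. norm x > R \<Longrightarrow> f x = 0 \<and> e x = 0 \<and> a x = 0"
    using polar_C1_support[OF f] by metis
  define F' where "F' x h = (if x = 0 then 0 else of_real (u x) * ((of_real (x \<bullet> h) * e x +
        of_real (x$1 * h$2 - x$2 * h$1) * a x) / of_real (r2 x)) + of_real (u' x h) * f x)" for x h
  have I_eq: "I x = F' x b" for x
    using I[of x] I0 by (cases "x = 0") (auto simp: F'_def)
  have D: "((\<lambda>x. of_real (u x) * f x) has_derivative F' x) (at x)" for x
  proof (cases "x = 0")
    case True
    have "((\<lambda>_. 0) has_derivative (\<lambda>_. 0)) (at x)" by simp
    then have "((\<lambda>x. of_real (u x) * f x) has_derivative (\<lambda>_. 0)) (at x)"
      by (rule has_derivative_transform_within_open[where s="ball 0 d"]) (use d True in auto)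
    then show ?thesis using True by (simp add: F'_def[abs_def])
  next
    case False
    show ?thesis
      by (rule has_derivative_eq_rhs[OF has_derivative_mult[OF has_derivative_of_real[OF u[OF False]] polar_C1_derivative[OF f False]]])
         (use False in \<open>simp add: F'_def fun_eq_iff\<close>)
  qed
  have cont: "continuous_on UNIV (\<lambda>x. F' x b)"
  proof (rule continuous_on_zero_near_0[OF _ d(1)])
    have "continuous_on (- {0}) u"
      using u by (intro continuous_at_imp_continuous_on ballI) (auto dest!: has_derivative_continuous)
    then have "continuous_on (- {0}) (\<lambda>x. of_real (u x) * ((of_real (x \<bullet> b) * e x +
        of_real (x$1 * b$2 - x$2 * b$1) * a x) / of_real (r2 x)) + of_real (u' x b) * f x)"
      using u'b polar_C1_continuous[OF f] polar_C1_continuous_ea[OF f]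
      by (intro continuous_intros) (auto intro: continuous_on_subset)
    then show "continuous_on (- {0}) (\<lambda>x. F' x b)"
      by (rule continuous_on_eq) (auto simp: F'_def)
    show "F' x b = 0" if "norm x < d" for x using d(2)[OF that] by (simp add: F'_def)
  qed
  have supp: "of_real (u x) * f x = 0" if "norm x > R" for x using R[OF that] by simp
  show "integrable lborel I" "(LINT x|lborel. I x) = 0"
    using integral_directional_derivative[OF D cont supp] by (simp_all add: I_eq[abs_def])
qed

text \<open>The function \<open>a\<close> is the divergence of \<open>f\<close> times the rotation
  field \<open>(- y, x)\<close>, which is itself free of divergence.\<close>

lemma polar_C1_integral_angular:
  assumes "polar_C1 f e a"
  shows "(LINT x|lborel. a x) = 0"
proof -
  have a0: "a 0 = 0" "e 0 = 0" "f 0 = 0" using polar_C1_support[OF assms] by (metis norm_zero)+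
  have d: "((\<lambda>x::real^2. x $ i) has_derivative (\<lambda>h. h $ i)) (at x)" for i x
    by (rule has_derivative_coord)
  have d': "((\<lambda>x::real^2. - (x $ i)) has_derivative (\<lambda>h. - (h $ i))) (at x)" for i x
    by (intro has_derivative_minus d)
  let ?I1 = "\<lambda>x. - of_real (x$2) * ((of_real (x$1) * e x - of_real (x$2) * a x) / of_real (r2 x))"
  let ?I2 = "\<lambda>x. of_real (x$1) * ((of_real (x$2) * e x + of_real (x$1) * a x) / of_real (r2 x))"
  note 1 = polar_C1_weighted_integral[OF assms d'[where i=2], where b="axis 1 1" and I="?I1"]
  note 2 = polar_C1_weighted_integral[OF assms d[where i=1], where b="axis 2 1" and I="?I2"]
  have "integrable lborel ?I1" "(LINT x|lborel. ?I1 x) = 0"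
    by (rule 1; simp add: a0 inner_axis)+
  moreover have "integrable lborel ?I2" "(LINT x|lborel. ?I2 x) = 0"
    by (rule 2; simp add: a0 inner_axis)+
  ultimately have "(LINT x|lborel. ?I1 x + ?I2 x) = 0" by simp
  also have "(\<lambda>x. ?I1 x + ?I2 x) = a"
  proof
    fix x :: "real^2"
    show "?I1 x + ?I2 x = a x"
    proof (cases "x = 0")
      case False
      define t where "t = complex_of_real (r2 x)"
      have t: "t \<noteq> 0" using False by (simp add: t_def)
      have t2: "of_real (x$1) * of_real (x$1) + of_real (x$2) * of_real (x$2) = t"
        by (simp add: inner_plane t_def)
      have "?I1 x + ?I2 x = a x * (of_real (x$1) * of_real (x$1) + of_real (x$2) * of_real (x$2)) / t"
        using t by (simp flip: t_def add: field_simps)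
      then show ?thesis using t by (simp add: t2)
    qed (simp add: a0)
  qed
  finally show ?thesis .
qed

text \<open>The integrand is the divergence of \<open>f x / r^2\<close>: in the plane the field
  \<open>x / r^2\<close> has no divergence away from the origin.\<close>

lemma polar_C1_integral_radial:
  assumes "polar_C1 f e a"
  shows "(LINT x|lborel. e x / of_real (r2 x)) = 0"
proof -
  have a0: "a 0 = 0" "e 0 = 0" "f 0 = 0" using polar_C1_support[OF assms] by (metis norm_zero)+
  have d: "((\<lambda>x::real^2. x $ i / (r2 x)) has_derivative
     (\<lambda>h. (h $ i * (r2 x) - x $ i * (2 * (x \<bullet> h))) / ((r2 x) * (r2 x)))) (at x)" if "x \<noteq> 0" for i x
    by (rule has_derivative_eq_rhs[OF has_derivative_divide'[OF has_derivative_coord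
          has_derivative_inner[OF has_derivative_ident has_derivative_ident]]])
       (use that in \<open>auto simp: fun_eq_iff inner_commute power2_eq_square\<close>)
  have c: "continuous_on (- {0}) (\<lambda>x. (axis k 1 $ i * (r2 x) - x $ i * (2 * (x \<bullet> axis k 1))) / ((r2 x) * (r2 x)))" for i k :: 2
    by (intro continuous_intros) auto
  let ?I1 = "\<lambda>x. of_real (x$1 / (r2 x)) * ((of_real (x$1) * e x - of_real (x$2) * a x) / of_real (r2 x))
     + of_real (((r2 x) - x $ 1 * (2 * x$1)) / ((r2 x) * (r2 x))) * f x"
  let ?I2 = "\<lambda>x. of_real (x$2 / (r2 x)) * ((of_real (x$2) * e x + of_real (x$1) * a x) / of_real (r2 x))
     + of_real (((r2 x) - x $ 2 * (2 * x$2)) / ((r2 x) * (r2 x))) * f x"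
  have "integrable lborel ?I1" "(LINT x|lborel. ?I1 x) = 0"
    by (rule polar_C1_weighted_integral[OF assms d[where i=1] c[where i=1 and k=1], where I="?I1"]; simp add: a0 inner_axis)+
  moreover have "integrable lborel ?I2" "(LINT x|lborel. ?I2 x) = 0"
    by (rule polar_C1_weighted_integral[OF assms d[where i=2] c[where i=2 and k=2], where I="?I2"]; simp add: a0 inner_axis)+
  ultimately have "(LINT x|lborel. ?I1 x + ?I2 x) = 0" by simp
  also have "(\<lambda>x. ?I1 x + ?I2 x) = (\<lambda>x. e x / of_real (r2 x))"
  proof
    fix x :: "real^2"
    show "?I1 x + ?I2 x = e x / of_real (r2 x)"
    proof (cases "x = 0")
      case False
      define t where "t = complex_of_real (r2 x)"
      have t: "t \<noteq> 0" using False by (simp add: t_def)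
      have t2: "t = of_real (x$1) * of_real (x$1) + of_real (x$2) * of_real (x$2)"
        by (simp add: inner_plane t_def)
      have "?I1 x + ?I2 x = (e x * (of_real (x$1) * of_real (x$1) + of_real (x$2) * of_real (x$2))
          + 2 * f x * (t - (of_real (x$1) * of_real (x$1) + of_real (x$2) * of_real (x$2)))) / (t * t)"
        using t by (simp flip: t_def add: field_simps)
      also have "\<dots> = e x / t" using t by (simp flip: t2)
      finally show ?thesis by (simp add: t_def)
    qed (simp add: a0)
  qed
  finally show ?thesis .
qed

lemma polar_C1I:
  assumes "d > 0" "\<And>x. norm x < d \<Longrightarrow> f x = 0 \<and> e x = 0 \<and> a x = 0"
    "\<And>x. norm x > R \<Longrightarrow> f x = 0 \<and> e x = 0 \<and> a x = 0"
    "continuous_on UNIV e" "continuous_on UNIV a"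
    "\<And>x. x \<noteq> 0 \<Longrightarrow> (f has_derivative (\<lambda>h. (of_real (x \<bullet> h) * e x +
        of_real (x$1 * h$2 - x$2 * h$1) * a x) / of_real (r2 x))) (at x)"
  shows "polar_C1 f e a"
  unfolding polar_C1_def using assms by blast

lemma polar_C1_mult:
  assumes f: "polar_C1 f e a" and g: "polar_C1 g e' a'"
  shows "polar_C1 (\<lambda>x. f x * g x) (\<lambda>x. f x * e' x + e x * g x) (\<lambda>x. f x * a' x + a x * g x)"
proof -
  obtain d R where d: "d > 0" "\<And>x. norm x < d \<Longrightarrow> f x = 0 \<and> e x = 0 \<and> a x = 0"
    "\<And>x. norm x > R \<Longrightarrow> f x = 0 \<and> e x = 0 \<and> a x = 0"
    using polar_C1_support[OF f] by metis
  show ?thesis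
  proof (rule polar_C1I[OF d(1)])
    fix x :: "real^2" assume x: "x \<noteq> 0"
    show "((\<lambda>x. f x * g x) has_derivative (\<lambda>h. (of_real (x \<bullet> h) * (f x * e' x + e x * g x) +
        of_real (x$1 * h$2 - x$2 * h$1) * (f x * a' x + a x * g x)) / of_real (r2 x))) (at x)"
      by (rule has_derivative_eq_rhs[OF has_derivative_mult[OF polar_C1_derivative[OF f x] polar_C1_derivative[OF g x]]])
         (use x in \<open>simp add: fun_eq_iff field_simps\<close>)
  qed (use d polar_C1_continuous[OF f] polar_C1_continuous[OF g] polar_C1_continuous_ea[OF f] polar_C1_continuous_ea[OF g]
      in \<open>auto intro!: continuous_intros\<close>)
qed

lemma polar_C1_add:
  assumes f: "polar_C1 f e a" and g: "polar_C1 g e' a'"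
  shows "polar_C1 (\<lambda>x. f x + g x) (\<lambda>x. e x + e' x) (\<lambda>x. a x + a' x)"
proof -
  obtain d R where d: "d > 0" "\<And>x. norm x < d \<Longrightarrow> f x = 0 \<and> e x = 0 \<and> a x = 0"
    "\<And>x. norm x > R \<Longrightarrow> f x = 0 \<and> e x = 0 \<and> a x = 0"
    using polar_C1_support[OF f] by metis
  obtain d' R' where d': "d' > 0" "\<And>x. norm x < d' \<Longrightarrow> g x = 0 \<and> e' x = 0 \<and> a' x = 0"
    "\<And>x. norm x > R' \<Longrightarrow> g x = 0 \<and> e' x = 0 \<and> a' x = 0"
    using polar_C1_support[OF g] by metis
  show ?thesis
  proof (rule polar_C1I[of "min d d'" _ _ _ "max R R'"])
    fix x :: "real^2" assume x: "x \<noteq> 0"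
    show "((\<lambda>x. f x + g x) has_derivative (\<lambda>h. (of_real (x \<bullet> h) * (e x + e' x) +
        of_real (x$1 * h$2 - x$2 * h$1) * (a x + a' x)) / of_real (r2 x))) (at x)"
      by (rule has_derivative_eq_rhs[OF has_derivative_add[OF polar_C1_derivative[OF f x] polar_C1_derivative[OF g x]]])
         (use x in \<open>simp add: fun_eq_iff field_simps\<close>)
  qed (use d d' polar_C1_continuous_ea[OF f] polar_C1_continuous_ea[OF g]
      in \<open>auto intro!: continuous_intros\<close>)
qed

lemma polar_C1_cmult:
  assumes f: "polar_C1 f e a"
  shows "polar_C1 (\<lambda>x. c * f x) (\<lambda>x. c * e x) (\<lambda>x. c * a x)"
proof -
  obtain d R where d: "d > 0" "\<And>x. norm x < d \<Longrightarrow> f x = 0 \<and> e x = 0 \<and> a x = 0"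
    "\<And>x. norm x > R \<Longrightarrow> f x = 0 \<and> e x = 0 \<and> a x = 0"
    using polar_C1_support[OF f] by metis
  show ?thesis
  proof (rule polar_C1I[OF d(1)])
    fix x :: "real^2" assume x: "x \<noteq> 0"
    show "((\<lambda>x. c * f x) has_derivative (\<lambda>h. (of_real (x \<bullet> h) * (c * e x) +
        of_real (x$1 * h$2 - x$2 * h$1) * (c * a x)) / of_real (r2 x))) (at x)"
      by (rule has_derivative_eq_rhs[OF has_derivative_mult[OF has_derivative_const polar_C1_derivative[OF f x]]])
         (use x in \<open>simp add: fun_eq_iff field_simps\<close>)
  qed (use d polar_C1_continuous_ea[OF f] in \<open>auto intro!: continuous_intros\<close>)
qed

lemma polar_C1_cnj:
  assumes f: "polar_C1 f e a"
  shows "polar_C1 (\<lambda>x. cnj (f x)) (\<lambda>x. cnj (e x)) (\<lambda>x. cnj (a x))"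
proof -
  obtain d R where d: "d > 0" "\<And>x. norm x < d \<Longrightarrow> f x = 0 \<and> e x = 0 \<and> a x = 0"
    "\<And>x. norm x > R \<Longrightarrow> f x = 0 \<and> e x = 0 \<and> a x = 0"
    using polar_C1_support[OF f] by metis
  show ?thesis
  proof (rule polar_C1I[OF d(1)])
    fix x :: "real^2" assume x: "x \<noteq> 0"
    show "((\<lambda>x. cnj (f x)) has_derivative (\<lambda>h. (of_real (x \<bullet> h) * cnj (e x) +
        of_real (x$1 * h$2 - x$2 * h$1) * cnj (a x)) / of_real (r2 x))) (at x)"
      by (rule has_derivative_eq_rhs[OF has_derivative_cnj[OF polar_C1_derivative[OF f x]]]) simp
  qed (use d polar_C1_continuous_ea[OF f] in \<open>auto intro!: continuous_intros\<close>)
qed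

lemma continuous_on_radial:
  fixes H :: "real \<Rightarrow> real"
  assumes "continuous_on {0<..} H"
  shows "continuous_on (- {0}) (\<lambda>x::'a::real_inner. H (r2 x))"
  by (rule continuous_on_compose2[OF assms]) (auto intro!: continuous_intros)

lemma has_derivative_radial:
  fixes H :: "real \<Rightarrow> real" and x :: "'a::real_inner"
  assumes "(H has_real_derivative H') (at (r2 x))"
  shows "((\<lambda>x. H (r2 x)) has_derivative (\<lambda>k. H' * (2 * (x \<bullet> k)))) (at x)"
proof -
  have "((\<lambda>x. x \<bullet> x) has_derivative (\<lambda>k. 2 * (x \<bullet> k))) (at x)"
    by (rule has_derivative_eq_rhs[OF has_derivative_inner[OF has_derivative_ident has_derivative_ident]])
       (auto simp: inner_commute)
  from has_derivative_compose[OF this assms[unfolded has_field_derivative_def]] show ?thesis .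
qed

lemma polar_C1_radial:
  assumes f: "polar_C1 f e a"
    and H: "\<And>t. t > 0 \<Longrightarrow> (H has_real_derivative H' t) (at t)" and H': "continuous_on {0<..} H'"
  shows "polar_C1 (\<lambda>x. of_real (H (r2 x)) * f x)
     (\<lambda>x. of_real (H (r2 x)) * e x + of_real (2 * (r2 x) * H' (r2 x)) * f x)
     (\<lambda>x. of_real (H (r2 x)) * a x)"
proof -
  obtain d R where d: "d > 0" "\<And>x. norm x < d \<Longrightarrow> f x = 0 \<and> e x = 0 \<and> a x = 0"
    "\<And>x. norm x > R \<Longrightarrow> f x = 0 \<and> e x = 0 \<and> a x = 0"
    using polar_C1_support[OF f] by metis
  have "continuous_on {0<..} H"
    using H by (intro continuous_at_imp_continuous_on ballI) (auto intro: DERIV_isCont)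
  note cont = continuous_on_radial[OF this] continuous_on_radial[OF H']
    polar_C1_continuous[OF f] polar_C1_continuous_ea[OF f]
  show ?thesis
  proof (rule polar_C1I[OF d(1)])
    show "continuous_on UNIV (\<lambda>x. of_real (H (r2 x)) * e x + of_real (2 * (r2 x) * H' (r2 x)) * f x)"
      "continuous_on UNIV (\<lambda>x. of_real (H (r2 x)) * a x)"
      by (rule continuous_on_zero_near_0[OF _ d(1)]; use d cont in \<open>auto intro!: continuous_intros intro: continuous_on_subset\<close>)+
    fix x :: "real^2" assume x: "x \<noteq> 0"
    have Hx: "((\<lambda>x. H (r2 x)) has_derivative (\<lambda>k. H' (r2 x) * (2 * (x \<bullet> k)))) (at x)"
      by (rule has_derivative_radial) (use H x in auto)
    show "((\<lambda>x. of_real (H (r2 x)) * f x) has_derivative (\<lambda>h. (of_real (x \<bullet> h) * (of_real (H (r2 x)) * e x + of_real (2 * (r2 x) * H' (r2 x)) * f x) +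
        of_real (x$1 * h$2 - x$2 * h$1) * (of_real (H (r2 x)) * a x)) / of_real (r2 x))) (at x)"
      by (rule has_derivative_eq_rhs[OF has_derivative_mult[OF has_derivative_of_real[OF Hx] polar_C1_derivative[OF f x]]])
         (use x in \<open>simp add: fun_eq_iff field_simps\<close>)
  qed (use d in auto)
qed

text \<open>The source of \<open>polar_C1\<close> functions, to which the closure rules above are
  then applied. The factor \<open>2 r^2\<close> in front of \<open>H'\<close> is what
  \<open>r d/dr\<close> produces on a function of \<open>r^2\<close>.\<close>

lemma polar_C1_cutoff:
  assumes p: "has_grad p p1 p2" "continuous_on UNIV p1" "continuous_on UNIV p2"
    and H: "\<And>t. (H has_real_derivative H' t) (at t)" "continuous_on UNIV H'"
    and d: "d > 0" "\<And>t. t < d \<Longrightarrow> H t = 0" "\<And>t. t > R \<Longrightarrow> H t = 0"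
  shows "polar_C1 (\<lambda>x. of_real (H (r2 x)) * p x)
     (\<lambda>x. of_real (H (r2 x)) * (rdr p1 p2 x) + of_real (2 * (r2 x) * H' (r2 x)) * p x)
     (\<lambda>x. of_real (H (r2 x)) * (dth p1 p2 x))"
proof -
  have contH: "continuous_on UNIV H"
    using H by (intro continuous_at_imp_continuous_on ballI) (auto intro: DERIV_isCont)
  have H0: "H' t = 0" if "t < d \<or> t > R" for t
  proof -
    have "(H has_real_derivative 0) (at t)"
      by (rule has_field_derivative_transform_within_open[where S="{..<d} \<union> {R<..}" and f="\<lambda>_. 0"])
         (use that d in auto)
    then show ?thesis using H(1) DERIV_unique by blast
  qed
  have cont: "continuous_on UNIV (\<lambda>x::real^2. H (r2 x))" "continuous_on UNIV (\<lambda>x::real^2. H' (r2 x))"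
    by (rule continuous_on_compose2[OF contH] continuous_on_compose2[OF H(2)]; auto intro!: continuous_intros)+
  have d': "x \<bullet> x < d" if "norm x < sqrt d" for x :: "real^2"
    using that by (simp add: norm_eq_sqrt_inner)
  have R': "x \<bullet> x > R" if "norm x > sqrt \<bar>R\<bar>" for x :: "real^2"
    using that by (simp add: norm_eq_sqrt_inner)
  show ?thesis
  proof (rule polar_C1I[of "sqrt d" _ _ _ "sqrt \<bar>R\<bar>"])
    show "sqrt d > 0" using d by simp
    fix x :: "real^2" assume x: "x \<noteq> 0"
    have Hx: "((\<lambda>x. H (r2 x)) has_derivative (\<lambda>k. H' (r2 x) * (2 * (x \<bullet> k)))) (at x)"
      by (rule has_derivative_radial) (use H in auto)
    have xx: "complex_of_real (r2 x) \<noteq> 0" using x by simp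
    have gr: "of_real (h$1) * p1 x + of_real (h$2) * p2 x = (of_real (x \<bullet> h) * (rdr p1 p2 x) +
        of_real (x$1 * h$2 - x$2 * h$1) * (dth p1 p2 x)) / of_real (r2 x)" for h
      by (subst nonzero_eq_divide_eq[OF xx]) (simp add: inner_plane algebra_simps)
    show "((\<lambda>x. of_real (H (r2 x)) * p x) has_derivative (\<lambda>h. (of_real (x \<bullet> h) * (of_real (H (r2 x)) * (rdr p1 p2 x) + of_real (2 * (r2 x) * H' (r2 x)) * p x) +
        of_real (x$1 * h$2 - x$2 * h$1) * (of_real (H (r2 x)) * (dth p1 p2 x))) / of_real (r2 x))) (at x)"
    proof (rule has_derivative_eq_rhs[OF has_derivative_mult[OF has_derivative_of_real[OF Hx] has_gradD[OF p(1)]]], rule ext)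
      fix h :: "real^2"
      have alg: "a * ((X * A + Y * B) / T) + b * (2 * X) * q = (X * (a * A + 2 * T * b * q) + Y * (a * B)) / T"
        if "T \<noteq> 0" for a b A B X Y T q :: complex
        using that by (simp add: field_simps)
      show "of_real (H (r2 x)) * (of_real (h$1) * p1 x + of_real (h$2) * p2 x) + of_real (H' (r2 x) * (2 * (x \<bullet> h))) * p x =
        (of_real (x \<bullet> h) * (of_real (H (r2 x)) * (rdr p1 p2 x) + of_real (2 * (r2 x) * H' (r2 x)) * p x) +
        of_real (x$1 * h$2 - x$2 * h$1) * (of_real (H (r2 x)) * (dth p1 p2 x))) / of_real (r2 x)"
        using alg[OF xx] by (simp only: gr[of h] of_real_mult of_real_numeral)
    qed
  qed (use d' R' d(2,3) H0 cont p(2,3) has_grad_continuous[OF p(1)] in \<open>auto intro!: continuous_intros\<close>)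
qed

lemma integrable_annulus:
  fixes g :: "'a::euclidean_space \<Rightarrow> 'b::{banach, second_countable_topology}"
  assumes "continuous_on (- {0}) g" "d > 0" "\<And>x. norm x < d \<Longrightarrow> g x = 0" "\<And>x. norm x > R \<Longrightarrow> g x = 0"
  shows "integrable lborel g"
  by (rule integrable_continuous_support[OF continuous_on_zero_near_0[OF assms(1-3)] assms(4)])

lemma polar_C1_integrable_radial:
  assumes "polar_C1 f e a"
  shows "integrable lborel (\<lambda>x. e x / of_real (r2 x))"
proof -
  obtain d R where d: "d > 0" "\<And>x. norm x < d \<Longrightarrow> f x = 0 \<and> e x = 0 \<and> a x = 0"
    "\<And>x. norm x > R \<Longrightarrow> f x = 0 \<and> e x = 0 \<and> a x = 0"
    using polar_C1_support[OF assms] by metis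
  show ?thesis
    by (rule integrable_annulus[OF _ d(1), where R=R])
       (use d polar_C1_continuous_ea[OF assms] in \<open>auto intro!: continuous_intros intro: continuous_on_subset\<close>)
qed

section \<open>Nonnegativity on angular modes\<close>

text \<open>In the variable \<open>t = r\<^sup>2\<close>, \<open>W\<close> is \<open>1 / (2 - \<Phi>\<^sup>2)\<close>, and \<open>Pot\<close>, \<open>Con\<close> are the coefficients of \<open>\<phi>\<close> and its
  conjugate in the operator.\<close>

definition W :: "real \<Rightarrow> real" where "W t = (t + 4) / (t + 8)"

definition Pot :: "real \<Rightarrow> real" where
  "Pot t = (t^4 / 2 + 12 * t^3 + 48 * t^2 - 16 * t + 128) / (t * (t + 4)^2 * (t + 8))"

definition Con :: "real \<Rightarrow> real" where
  "Con t = (t^3 / 2 + 12 * t^2 + 56 * t) / ((t + 4)^2 * (t + 8))"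

lemma W_bounds: "t > 0 \<Longrightarrow> W t > 0" "t > 0 \<Longrightarrow> W t < 1"
  by (auto simp: W_def)

lemma Pot_plus_Con: "t > 0 \<Longrightarrow> t * (Pot t + Con t) = (t^4 + 24 * t^3 + 104 * t^2 - 16 * t + 128) / ((t + 4)^2 * (t + 8))"
  unfolding Pot_def Con_def by (simp add: divide_simps) (simp add: algebra_simps power2_eq_square power3_eq_cube power4_eq_xxxx)

lemma Pot_minus_Con: "t > 0 \<Longrightarrow> t * (Pot t - Con t) = (128 - 16 * t - 8 * t^2) / ((t + 4)^2 * (t + 8))"
  unfolding Pot_def Con_def by (simp add: divide_simps) (simp add: algebra_simps power2_eq_square power3_eq_cube power4_eq_xxxx)

text \<open>For a positive weight \<open>A\<close> of the radial variable and \<open>H = W r A' / A\<close>, the residual is \<open>r\<^sup>2 / A\<close> times the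
  radial Schroedinger operator applied to \<open>A\<close>, as a function of \<open>t = r\<^sup>2\<close>; \<open>H'\<close> is the derivative of \<open>H\<close> in \<open>t\<close>.
  The pairs of weights used below are \<open>(\<Phi>, \<Phi>)\<close> for \<open>m = 0\<close>, \<open>(\<Phi>', \<Phi> / r)\<close> for \<open>\<bar>m\<bar> = 1\<close> and \<open>\<bar>m\<bar> \<ge> 3\<close>, and
  \<open>(8 \<Phi> / (t + 8), \<Phi>)\<close> for \<open>\<bar>m\<bar> = 2\<close>. For \<open>\<bar>m\<bar> \<ge> 3\<close> the growth of \<open>m\<^sup>2\<close> beats that of the coupling
  because \<open>W < 1\<close>; \<open>m = 2\<close> is too small for this.\<close>

definition picone_residual :: "real \<Rightarrow> (real \<Rightarrow> real) \<Rightarrow> (real \<Rightarrow> real) \<Rightarrow> (real \<Rightarrow> real) \<Rightarrow> real \<Rightarrow> real" where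
  "picone_residual k V H H' t = W t * (k^2 + t * V t) - (H t)^2 / W t - 2 * t * H' t"

text \<open>\<open>4 / (t + 8)\<close> is \<open>W r A' / A\<close> for the weight
  \<open>A = \<Phi>\<close>. The second residual is exactly zero because \<open>\<i> \<Phi>\<close>
  is the zero mode generated by the global phase rotation.\<close>

lemma picone_0:
  assumes "t > 0"
  shows "picone_residual 0 (\<lambda>t. Pot t + Con t) (\<lambda>t. 4 / (t + 8)) (\<lambda>t. - 4 / (t + 8)^2) t \<ge> 0"
    "picone_residual 0 (\<lambda>t. Pot t - Con t) (\<lambda>t. 4 / (t + 8)) (\<lambda>t. - 4 / (t + 8)^2) t \<ge> 0"
proof -
  have "picone_residual 0 (\<lambda>t. Pot t + Con t) (\<lambda>t. 4 / (t + 8)) (\<lambda>t. - 4 / (t + 8)^2) t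
     = (t^4 + 24 * t^3 + 112 * t^2) / ((t + 4) * (t + 8)^2)"
    unfolding picone_residual_def Pot_plus_Con[OF assms] W_def using assms
    by (simp add: divide_simps) algebra
  then show "picone_residual 0 (\<lambda>t. Pot t + Con t) (\<lambda>t. 4 / (t + 8)) (\<lambda>t. - 4 / (t + 8)^2) t \<ge> 0"
    using assms by simp
  have "picone_residual 0 (\<lambda>t. Pot t - Con t) (\<lambda>t. 4 / (t + 8)) (\<lambda>t. - 4 / (t + 8)^2) t = 0"
    unfolding picone_residual_def Pot_minus_Con[OF assms] W_def using assms
    by (simp add: divide_simps) algebra
  then show "picone_residual 0 (\<lambda>t. Pot t - Con t) (\<lambda>t. 4 / (t + 8)) (\<lambda>t. - 4 / (t + 8)^2) t \<ge> 0"
    by simp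
qed

text \<open>The factor \<open>(t + 4) / 4\<close> is the ratio \<open>(\<Phi> / r) / \<Phi>'\<close>
  of the two weights. For \<open>k^2 = 1\<close> only the terms with this ratio and its inverse
  remain, and their product is exactly the square of the coupling \<open>4 W^2\<close>: the pair of
  weights is then a genuine zero mode.\<close>

lemma picone_1:
  assumes "t > 0"
  shows "picone_residual k (\<lambda>t. Pot t + Con t) (\<lambda>t. - 3 * t / (t + 8)) (\<lambda>t. - 24 / (t + 8)^2) t
      = (k^2 - 1) * W t + 4 * (W t)^2 * ((t + 4) / 4)"
    "picone_residual k (\<lambda>t. Pot t - Con t) (\<lambda>t. - t / (t + 8)) (\<lambda>t. - 8 / (t + 8)^2) t
      = (k^2 - 1) * W t + 4 * (W t)^2 / ((t + 4) / 4)"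
  unfolding picone_residual_def Pot_plus_Con[OF assms] Pot_minus_Con[OF assms] W_def using assms
  by (simp add: divide_simps; algebra)+

text \<open>Here \<open>(t + 8) / 8\<close> is the ratio of the two weights and \<open>8 W^2\<close>
  is the coupling \<open>4 W^2 k\<close> at \<open>k = 2\<close>. The remaining fractions are a
  nonnegative surplus, so the weights form a strict supersolution.\<close>

lemma picone_2:
  assumes "t > 0"
  shows "picone_residual 2 (\<lambda>t. Pot t + Con t) (\<lambda>t. 4 / (t + 8) - 2 * t * (t + 4) / (t + 8)^2)
      (\<lambda>t. - 4 / (t + 8)^2 - 2 * (12 * t + 32) / (t + 8)^3) t
      = 8 * (W t)^2 * ((t + 8) / 8) + (4 * t^4 + 128 * t^3 + 576 * t^2) / ((t + 4) * (t + 8)^3)"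
    "picone_residual 2 (\<lambda>t. Pot t - Con t) (\<lambda>t. 4 / (t + 8)) (\<lambda>t. - 4 / (t + 8)^2) t
      = 8 * (W t)^2 / ((t + 8) / 8) + (4 * t^3 + 16 * t^2) / (t + 8)^3"
  unfolding picone_residual_def Pot_plus_Con[OF assms] Pot_minus_Con[OF assms] W_def using assms
  by (simp add: divide_simps; algebra)+

lemma quadratic_form_nonneg:
  fixes E1 E2 F x y z :: real
  assumes "E1 \<ge> 0" "E2 \<ge> 0" "F^2 \<le> E1 * E2" "\<bar>z\<bar> \<le> x * y" "x \<ge> 0" "y \<ge> 0"
  shows "E1 * x^2 + E2 * y^2 + 2 * F * z \<ge> 0"
proof -
  have "\<bar>F * z\<bar> \<le> \<bar>F\<bar> * (x * y)" using assms by (simp add: abs_mult mult_left_mono)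
  also have "\<dots> \<le> sqrt (E1 * E2) * (x * y)"
    using assms by (intro mult_right_mono real_le_rsqrt) auto
  also have "\<dots> = (sqrt E1 * x) * (sqrt E2 * y)" by (simp add: real_sqrt_mult)
  finally have "2 * \<bar>F * z\<bar> \<le> 2 * ((sqrt E1 * x) * (sqrt E2 * y))" by simp
  also have "\<dots> \<le> (sqrt E1 * x)^2 + (sqrt E2 * y)^2"
    using sum_squares_bound[of "sqrt E1 * x" "sqrt E2 * y"] by (simp add: mult.assoc)
  also have "\<dots> = E1 * x^2 + E2 * y^2" using assms by (simp add: power_mult_distrib)
  finally show ?thesis by linarith
qed

text \<open>Picone's argument: the divergence of the radial field with density
  \<open>K1 |a|^2 + K2 |s|^2\<close> integrates to zero and may be subtracted from the form.
  Completing the square in \<open>ea\<close> and \<open>es\<close> costs \<open>K^2 / W\<close>, and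
  what is left is a quadratic form in \<open>|a|\<close> and \<open>|s|\<close> with the residuals
  on the diagonal and the coupling \<open>4 W^2 k\<close> off it. The hypothesis \<open>det\<close>
  makes it nonnegative.\<close>

lemma mode_form_nonneg_of_picone:
  fixes k :: real
  assumes a: "polar_C1 a ea aa" and s: "polar_C1 s es as"
    and K1: "\<And>t. t > 0 \<Longrightarrow> (K1 has_real_derivative K1' t) (at t)" "continuous_on {0<..} K1'"
    and K2: "\<And>t. t > 0 \<Longrightarrow> (K2 has_real_derivative K2' t) (at t)" "continuous_on {0<..} K2'"
    and pos: "\<And>t. t > 0 \<Longrightarrow> 0 \<le> picone_residual k (\<lambda>t. Pot t + Con t) K1 K1' t"
      "\<And>t. t > 0 \<Longrightarrow> 0 \<le> picone_residual k (\<lambda>t. Pot t - Con t) K2 K2' t"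
    and det: "\<And>t. t > 0 \<Longrightarrow> (4 * (W t)^2 * k)^2 \<le>
      picone_residual k (\<lambda>t. Pot t + Con t) K1 K1' t * picone_residual k (\<lambda>t. Pot t - Con t) K2 K2' t"
  shows "0 \<le> (LINT x|lborel. W (r2 x) / (r2 x) * ((norm (ea x))^2 + (norm (es x))^2
      + (k^2 + (r2 x) * (Pot (r2 x) + Con (r2 x))) * (norm (a x))^2
      + (k^2 + (r2 x) * (Pot (r2 x) - Con (r2 x))) * (norm (s x))^2
      + 8 * W (r2 x) * k * Re (a x * cnj (s x))))" (is "0 \<le> (LINT x|lborel. ?J x)")
proof (cases "integrable lborel ?J")
  case False
  \<comment> \<open>The integral of a function that is not integrable is 0 by convention.\<close>
  then show ?thesis by (simp add: not_integrable_integral_eq)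
next
  case True
  note rad = polar_C1_radial[OF polar_C1_mult[OF a polar_C1_cnj[OF a]] K1]
    polar_C1_radial[OF polar_C1_mult[OF s polar_C1_cnj[OF s]] K2]
  \<comment> \<open>This is \<open>r d/dr\<close> of \<open>K1 |a|^2 + K2 |s|^2\<close>, divided by
    \<open>r^2\<close>, hence the divergence treated in
    \<open>polar_C1_integral_radial\<close>.\<close>
  define D where "D = (\<lambda>x. (of_real (K1 (r2 x)) * (a x * cnj (ea x) + ea x * cnj (a x)) +
      of_real (2 * (r2 x) * K1' (r2 x)) * (a x * cnj (a x)) +
     (of_real (K2 (r2 x)) * (s x * cnj (es x) + es x * cnj (s x)) +
      of_real (2 * (r2 x) * K2' (r2 x)) * (s x * cnj (s x)))) / of_real (r2 x))"
  note sum = polar_C1_add[OF rad]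
  have D0: "integrable lborel D" "(LINT x|lborel. D x) = 0"
    using polar_C1_integral_radial[OF sum] polar_C1_integrable_radial[OF sum] by (simp_all add: D_def)
  have ReD: "Re (D x) = (2 * K1 (r2 x) * Re (ea x * cnj (a x)) + 2 * (r2 x) * K1' (r2 x) * (norm (a x))^2
      + (2 * K2 (r2 x) * Re (es x * cnj (s x)) + 2 * (r2 x) * K2' (r2 x) * (norm (s x))^2)) / (r2 x)" for x
    unfolding D_def Re_divide_of_real cmod_power2 by (simp add: algebra_simps power2_eq_square)
  have "0 = (LINT x|lborel. Re (D x))"
    using integral_bounded_linear[OF bounded_linear_Re D0(1)] D0(2) by simp
  also have "\<dots> \<le> (LINT x|lborel. ?J x)"
  proof (rule integral_mono)
    show "integrable lborel (\<lambda>x. Re (D x))" by (rule integrable_bounded_linear[OF bounded_linear_Re D0(1)])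
    show "integrable lborel ?J" by fact
    fix x :: "real^2"
    show "Re (D x) \<le> ?J x"
    proof (cases "x = 0")
      case True then show ?thesis by (simp add: ReD)
    next
      case False
      define t where "t = x \<bullet> x"
      have t: "t > 0" using False by (simp add: t_def)
      have w: "W t > 0" using W_bounds t by blast
      have young: "2 * H * Re (e * cnj f) \<le> W t * (norm e)^2 + H^2 / W t * (norm f)^2" for H e f
      proof -
        have "2 * H * Re (e * cnj f) \<le> 2 * (sqrt (W t) * norm e) * (\<bar>H\<bar> / sqrt (W t) * norm f)"
          using w complex_Re_le_cmod[of "of_real H * (e * cnj f)"] by (simp add: norm_mult algebra_simps)
        also have "\<dots> \<le> (sqrt (W t) * norm e)^2 + (\<bar>H\<bar> / sqrt (W t) * norm f)^2"
          by (rule sum_squares_bound)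
        also have "\<dots> = W t * (norm e)^2 + H^2 / W t * (norm f)^2"
          using w by (simp add: power_mult_distrib power_divide)
        finally show ?thesis .
      qed
      have "\<bar>Re (a x * cnj (s x))\<bar> \<le> norm (a x) * norm (s x)"
        using abs_Re_le_cmod[of "a x * cnj (s x)"] by (simp add: norm_mult)
      from quadratic_form_nonneg[OF pos(1)[OF t] pos(2)[OF t] det[OF t] this]
      have "0 \<le> W t * (k^2 + t * (Pot t + Con t)) * (norm (a x))^2 - (K1 t)^2 / W t * (norm (a x))^2 - 2 * t * K1' t * (norm (a x))^2
         + (W t * (k^2 + t * (Pot t - Con t)) * (norm (s x))^2 - (K2 t)^2 / W t * (norm (s x))^2 - 2 * t * K2' t * (norm (s x))^2)
         + 8 * (W t)^2 * k * Re (a x * cnj (s x))"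
        by (simp add: picone_residual_def algebra_simps)
      with young[of "K1 t" "ea x" "a x"] young[of "K2 t" "es x" "s x"]
      have "2 * K1 t * Re (ea x * cnj (a x)) + 2 * t * K1' t * (norm (a x))^2
          + (2 * K2 t * Re (es x * cnj (s x)) + 2 * t * K2' t * (norm (s x))^2)
         \<le> W t * ((norm (ea x))^2 + (norm (es x))^2
      + (k^2 + t * (Pot t + Con t)) * (norm (a x))^2
      + (k^2 + t * (Pot t - Con t)) * (norm (s x))^2
      + 8 * W t * k * Re (a x * cnj (s x)))"
        by (simp add: algebra_simps power2_eq_square)
      from divide_right_mono[OF this, of t] t show ?thesis by (simp add: ReD flip: t_def)
    qed
  qed
  finally show ?thesis .
qed

text \<open>The residuals and the squared coupling depend on \<open>m\<close> through
  \<open>m^2\<close> only, so the sign of \<open>m\<close> is irrelevant and the cases are sorted by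
  \<open>m^2\<close>.\<close>

lemma mode_form_nonneg:
  fixes m :: int
  assumes a: "polar_C1 a ea aa" and s: "polar_C1 s es as"
  shows "0 \<le> (LINT x|lborel. W (r2 x) / (r2 x) * ((norm (ea x))^2 + (norm (es x))^2
      + ((real_of_int m)^2 + (r2 x) * (Pot (r2 x) + Con (r2 x))) * (norm (a x))^2
      + ((real_of_int m)^2 + (r2 x) * (Pot (r2 x) - Con (r2 x))) * (norm (s x))^2
      + 8 * W (r2 x) * m * Re (a x * cnj (s x))))"
proof -
  have cont: "continuous_on {0<..} (\<lambda>t::real. c / (t + 8)^n)" for c n
    by (intro continuous_intros) auto
  consider "m = 0" | "m^2 = 1 \<or> m^2 \<ge> 9" | "m^2 = 4"
  proof -
    have "\<bar>m\<bar> = 0 \<or> \<bar>m\<bar> = 1 \<or> \<bar>m\<bar> = 2 \<or> \<bar>m\<bar> \<ge> 3" by linarith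
    moreover have "\<bar>m\<bar>^2 = m^2" by simp
    moreover have "\<bar>m\<bar> \<ge> 3 \<Longrightarrow> \<bar>m\<bar>^2 \<ge> 9" using power_mono[of 3 "\<bar>m\<bar>" 2] by simp
    moreover have "\<bar>m\<bar> = 2 \<Longrightarrow> \<bar>m\<bar>^2 = 4" by simp
    moreover have "\<bar>m\<bar> = 1 \<Longrightarrow> \<bar>m\<bar>^2 = 1" by simp
    ultimately show ?thesis
      using that by (metis abs_eq_0)
  qed
  then show ?thesis
  proof cases
    case 1
    have D: "((\<lambda>t. 4 / (t + 8)) has_real_derivative - 4 / (t + 8)^2) (at t)" if "t > 0" for t :: real
      using that by (auto intro!: derivative_eq_intros simp: power2_eq_square)
    show ?thesis
      unfolding 1 of_int_0
    proof (rule mode_form_nonneg_of_picone[OF a s D cont D cont])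
      fix t :: real assume t: "t > 0"
      note picone_0[OF t]
      then show "0 \<le> picone_residual 0 (\<lambda>t. Pot t + Con t) (\<lambda>t. 4 / (t + 8)) (\<lambda>t. - 4 / (t + 8)^2) t"
        "0 \<le> picone_residual 0 (\<lambda>t. Pot t - Con t) (\<lambda>t. 4 / (t + 8)) (\<lambda>t. - 4 / (t + 8)^2) t"
        "(4 * (W t)^2 * 0)^2 \<le> picone_residual 0 (\<lambda>t. Pot t + Con t) (\<lambda>t. 4 / (t + 8)) (\<lambda>t. - 4 / (t + 8)^2) t
          * picone_residual 0 (\<lambda>t. Pot t - Con t) (\<lambda>t. 4 / (t + 8)) (\<lambda>t. - 4 / (t + 8)^2) t"
        by simp_all
    qed
  next
    case 3
    have D: "((\<lambda>t. 4 / (t + 8)) has_real_derivative - 4 / (t + 8)^2) (at t)" if "t > 0" for t :: real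
      using that by (auto intro!: derivative_eq_intros simp: power2_eq_square)
    have D2: "((\<lambda>t. 4 / (t + 8) - 2 * t * (t + 4) / (t + 8)^2) has_real_derivative
        - 4 / (t + 8)^2 - 2 * (12 * t + 32) / (t + 8)^3) (at t)" if "t > 0" for t :: real
    proof -
      have "t + 8 \<noteq> 0" using that by simp
      then show ?thesis
        by (auto intro!: derivative_eq_intros) (simp add: divide_simps, algebra)
    qed
    have c2: "continuous_on {0<..} (\<lambda>t::real. - 4 / (t + 8)^2 - 2 * (12 * t + 32) / (t + 8)^3)"
      by (intro continuous_intros) auto
    have res: "picone_residual m V H H' t = picone_residual 2 V H H' t" for V H H' t
      using 3 by (simp add: picone_residual_def) (metis of_int_power of_int_numeral)
    have m2: "(real_of_int m)^2 = 4" using 3 by (metis of_int_power of_int_numeral)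
    show ?thesis
    proof (rule mode_form_nonneg_of_picone[OF a s D2 c2 D cont], unfold res)
      fix t :: real assume t: "t > 0"
      let ?A = "picone_residual 2 (\<lambda>t. Pot t + Con t) (\<lambda>t. 4 / (t + 8) - 2 * t * (t + 4) / (t + 8)^2)
      (\<lambda>t. - 4 / (t + 8)^2 - 2 * (12 * t + 32) / (t + 8)^3) t"
      let ?B = "picone_residual 2 (\<lambda>t. Pot t - Con t) (\<lambda>t. 4 / (t + 8)) (\<lambda>t. - 4 / (t + 8)^2) t"
      have A: "?A \<ge> 8 * (W t)^2 * ((t + 8) / 8)" unfolding picone_2[OF t] using t by simp
      have B: "?B \<ge> 8 * (W t)^2 / ((t + 8) / 8)" unfolding picone_2[OF t] using t by simp
      show A0: "?A \<ge> 0" using A t by (intro order_trans[OF _ A]) auto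
      show "?B \<ge> 0" using B t by (intro order_trans[OF _ B]) auto
      \<comment> \<open>The weight ratio cancels between the two lower bounds, and
        \<open>m^2 = 4\<close> turns the squared coupling into \<open>64 W^4\<close>.\<close>
      have "(4 * (W t)^2 * m)^2 = (8 * (W t)^2 * ((t + 8) / 8)) * (8 * (W t)^2 / ((t + 8) / 8))"
        using t by (simp add: power_mult_distrib m2 power4_eq_xxxx power2_eq_square[of "W t"])
      also have "\<dots> \<le> ?A * ?B" using A B A0 t by (intro mult_mono) auto
      finally show "(4 * (W t)^2 * m)^2 \<le> ?A * ?B" .
    qed
  next
    case 2
    then have m2: "(real_of_int m)^2 = 1 \<or> (real_of_int m)^2 \<ge> 9"
      by (metis of_int_1 of_int_le_iff of_int_numeral of_int_power)
    have D1: "((\<lambda>t. - 3 * t / (t + 8)) has_real_derivative - 24 / (t + 8)^2) (at t)" if "t > 0" for t :: real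
      using that by (auto intro!: derivative_eq_intros simp: power2_eq_square field_simps)
    have D2: "((\<lambda>t. - t / (t + 8)) has_real_derivative - 8 / (t + 8)^2) (at t)" if "t > 0" for t :: real
      using that by (auto intro!: derivative_eq_intros simp: power2_eq_square field_simps)
    show ?thesis
    proof (rule mode_form_nonneg_of_picone[OF a s D1 cont D2 cont])
      fix t :: real assume t: "t > 0"
      define c where "c = (t + 4) / 4"
      define w where "w = W t"
      define n where "n = (real_of_int m)^2 - 1"
      have c: "c > 0" using t by (simp add: c_def)
      have w: "w > 0" "w < 1" using W_bounds[OF t] by (auto simp: w_def)
      have n: "n = 0 \<or> n \<ge> 8" "n \<ge> 0" using m2 by (auto simp: n_def)
      have cc: "c + 1 / c \<ge> 2" using c sum_squares_bound[of c 1] by (simp add: field_simps power2_eq_square)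
      show "0 \<le> picone_residual m (\<lambda>t. Pot t + Con t) (\<lambda>t. - 3 * t / (t + 8)) (\<lambda>t. - 24 / (t + 8)^2) t"
        "0 \<le> picone_residual m (\<lambda>t. Pot t - Con t) (\<lambda>t. - t / (t + 8)) (\<lambda>t. - 8 / (t + 8)^2) t"
        unfolding picone_1[OF t] c_def[symmetric] w_def[symmetric] n_def[symmetric] using c w n by simp_all
      have n8: "n * (n - 8) \<ge> 0" using n by auto
      \<comment> \<open>The determinant minus the squared coupling is
        \<open>n^2 w^2 + 4 n w^3 (c + 1/c) - 16 n w^4\<close>. It is split so that each part has a
        visible sign: \<open>n (n - 8) \<ge> 0\<close> since \<open>n = m^2 - 1\<close> is 0 or at
        least 8, \<open>w < 1\<close>, and \<open>c + 1/c \<ge> 2\<close>.\<close>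
      have "0 \<le> n * (n - 8) * w^2 + n * w^2 * (8 * (1 - w) + 16 * w * (1 - w)) + n * 4 * w^3 * (c + 1 / c - 2)"
        using n(2) n8 w cc by (intro add_nonneg_nonneg mult_nonneg_nonneg[OF n8] mult_nonneg_nonneg) auto
      also have "\<dots> = (n * w + 4 * w^2 * c) * (n * w + 4 * w^2 / c) - (4 * w^2)^2 * (n + 1)"
        using c by (simp add: field_simps power2_eq_square power3_eq_cube)
      finally show "(4 * (W t)^2 * m)^2 \<le> picone_residual m (\<lambda>t. Pot t + Con t) (\<lambda>t. - 3 * t / (t + 8)) (\<lambda>t. - 24 / (t + 8)^2) t
         * picone_residual m (\<lambda>t. Pot t - Con t) (\<lambda>t. - t / (t + 8)) (\<lambda>t. - 8 / (t + 8)^2) t"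
        unfolding picone_1[OF t] c_def[symmetric] w_def[symmetric] n_def[symmetric]
        by (simp add: power_mult_distrib n_def)
    qed
  qed
qed

section \<open>Angular modes and their orthogonality\<close>

text \<open>The regularity required of a radial coefficient as a function of \<open>t = r^2\<close>.
  Nothing is asked at \<open>t = 0\<close>, since the functions it multiplies vanish near the
  origin.\<close>

definition C1_pos :: "(real \<Rightarrow> real) \<Rightarrow> bool" where
  "C1_pos H \<longleftrightarrow> (\<exists>H'. (\<forall>t>0. (H has_real_derivative H' t) (at t)) \<and> continuous_on {0<..} H')"

lemma C1_pos_continuous: "C1_pos H \<Longrightarrow> continuous_on {0<..} H"
  unfolding C1_pos_def by (intro continuous_at_imp_continuous_on ballI) (auto intro: DERIV_isCont)

lemma C1_pos_const: "C1_pos (\<lambda>_. c)"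
  unfolding C1_pos_def by (rule exI[of _ "\<lambda>_. 0"]) auto

lemma C1_pos_id: "C1_pos (\<lambda>t. t)"
  unfolding C1_pos_def by (rule exI[of _ "\<lambda>_. 1"]) auto

lemma C1_pos_add:
  assumes "C1_pos F" "C1_pos G"
  shows "C1_pos (\<lambda>t. F t + G t)"
proof -
  obtain F' G' where "\<And>t. t > 0 \<Longrightarrow> (F has_real_derivative F' t) (at t)" "continuous_on {0<..} F'"
    "\<And>t. t > 0 \<Longrightarrow> (G has_real_derivative G' t) (at t)" "continuous_on {0<..} G'"
    using assms unfolding C1_pos_def by blast
  then show ?thesis unfolding C1_pos_def
    by (intro exI[of _ "\<lambda>t. F' t + G' t"]) (auto intro!: derivative_intros continuous_intros)
qed

lemma C1_pos_mult:
  assumes "C1_pos F" "C1_pos G"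
  shows "C1_pos (\<lambda>t. F t * G t)"
proof -
  obtain F' G' where FG: "\<And>t. t > 0 \<Longrightarrow> (F has_real_derivative F' t) (at t)" "continuous_on {0<..} F'"
    "\<And>t. t > 0 \<Longrightarrow> (G has_real_derivative G' t) (at t)" "continuous_on {0<..} G'"
    using assms unfolding C1_pos_def by blast
  then show ?thesis unfolding C1_pos_def
    by (intro exI[of _ "\<lambda>t. F' t * G t + G' t * F t"] conjI allI impI DERIV_mult)
       (use FG C1_pos_continuous[OF assms(1)] C1_pos_continuous[OF assms(2)] in \<open>auto intro!: continuous_intros\<close>)
qed

lemma C1_pos_power: "C1_pos F \<Longrightarrow> C1_pos (\<lambda>t. F t ^ n)"
  by (induction n) (auto intro: C1_pos_mult C1_pos_const)

lemma C1_pos_divide: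
  assumes "C1_pos F" "C1_pos G" "\<And>t. t > 0 \<Longrightarrow> G t \<noteq> 0"
  shows "C1_pos (\<lambda>t. F t / G t)"
proof -
  obtain F' G' where FG: "\<And>t. t > 0 \<Longrightarrow> (F has_real_derivative F' t) (at t)" "continuous_on {0<..} F'"
    "\<And>t. t > 0 \<Longrightarrow> (G has_real_derivative G' t) (at t)" "continuous_on {0<..} G'"
    using assms unfolding C1_pos_def by blast
  then show ?thesis unfolding C1_pos_def
    by (intro exI[of _ "\<lambda>t. (F' t * G t - F t * G' t) / (G t * G t)"] conjI allI impI DERIV_divide)
       (use FG assms(3) C1_pos_continuous[OF assms(1)] C1_pos_continuous[OF assms(2)] in \<open>auto intro!: continuous_intros\<close>)
qed

lemma C1_pos_W: "C1_pos W"
  unfolding W_def[abs_def] by (intro C1_pos_divide C1_pos_add C1_pos_id C1_pos_const) auto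

lemma C1_pos_Con: "C1_pos Con"
  unfolding Con_def[abs_def] by (intro C1_pos_divide C1_pos_add C1_pos_mult C1_pos_power C1_pos_id C1_pos_const) auto

lemma C1_pos_Pot: "C1_pos Pot"
  unfolding Pot_def[abs_def] diff_conv_add_uminus mult_minus_left[symmetric]
  by (intro C1_pos_divide C1_pos_add C1_pos_mult C1_pos_power C1_pos_id C1_pos_const) auto

text \<open>The functions of the form \<open>f(r) exp(\<i> m \<theta>)\<close>, characterised as
  eigenfunctions of the angular derivative so that no polar coordinates have to be
  introduced.\<close>

definition mode :: "int \<Rightarrow> (real^2 \<Rightarrow> complex) \<Rightarrow> bool" where
  "mode m f \<longleftrightarrow> (\<exists>e. polar_C1 f e (\<lambda>x. \<i> * of_int m * f x))"

lemma modeI: "polar_C1 f e (\<lambda>x. \<i> * of_int m * f x) \<Longrightarrow> mode m f"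
  unfolding mode_def by blast

lemma mode_cmult: "mode m f \<Longrightarrow> mode m (\<lambda>x. c * f x)"
  unfolding mode_def using polar_C1_cmult[where c=c] by (fastforce simp: algebra_simps)

lemma polar_C1_cnj_mode:
  assumes "polar_C1 f e (\<lambda>x. \<i> * of_int (- m) * f x)"
  shows "polar_C1 (\<lambda>x. cnj (f x)) (\<lambda>x. cnj (e x)) (\<lambda>x. \<i> * of_int m * cnj (f x))"
  using polar_C1_cnj[OF assms] by simp

text \<open>The angular derivative of \<open>H f cnj g\<close> is \<open>\<i> (m - n)\<close> times
  the function itself, and an angular derivative integrates to zero.\<close>

lemma mode_orthogonal:
  assumes "mode m f" "mode n g" "m \<noteq> n" "C1_pos H"
  shows "(LINT x|lborel. of_real (H (r2 x)) * (f x * cnj (g x))) = 0"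
proof -
  obtain e e' where f: "polar_C1 f e (\<lambda>x. \<i> * of_int m * f x)" and g: "polar_C1 g e' (\<lambda>x. \<i> * of_int n * g x)"
    using assms unfolding mode_def by blast
  obtain H' where H: "\<And>t. t > 0 \<Longrightarrow> (H has_real_derivative H' t) (at t)" "continuous_on {0<..} H'"
    using assms unfolding C1_pos_def by blast
  from polar_C1_integral_angular[OF polar_C1_radial[OF polar_C1_mult[OF f polar_C1_cnj[OF g]] H]]
  have "0 = (LINT x|lborel. \<i> * of_int (m - n) * (of_real (H (r2 x)) * (f x * cnj (g x))))"
    by (simp add: algebra_simps)
  also have "\<dots> = \<i> * of_int (m - n) * (LINT x|lborel. of_real (H (r2 x)) * (f x * cnj (g x)))"
    by (rule integral_mult_right_zero)
  finally show ?thesis using assms(3) by simp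
qed

lemma polar_C1_integrable_mult:
  assumes "polar_C1 f e a" "continuous_on (- {0}) g"
  shows "integrable lborel (\<lambda>x. g x * f x)"
proof -
  obtain d R where d: "d > 0" "\<And>x. norm x < d \<Longrightarrow> f x = 0 \<and> e x = 0 \<and> a x = 0"
    "\<And>x. norm x > R \<Longrightarrow> f x = 0 \<and> e x = 0 \<and> a x = 0"
    using polar_C1_support[OF assms(1)] by metis
  show ?thesis
    by (rule integrable_annulus[OF _ d(1), where R=R])
       (use d assms(2) polar_C1_continuous[OF assms(1)] in \<open>auto intro!: continuous_intros intro: continuous_on_subset\<close>)
qed

lemma mode_product_integrable:
  assumes "mode m f" "mode n g" "C1_pos H"
  shows "integrable lborel (\<lambda>x. of_real (H (r2 x)) * (f x * cnj (g x)))"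
proof -
  obtain e e' where f: "polar_C1 f e (\<lambda>x. \<i> * of_int m * f x)" and g: "polar_C1 g e' (\<lambda>x. \<i> * of_int n * g x)"
    using assms unfolding mode_def by blast
  show ?thesis
    by (rule polar_C1_integrable_mult[OF polar_C1_mult[OF f polar_C1_cnj[OF g]]])
       (intro continuous_intros continuous_on_radial C1_pos_continuous assms)
qed

lemma mode_parseval:
  assumes M: "finite M" and f: "\<And>m. m \<in> M \<Longrightarrow> mode m (f m)" and g: "\<And>m. m \<in> M \<Longrightarrow> mode m (g m)"
    and H: "C1_pos H"
  shows "integrable lborel (\<lambda>x. H (r2 x) * Re ((\<Sum>m\<in>M. f m x) * cnj (\<Sum>m\<in>M. g m x)))"
    "(LINT x|lborel. H (r2 x) * Re ((\<Sum>m\<in>M. f m x) * cnj (\<Sum>m\<in>M. g m x))) =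
      (\<Sum>m\<in>M. LINT x|lborel. H (r2 x) * Re (f m x * cnj (g m x)))"
proof -
  let ?P = "\<lambda>m n x. of_real (H (r2 x)) * (f m x * cnj (g n x))"
  have int: "integrable lborel (?P m n)" if "m \<in> M" "n \<in> M" for m n
    using mode_product_integrable[OF f g H] that by blast
  have eq: "H (r2 x) * Re ((\<Sum>m\<in>M. f m x) * cnj (\<Sum>m\<in>M. g m x)) = Re (\<Sum>m\<in>M. \<Sum>n\<in>M. ?P m n x)" for x
  proof -
    have Re_mult_real: "Re (of_real r * z) = r * Re z" for r z by simp
    have "(\<Sum>m\<in>M. \<Sum>n\<in>M. ?P m n x) = of_real (H (r2 x)) * ((\<Sum>m\<in>M. f m x) * cnj (\<Sum>m\<in>M. g m x))"
      unfolding cnj_sum sum_product by (simp only: sum_distrib_left)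
    then show ?thesis by (simp only: Re_mult_real)
  qed
  have I: "integrable lborel (\<lambda>x. \<Sum>m\<in>M. \<Sum>n\<in>M. ?P m n x)"
    using int by (intro Bochner_Integration.integrable_sum) auto
  show "integrable lborel (\<lambda>x. H (r2 x) * Re ((\<Sum>m\<in>M. f m x) * cnj (\<Sum>m\<in>M. g m x)))"
    unfolding eq by (rule integrable_bounded_linear[OF bounded_linear_Re I])
  have "(LINT x|lborel. H (r2 x) * Re ((\<Sum>m\<in>M. f m x) * cnj (\<Sum>m\<in>M. g m x))) =
      Re (LINT x|lborel. (\<Sum>m\<in>M. \<Sum>n\<in>M. ?P m n x))"
    unfolding eq by (rule integral_bounded_linear[OF bounded_linear_Re I])
  also have "(LINT x|lborel. (\<Sum>m\<in>M. \<Sum>n\<in>M. ?P m n x)) = (\<Sum>m\<in>M. LINT x|lborel. (\<Sum>n\<in>M. ?P m n x))"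
    by (rule Bochner_Integration.integral_sum) (auto intro!: Bochner_Integration.integrable_sum int)
  also have "\<dots> = (\<Sum>m\<in>M. \<Sum>n\<in>M. LINT x|lborel. ?P m n x)"
    by (intro sum.cong refl Bochner_Integration.integral_sum int)
  also have "\<dots> = (\<Sum>m\<in>M. LINT x|lborel. ?P m m x)"
  proof (rule sum.cong)
    fix m assume m: "m \<in> M"
    have "(\<Sum>n\<in>M. LINT x|lborel. ?P m n x) = (\<Sum>n\<in>M. if n = m then LINT x|lborel. ?P m m x else 0)"
      by (rule sum.cong) (use mode_orthogonal[OF f[OF m] g _ H] in auto)
    then show "(\<Sum>n\<in>M. LINT x|lborel. ?P m n x) = (LINT x|lborel. ?P m m x)"
      using m M by (simp add: sum.delta)
  qed simp
  also have "Re \<dots> = (\<Sum>m\<in>M. Re (LINT x|lborel. ?P m m x))" by simp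
  also have "\<dots> = (\<Sum>m\<in>M. LINT x|lborel. Re (?P m m x))"
    by (intro sum.cong refl integral_bounded_linear[OF bounded_linear_Re int, symmetric])
  also have "\<dots> = (\<Sum>m\<in>M. LINT x|lborel. H (r2 x) * Re (f m x * cnj (g m x)))"
    by (simp add: algebra_simps)
  finally show "(LINT x|lborel. H (r2 x) * Re ((\<Sum>m\<in>M. f m x) * cnj (\<Sum>m\<in>M. g m x))) =
      (\<Sum>m\<in>M. LINT x|lborel. H (r2 x) * Re (f m x * cnj (g m x)))" .
qed

text \<open>The density of \<open>W\<close> times the second variation, with
  \<open>e = r du/dr\<close> and \<open>a = du/d\<theta>\<close>. The term
  \<open>Im (a * cnj u)\<close> comes from the first-order angular term of the operator, the term
  \<open>Re (u^2)\<close> from its conjugate-linear part.\<close>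

definition energy_density :: "real \<Rightarrow> complex \<Rightarrow> complex \<Rightarrow> complex \<Rightarrow> real" where
  "energy_density t u e a = W t / t * ((norm e)^2 + (norm a)^2 + 4 * W t * Im (a * cnj u)
     + t * Pot t * (norm u)^2 + t * Con t * Re (u^2))"

text \<open>All terms but the one with \<open>Con\<close> are diagonal in the modes. For that one,
  \<open>Re (u^2)\<close> is the product of \<open>u\<close> with its own conjugate counterpart,
  whose component of frequency \<open>m\<close> is the conjugate of \<open>f (- m)\<close>; hence
  only the frequencies \<open>m\<close> and \<open>- m\<close> interact, and adding their
  contributions gives the form of \<open>mode_form_nonneg\<close>.\<close>

lemma energy_nonneg:
  fixes N :: int
  assumes f: "\<And>m. polar_C1 (f m) (e m) (\<lambda>x. \<i> * of_int m * f m x)"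
    and e: "\<And>m. mode m (e m)"
  defines "u \<equiv> \<lambda>x. \<Sum>m\<in>{-N..N}. f m x"
    and "eu \<equiv> \<lambda>x. \<Sum>m\<in>{-N..N}. e m x"
    and "au \<equiv> \<lambda>x. \<Sum>m\<in>{-N..N}. \<i> * of_int m * f m x"
  shows "integrable lborel (\<lambda>x. energy_density (r2 x) (u x) (eu x) (au x))"
    "0 \<le> (LINT x|lborel. energy_density (r2 x) (u x) (eu x) (au x))"
proof -
  let ?M = "{-N..N}"
  \<comment> \<open>Conjugation reverses the frequency, so \<open>g m\<close> is again of frequency
    \<open>m\<close> and can be paired with \<open>f m\<close>.\<close>
  define g where "g m x = cnj (f (- m) x)" for m x
  define eg where "eg m x = cnj (e (- m) x)" for m x
  have g: "polar_C1 (g m) (eg m) (\<lambda>x. \<i> * of_int m * g m x)" for m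
    unfolding g_def[abs_def] eg_def[abs_def] by (rule polar_C1_cnj_mode[OF f])
  have f': "mode m (f m)" and g': "mode m (g m)" for m
    using f g modeI by blast+
  have f'a: "mode m (\<lambda>x. \<i> * of_int m * f m x)" and f'i: "mode m (\<lambda>x. \<i> * f m x)" for m
    by (rule mode_cmult[OF f'])+
  have t: "C1_pos (\<lambda>t. W t / t)" "C1_pos (\<lambda>t. 4 * (W t)^2 / t)" "C1_pos (\<lambda>t. W t * Pot t)" "C1_pos (\<lambda>t. W t * Con t)"
    by (auto intro!: C1_pos_divide C1_pos_mult C1_pos_power C1_pos_W C1_pos_Pot C1_pos_Con C1_pos_id C1_pos_const)
  have sg: "(\<Sum>m\<in>?M. g m x) = cnj (u x)" for x
  proof -
    have "(\<Sum>m\<in>?M. g m x) = (\<Sum>m\<in>?M. cnj (f m x))"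
      unfolding g_def by (rule sum.reindex_bij_witness[of _ uminus uminus]) auto
    then show ?thesis by (simp add: u_def)
  qed
  define T where "T m x = W (r2 x) / (r2 x) * Re (e m x * cnj (e m x))
      + W (r2 x) / (r2 x) * Re ((\<i> * of_int m * f m x) * cnj (\<i> * of_int m * f m x))
      + 4 * (W (r2 x))^2 / (r2 x) * Re ((\<i> * of_int m * f m x) * cnj (\<i> * f m x))
      + W (r2 x) * Pot (r2 x) * Re (f m x * cnj (f m x))
      + W (r2 x) * Con (r2 x) * Re (f m x * cnj (g m x))" for m x
  have sing: "integrable lborel (\<lambda>x. H (r2 x) * Re (p x * cnj (q x)))" if "mode m p" "mode m q" "C1_pos H" for H p q m
    using mode_parseval(1)[of "{m}" "\<lambda>_. p" "\<lambda>_. q" H] that by simp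
  have Tint: "integrable lborel (T m)" for m
    unfolding T_def
    using sing[OF e[of m] e[of m] t(1)] sing[OF f'a[of m] f'a[of m] t(1)] sing[OF f'a[of m] f'i[of m] t(2)]
      sing[OF f'[of m] f'[of m] t(3)] sing[OF f'[of m] g'[of m] t(4)]
    by (intro Bochner_Integration.integrable_add)
  have dens: "energy_density (r2 x) (u x) (eu x) (au x) =
     W (r2 x) / (r2 x) * Re (eu x * cnj (eu x))
      + W (r2 x) / (r2 x) * Re (au x * cnj (au x))
      + 4 * (W (r2 x))^2 / (r2 x) * Re (au x * cnj (\<Sum>m\<in>?M. \<i> * f m x))
      + W (r2 x) * Pot (r2 x) * Re (u x * cnj (u x))
      + W (r2 x) * Con (r2 x) * Re (u x * cnj (\<Sum>m\<in>?M. g m x))" for x :: "real^2"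
  proof (cases "x = 0")
    case True
    \<comment> \<open>At the origin both sides are 0, as every coefficient contains a division by
      zero.\<close>
    then show ?thesis by (simp add: energy_density_def Pot_def Con_def)
  next
    case False
    have s: "(\<Sum>m\<in>?M. \<i> * f m x) = \<i> * u x" by (simp add: u_def sum_distrib_left)
    have n: "Re (z * cnj z) = (norm z)^2" for z unfolding cmod_power2 by (simp add: power2_eq_square)
    have i: "Re (au x * cnj (\<i> * u x)) = Im (au x * cnj (u x))" by (simp add: algebra_simps)
    show ?thesis
      unfolding energy_density_def s sg n i complex_cnj_cnj
      using False by (simp add: field_simps power2_eq_square[of "u x"] power2_eq_square[of "W (r2 x)"])
  qed
  note P = mode_parseval[OF finite_atLeastAtMost_int[of "- N" N] e e t(1)]
    mode_parseval[OF finite_atLeastAtMost_int[of "- N" N] f'a f'a t(1)]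
    mode_parseval[OF finite_atLeastAtMost_int[of "- N" N] f'a f'i t(2)]
    mode_parseval[OF finite_atLeastAtMost_int[of "- N" N] f' f' t(3)]
    mode_parseval[OF finite_atLeastAtMost_int[of "- N" N] f' g' t(4)]
  have sums: "(\<Sum>m\<in>?M. f m x) = u x" "(\<Sum>m\<in>?M. e m x) = eu x" "(\<Sum>m\<in>?M. \<i> * of_int m * f m x) = au x" for x
    by (simp_all add: u_def eu_def au_def)
  note P = P[unfolded sums]
  show "integrable lborel (\<lambda>x. energy_density (r2 x) (u x) (eu x) (au x))"
    unfolding dens by (intro Bochner_Integration.integrable_add P)
  have "(LINT x|lborel. energy_density (r2 x) (u x) (eu x) (au x)) = (\<Sum>m\<in>?M. LINT x|lborel. T m x)"
    unfolding dens T_def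
    using P sing[OF e e t(1)] sing[OF f'a f'a t(1)] sing[OF f'a f'i t(2)] sing[OF f' f' t(3)] sing[OF f' g' t(4)]
    by (simp only: Bochner_Integration.integral_add Bochner_Integration.integrable_add sum.distrib)
  \<comment> \<open>The range of frequencies is symmetric, so the contribution of \<open>m\<close>
    may be averaged with that of \<open>- m\<close>.\<close>
  also have "\<dots> = (\<Sum>m\<in>?M. ((LINT x|lborel. T m x) + (LINT x|lborel. T (- m) x)) / 2)"
  proof -
    have "(\<Sum>m\<in>?M. LINT x|lborel. T m x) = (\<Sum>m\<in>?M. LINT x|lborel. T (- m) x)"
      by (rule sum.reindex_bij_witness[of _ uminus uminus]) auto
    then show ?thesis by (simp add: sum.distrib flip: sum_divide_distrib)
  qed
  also have "\<dots> \<ge> 0"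
  proof (intro sum_nonneg)
    fix m assume "m \<in> ?M"
    let ?a = "\<lambda>x. f m x + g m x" and ?s = "\<lambda>x. f m x + (- 1) * g m x"
    let ?ea = "\<lambda>x. e m x + eg m x" and ?es = "\<lambda>x. e m x + (- 1) * eg m x"
    let ?J = "\<lambda>x. W (r2 x) / (r2 x) * ((norm (?ea x))^2 + (norm (?es x))^2
      + ((real_of_int m)^2 + (r2 x) * (Pot (r2 x) + Con (r2 x))) * (norm (?a x))^2
      + ((real_of_int m)^2 + (r2 x) * (Pot (r2 x) - Con (r2 x))) * (norm (?s x))^2
      + 8 * W (r2 x) * m * Re (?a x * cnj (?s x)))"
    \<comment> \<open>The change of variables to \<open>f + g\<close> and \<open>f - g\<close>:
      squared norms transform by the parallelogram law, the product \<open>Re (f cnj g)\<close> by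
      polarization, and the difference \<open>|f|^2 - |g|^2\<close> of the rotation terms becomes
      the cross term \<open>Re ((f + g) cnj (f - g))\<close>.\<close>
    have TJ: "T m x + T (- m) x = ?J x / 2" for x
    proof (cases "x = 0")
      case True
      then show ?thesis by (simp add: T_def Pot_def Con_def)
    next
      case False
      have nn: "Re (z * cnj z) = (norm z)^2" for z unfolding cmod_power2 by (simp add: power2_eq_square)
      have par: "(norm (z + (- 1) * z'))^2 = 2 * (norm z)^2 + 2 * (norm z')^2 - (norm (z + z'))^2" for z z' :: complex
        unfolding cmod_power2 by (simp add: power2_eq_square algebra_simps)
      have pl: "(norm (z + z'))^2 = (norm z)^2 + (norm z')^2 + 2 * Re (z * cnj z')" for z z' :: complex
        unfolding cmod_power2 by (simp add: power2_eq_square algebra_simps)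
      have df: "Re ((z + z') * cnj (z + (- 1) * z')) = (norm z)^2 - (norm z')^2" for z z' :: complex
        unfolding cmod_power2 by (simp add: power2_eq_square algebra_simps)
      have im: "Re (\<i> * of_int k * z * cnj (\<i> * of_int k * z)) = (real_of_int k)^2 * (norm z)^2"
        "Re (\<i> * of_int k * z * cnj (\<i> * z)) = real_of_int k * (norm z)^2" for z k
        unfolding cmod_power2 by (simp_all add: power2_eq_square algebra_simps)
      have neg: "norm (f (- m) x) = norm (g m x)" "norm (e (- m) x) = norm (eg m x)"
        "Re (f (- m) x * cnj (g (- m) x)) = Re (f m x * cnj (g m x))"
        by (simp_all add: g_def eg_def)
      have "T m x + T (- m) x = W (r2 x) / (r2 x) * ((norm (e m x))^2 + (norm (eg m x))^2
        + (real_of_int m)^2 * ((norm (f m x))^2 + (norm (g m x))^2)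
        + 4 * W (r2 x) * m * ((norm (f m x))^2 - (norm (g m x))^2)
        + (r2 x) * Pot (r2 x) * ((norm (f m x))^2 + (norm (g m x))^2)
        + 2 * (r2 x) * Con (r2 x) * Re (f m x * cnj (g m x)))"
        unfolding T_def unfolding im unfolding nn neg using False by (simp add: field_simps power2_eq_square[of "W (r2 x)"])
      also have "\<dots> = ?J x / 2"
        unfolding par df unfolding pl by (simp add: algebra_simps)
      finally show ?thesis .
    qed
    have "(LINT x|lborel. T m x) + (LINT x|lborel. T (- m) x) = (LINT x|lborel. ?J x / 2)"
      unfolding TJ[symmetric] by (rule Bochner_Integration.integral_add[OF Tint Tint, symmetric])
    also have "\<dots> = (LINT x|lborel. ?J x) / 2" by (rule Bochner_Integration.integral_divide_zero)
    also have "\<dots> \<ge> 0"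
    proof -
      have "0 \<le> (LINT x|lborel. ?J x)"
        by (rule mode_form_nonneg[OF polar_C1_add[OF f g] polar_C1_add[OF f polar_C1_cmult[OF g]]])
      then show ?thesis by simp
    qed
    finally show "0 \<le> ((LINT x|lborel. T m x) + (LINT x|lborel. T (- m) x)) / 2" by simp
  qed
  finally show "0 \<le> (LINT x|lborel. energy_density (r2 x) (u x) (eu x) (au x))" .
qed

section \<open>Approximation by polynomials\<close>

lemma has_grad_sum:
  assumes "finite I" "\<And>i. i \<in> I \<Longrightarrow> has_grad (f i) (f1 i) (f2 i)"
  shows "has_grad (\<lambda>x. \<Sum>i\<in>I. f i x) (\<lambda>x. \<Sum>i\<in>I. f1 i x) (\<lambda>x. \<Sum>i\<in>I. f2 i x)"
  using assms by (induction rule: finite_induct) (auto intro: has_grad_const has_grad_add)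

lemma has_grad_unique:
  assumes "has_grad f f1 f2" "has_grad f g1 g2"
  shows "f1 = g1" "f2 = g2"
  using has_grad_partial_deriv[OF assms(1)] has_grad_partial_deriv[OF assms(2)] by auto

lemma has_grad_cmult: "has_grad f f1 f2 \<Longrightarrow> has_grad (\<lambda>x. c * f x) (\<lambda>x. c * f1 x) (\<lambda>x. c * f2 x)"
  using has_grad_mult[OF has_grad_const[of c], of f f1 f2] by simp

definition zc :: "real^2 \<Rightarrow> complex" where "zc x = of_real (x$1) + \<i> * of_real (x$2)"

lemma has_grad_zc: "has_grad zc (\<lambda>_. 1) (\<lambda>_. \<i>)"
  using has_grad_add[OF has_grad_coord[OF DERIV_ident, of 1] has_grad_cmult[OF has_grad_coord[OF DERIV_ident, of 2], of \<i>]]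
  by (simp add: zc_def[abs_def])

lemma has_grad_power:
  assumes "has_grad f f1 f2"
  shows "has_grad (\<lambda>x. f x ^ n) (\<lambda>x. of_nat n * f x ^ (n - 1) * f1 x) (\<lambda>x. of_nat n * f x ^ (n - 1) * f2 x)"
proof (induction n)
  case 0
  then show ?case by (simp add: has_grad_const)
next
  case (Suc n)
  have "of_nat (Suc n) * f x ^ n * g = f x * (of_nat n * f x ^ (n - 1) * g) + g * f x ^ n" for x g
    by (cases n) (auto simp: algebra_simps)
  then show ?case using has_grad_mult[OF assms Suc] by simp
qed

lemma smooth_plane_coordinate: "smooth_plane (\<lambda>x. of_real (x $ i))"
  by (rule smooth_plane_coord[OF smooth_id])

lemma smooth_plane_power: "smooth_plane f \<Longrightarrow> smooth_plane (\<lambda>x. f x ^ n)"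
  by (induction n) (auto intro: smooth_plane_const smooth_plane_mult)

lemma smooth_plane_zc: "smooth_plane zc" "smooth_plane (\<lambda>x. cnj (zc x))"
proof -
  show "smooth_plane zc"
    unfolding zc_def[abs_def] by (intro smooth_plane_add smooth_plane_mult smooth_plane_const smooth_plane_coordinate)
  have "(\<lambda>x. cnj (zc x)) = (\<lambda>x. of_real (x$1) + (- \<i>) * of_real (x$2))"
    by (simp add: zc_def fun_eq_iff)
  then show "smooth_plane (\<lambda>x. cnj (zc x))"
    by (simp only:) (intro smooth_plane_add smooth_plane_mult smooth_plane_const smooth_plane_coordinate)
qed

section \<open>Polynomials sorted by angular frequency\<close>

inductive mode_poly :: "int \<Rightarrow> (real^2 \<Rightarrow> complex) \<Rightarrow> bool" where
  mode_poly_monomial: "mode_poly (int i - int j) (\<lambda>x. c * zc x ^ i * cnj (zc x) ^ j)"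
| mode_poly_add: "mode_poly m p \<Longrightarrow> mode_poly m q \<Longrightarrow> mode_poly m (\<lambda>x. p x + q x)"

lemma mode_poly_0: "mode_poly m (\<lambda>_. 0)"
  using mode_poly_monomial[of "nat m" "nat (- m)" 0] by (cases "m \<ge> 0") auto

text \<open>On the monomial \<open>z^i cnj z^j\<close> the operator \<open>r d/dr\<close> is
  multiplication by the degree \<open>i + j\<close> and the angular derivative is multiplication by
  \<open>\<i> (i - j)\<close>. Keeping the radial derivative in the same class is what later makes
  it a mode as well.\<close>

lemma mode_poly_grad:
  assumes "mode_poly m p"
  shows "\<exists>p1 p2 q. has_grad p p1 p2 \<and> continuous_on UNIV p1 \<and> continuous_on UNIV p2 \<and> mode_poly m q \<and>
    (\<forall>x. of_real (x$1) * p1 x + of_real (x$2) * p2 x = q x) \<and>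
    (\<forall>x. of_real (x$1) * p2 x - of_real (x$2) * p1 x = \<i> * of_int m * p x)"
  using assms
proof induction
  case (mode_poly_monomial i j c)
  have cz: "has_grad (\<lambda>x. cnj (zc x)) (\<lambda>_. 1) (\<lambda>_. - \<i>)"
    using has_grad_cnj[OF has_grad_zc] by simp
  note h = has_grad_mult[OF has_grad_cmult[OF has_grad_power[OF has_grad_zc, of i], of c] has_grad_power[OF cz, of j]]
  have c: "continuous_on UNIV zc" by (rule has_grad_continuous[OF has_grad_zc])
  let ?q = "\<lambda>x. (of_nat (i + j) * c) * zc x ^ i * cnj (zc x) ^ j"
  have zi: "of_nat k * z ^ (k - 1) * z = of_nat k * z ^ k" for z :: complex and k
    by (cases k) auto
  have z1: "of_real (x$1) * a + of_real (x$2) * (b * \<i>) = zc x * a" if "a = b" for x a b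
    using that by (simp add: zc_def algebra_simps)
  show ?case
  proof (intro exI conjI allI, rule h)
    show "mode_poly (int i - int j) ?q" by (rule mode_poly.intros)
    fix x :: "real^2"
    define P Q where "P = of_nat i * zc x ^ (i - 1)" and "Q = of_nat j * cnj (zc x) ^ (j - 1)"
    have P: "P * zc x = of_nat i * zc x ^ i" and Q: "Q * cnj (zc x) = of_nat j * cnj (zc x) ^ j"
      unfolding P_def Q_def by (rule zi)+
    have "of_real (x$1) * (c * zc x ^ i * (Q * 1) + c * (P * 1) * cnj (zc x) ^ j) +
        of_real (x$2) * (c * zc x ^ i * (Q * - \<i>) + c * (P * \<i>) * cnj (zc x) ^ j)
      = c * zc x ^ i * (Q * (of_real (x$1) - \<i> * of_real (x$2))) + c * (P * (of_real (x$1) + \<i> * of_real (x$2))) * cnj (zc x) ^ j"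
      by (simp add: algebra_simps)
    also have "of_real (x$1) - \<i> * of_real (x$2) = cnj (zc x)" by (simp add: zc_def)
    also have "of_real (x$1) + \<i> * of_real (x$2) = zc x" by (simp add: zc_def)
    finally show "of_real (x$1) * (c * zc x ^ i * (of_nat j * cnj (zc x) ^ (j - 1) * 1) + c * (of_nat i * zc x ^ (i - 1) * 1) * cnj (zc x) ^ j) +
        of_real (x$2) * (c * zc x ^ i * (of_nat j * cnj (zc x) ^ (j - 1) * - \<i>) + c * (of_nat i * zc x ^ (i - 1) * \<i>) * cnj (zc x) ^ j) = ?q x"
      unfolding P Q P_def[symmetric] Q_def[symmetric] by (simp add: algebra_simps)
    have "of_real (x$1) * (c * zc x ^ i * (Q * - \<i>) + c * (P * \<i>) * cnj (zc x) ^ j) -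
        of_real (x$2) * (c * zc x ^ i * (Q * 1) + c * (P * 1) * cnj (zc x) ^ j)
      = - \<i> * c * zc x ^ i * (Q * (of_real (x$1) - \<i> * of_real (x$2))) + \<i> * c * (P * (of_real (x$1) + \<i> * of_real (x$2))) * cnj (zc x) ^ j"
      by (simp add: algebra_simps)
    also have "of_real (x$1) - \<i> * of_real (x$2) = cnj (zc x)" by (simp add: zc_def)
    also have "of_real (x$1) + \<i> * of_real (x$2) = zc x" by (simp add: zc_def)
    finally show "of_real (x$1) * (c * zc x ^ i * (of_nat j * cnj (zc x) ^ (j - 1) * - \<i>) + c * (of_nat i * zc x ^ (i - 1) * \<i>) * cnj (zc x) ^ j) -
        of_real (x$2) * (c * zc x ^ i * (of_nat j * cnj (zc x) ^ (j - 1) * 1) + c * (of_nat i * zc x ^ (i - 1) * 1) * cnj (zc x) ^ j)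
        = \<i> * of_int (int i - int j) * (c * zc x ^ i * cnj (zc x) ^ j)"
      unfolding P Q P_def[symmetric] Q_def[symmetric] by (simp add: algebra_simps)
  qed (use c in \<open>auto intro!: continuous_intros\<close>)
next
  case (mode_poly_add m p q)
  then obtain p1 p2 p' q1 q2 q' where
    p: "has_grad p p1 p2" "continuous_on UNIV p1" "continuous_on UNIV p2" "mode_poly m p'"
      "\<And>x. of_real (x$1) * p1 x + of_real (x$2) * p2 x = p' x"
      "\<And>x. of_real (x$1) * p2 x - of_real (x$2) * p1 x = \<i> * of_int m * p x" and
    q: "has_grad q q1 q2" "continuous_on UNIV q1" "continuous_on UNIV q2" "mode_poly m q'"
      "\<And>x. of_real (x$1) * q1 x + of_real (x$2) * q2 x = q' x"
      "\<And>x. of_real (x$1) * q2 x - of_real (x$2) * q1 x = \<i> * of_int m * q x" by blast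
  show ?case
  proof (intro exI conjI allI, rule has_grad_add[OF p(1) q(1)])
    show "mode_poly m (\<lambda>x. p' x + q' x)" by (rule mode_poly.intros(2)[OF p(4) q(4)])
    fix x
    show "of_real (x$1) * (p1 x + q1 x) + of_real (x$2) * (p2 x + q2 x) = p' x + q' x"
      using p(5)[of x] q(5)[of x] by (simp add: algebra_simps)
    show "of_real (x$1) * (p2 x + q2 x) - of_real (x$2) * (p1 x + q1 x) = \<i> * of_int m * (p x + q x)"
      using p(6)[of x] q(6)[of x] by (simp add: algebra_simps)
  qed (use p q in \<open>auto intro!: continuous_intros\<close>)
qed

inductive plane_poly :: "(real^2 \<Rightarrow> complex) \<Rightarrow> bool" where
  plane_poly_monomial: "plane_poly (\<lambda>x. c * zc x ^ i * cnj (zc x) ^ j)"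
| plane_poly_add: "plane_poly p \<Longrightarrow> plane_poly q \<Longrightarrow> plane_poly (\<lambda>x. p x + q x)"

text \<open>The monomials are collected by \<open>i - j\<close>. The decomposition is asserted for
  every range beyond \<open>N\<close>, so that two polynomials can be written over a common range
  and added.\<close>

lemma plane_poly_modes:
  assumes "plane_poly p"
  shows "\<exists>N P. (\<forall>m. mode_poly m (P m)) \<and> (\<forall>N'\<ge>N. p = (\<lambda>x. \<Sum>m\<in>{-N'..N'}. P m x))"
  using assms
proof induction
  case (plane_poly_monomial c i j)
  define k where "k = int i - int j"
  have "mode_poly m (\<lambda>x. if m = k then c * zc x ^ i * cnj (zc x) ^ j else 0)" for m
    using mode_poly_monomial[of i j c] mode_poly_0 by (cases "m = k") (auto simp: k_def)
  then show ?case
    by (intro exI[of _ "\<bar>k\<bar>"] exI[of _ "\<lambda>m x. if m = k then c * zc x ^ i * cnj (zc x) ^ j else 0"])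
       (auto simp: fun_eq_iff)
next
  case (plane_poly_add p q)
  then obtain N P N' Q where "\<And>m. mode_poly m (P m)" "\<And>m. mode_poly m (Q m)"
    "\<And>M. M \<ge> N \<Longrightarrow> p = (\<lambda>x. \<Sum>m\<in>{-M..M}. P m x)" "\<And>M. M \<ge> N' \<Longrightarrow> q = (\<lambda>x. \<Sum>m\<in>{-M..M}. Q m x)"
    by blast
  then show ?case
    by (intro exI[of _ "max N N'"] exI[of _ "\<lambda>m x. P m x + Q m x"])
       (auto intro: mode_poly_add simp: sum.distrib)
qed

lemma plane_poly_smooth: "plane_poly p \<Longrightarrow> smooth_plane p \<and> smooth_plane (\<lambda>x. cnj (p x))"
  by (induction rule: plane_poly.induct)
     (auto intro!: smooth_plane_zc smooth_plane_power smooth_plane_const intro: smooth_plane_add smooth_plane_mult)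

lemma mode_add:
  assumes "mode m f" "mode m g"
  shows "mode m (\<lambda>x. f x + g x)"
proof -
  obtain e e' where "polar_C1 f e (\<lambda>x. \<i> * of_int m * f x)" "polar_C1 g e' (\<lambda>x. \<i> * of_int m * g x)"
    using assms unfolding mode_def by blast
  from polar_C1_add[OF this] show ?thesis by (intro modeI) (simp add: algebra_simps)
qed

text \<open>A radial cutoff does not mix frequencies, so a cut-off polynomial is still a finite sum
  of modes. A second derivative of \<open>h\<close> enters because \<open>energy_nonneg\<close>
  wants the radial derivatives to be modes too, and these contain the new cutoff
  \<open>2 t h'\<close>.\<close>

lemma energy_cutoff_nonneg:
  assumes p: "plane_poly p" "has_grad p p1 p2"
    and h: "\<And>t. (h has_real_derivative h' t) (at t)" "\<And>t. (h' has_real_derivative h'' t) (at t)" "continuous_on UNIV h''"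
    and d: "d > 0" "\<And>t. t < d \<Longrightarrow> h t = 0" "\<And>t. t > R \<Longrightarrow> h t = 0"
  shows "integrable lborel (\<lambda>x. energy_density (r2 x) (of_real (h (r2 x)) * p x)
      (of_real (h (r2 x)) * (rdr p1 p2 x) + of_real (2 * (r2 x) * h' (r2 x)) * p x)
      (of_real (h (r2 x)) * (dth p1 p2 x)))" (is "integrable lborel ?D")
    "0 \<le> (LINT x|lborel. energy_density (r2 x) (of_real (h (r2 x)) * p x)
      (of_real (h (r2 x)) * (rdr p1 p2 x) + of_real (2 * (r2 x) * h' (r2 x)) * p x)
      (of_real (h (r2 x)) * (dth p1 p2 x)))"
proof -
  obtain N P where P: "\<And>m. mode_poly m (P m)" and pP: "p = (\<lambda>x. \<Sum>m\<in>{-N..N}. P m x)"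
    using plane_poly_modes[OF p(1)] by blast
  obtain P1 P2 E where G: "\<And>m. has_grad (P m) (P1 m) (P2 m)" "\<And>m. continuous_on UNIV (P1 m)" "\<And>m. continuous_on UNIV (P2 m)"
    "\<And>m. mode_poly m (E m)" "\<And>m x. of_real (x$1) * P1 m x + of_real (x$2) * P2 m x = E m x"
    "\<And>m x. of_real (x$1) * P2 m x - of_real (x$2) * P1 m x = \<i> * of_int m * P m x"
    using mode_poly_grad[OF P] by metis
  have cont: "continuous_on UNIV h'"
    using h by (intro continuous_at_imp_continuous_on ballI) (auto intro: DERIV_isCont)
  have h0: "h' t = 0" if "t < d \<or> t > R" for t
  proof -
    have "(h has_real_derivative 0) (at t)"
      by (rule has_field_derivative_transform_within_open[where S="{..<d} \<union> {R<..}" and f="\<lambda>_. 0"])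
         (use that d in auto)
    then show ?thesis using h(1) DERIV_unique by blast
  qed
  have cut: "mode m (\<lambda>x. of_real (H (r2 x)) * q x)"
    if q: "mode_poly m q" and H: "\<And>t. (H has_real_derivative H' t) (at t)" "continuous_on UNIV H'"
      "\<And>t. t < d \<Longrightarrow> H t = 0" "\<And>t. t > R \<Longrightarrow> H t = 0" for m q H H'
  proof -
    obtain q1 q2 where q': "has_grad q q1 q2" "continuous_on UNIV q1" "continuous_on UNIV q2"
      "\<And>x. of_real (x$1) * q2 x - of_real (x$2) * q1 x = \<i> * of_int m * q x"
      using mode_poly_grad[OF q] by metis
    have "(\<lambda>x. of_real (H (r2 x)) * (dth q1 q2 x)) =
        (\<lambda>x. \<i> * of_int m * (of_real (H (r2 x)) * q x))"
      unfolding q'(4) by (simp add: algebra_simps)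
    note eq = this
    show ?thesis
      by (rule modeI, unfold eq[symmetric], rule polar_C1_cutoff[OF q'(1-3) H(1,2) d(1), where R=R])
         (use H in auto)
  qed
  define f where "f m x = of_real (h (r2 x)) * P m x" for m x
  define e where "e m x = of_real (h (r2 x)) * E m x + of_real (2 * (r2 x) * h' (r2 x)) * P m x" for m x
  have f: "polar_C1 (f m) (e m) (\<lambda>x. \<i> * of_int m * f m x)" for m
  proof -
    have eq: "(\<lambda>x. \<i> * of_int m * f m x) =
        (\<lambda>x. of_real (h (r2 x)) * (of_real (x$1) * P2 m x - of_real (x$2) * P1 m x))"
      unfolding G(6) f_def by (simp add: algebra_simps)
    show ?thesis
      unfolding eq unfolding e_def[abs_def] f_def[abs_def] G(5)[symmetric]
      by (rule polar_C1_cutoff[OF G(1-3) h(1) cont d(1), where R=R]) (use d in auto)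
  qed
  have e: "mode m (e m)" for m
    unfolding e_def[abs_def]
  proof (rule mode_add)
    show "mode m (\<lambda>x. of_real (h (r2 x)) * E m x)"
      by (rule cut[OF G(4) h(1) cont]) (use d in auto)
    have *: "((\<lambda>t. 2 * t * h' t) has_real_derivative 2 * h' t + 2 * t * h'' t) (at t)" for t
      by (auto intro!: derivative_eq_intros h)
    show "mode m (\<lambda>x. of_real (2 * (r2 x) * h' (r2 x)) * P m x)"
      by (rule cut[OF P *]) (use h0 h(3) cont in \<open>auto intro!: continuous_intros\<close>)
  qed
  have sums: "p1 = (\<lambda>x. \<Sum>m\<in>{-N..N}. P1 m x)" "p2 = (\<lambda>x. \<Sum>m\<in>{-N..N}. P2 m x)"
    using has_grad_unique[OF p(2)] has_grad_sum[of "{-N..N}" P P1 P2] G(1) pP by auto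
  have 1: "of_real (h (r2 x)) * p x = (\<Sum>m\<in>{-N..N}. f m x)" for x
    by (simp add: pP f_def sum_distrib_left)
  have 2: "of_real (h (r2 x)) * (rdr p1 p2 x) + of_real (2 * (r2 x) * h' (r2 x)) * p x
      = (\<Sum>m\<in>{-N..N}. e m x)" for x
    unfolding e_def pP sums sum_distrib_left sum.distrib[symmetric] G(5)[symmetric] ..
  have 3: "of_real (h (r2 x)) * (dth p1 p2 x) = (\<Sum>m\<in>{-N..N}. \<i> * of_int m * f m x)" for x
  proof -
    have "of_real (h (r2 x)) * (dth p1 p2 x)
        = (\<Sum>m\<in>{-N..N}. of_real (h (r2 x)) * (of_real (x$1) * P2 m x - of_real (x$2) * P1 m x))"
      unfolding sums sum_distrib_left sum_subtractf[symmetric] ..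
    then show ?thesis unfolding G(6) f_def by (simp add: algebra_simps)
  qed
  show "integrable lborel ?D" "0 \<le> (LINT x|lborel. ?D x)"
    unfolding 1 2 3 by (rule energy_nonneg[OF f e])+
qed

lemma plane_poly_mult:
  assumes "plane_poly p" "plane_poly q"
  shows "plane_poly (\<lambda>x. p x * q x)"
  using assms(1)
proof induction
  case (plane_poly_monomial c i j)
  show ?case using assms(2)
  proof induction
    case (plane_poly_monomial c' i' j')
    have "(\<lambda>x. c * zc x ^ i * cnj (zc x) ^ j * (c' * zc x ^ i' * cnj (zc x) ^ j')) =
      (\<lambda>x. (c * c') * zc x ^ (i + i') * cnj (zc x) ^ (j + j'))"
      by (simp add: power_add mult_ac)
    then show ?case by (simp only:) (rule plane_poly.plane_poly_monomial)
  next
    case (plane_poly_add p q)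
    then show ?case unfolding distrib_left by (intro plane_poly.plane_poly_add)
  qed
next
  case (plane_poly_add p q)
  then show ?case unfolding distrib_right by (intro plane_poly.plane_poly_add)
qed

lemma plane_poly_const: "plane_poly (\<lambda>_. c)"
  using plane_poly.intros(1)[of c 0 0] by simp

lemma plane_poly_coordinate: "plane_poly (\<lambda>x. of_real (x $ 1))" "plane_poly (\<lambda>x. of_real (x $ 2))"
proof -
  have "(\<lambda>x::real^2. complex_of_real (x $ 1)) = (\<lambda>x. 1 / 2 * zc x ^ 1 * cnj (zc x) ^ 0 + 1 / 2 * zc x ^ 0 * cnj (zc x) ^ 1)"
    by (simp add: zc_def fun_eq_iff field_simps)
  then show "plane_poly (\<lambda>x. of_real (x $ 1))"
    by (simp only:) (rule plane_poly_add; rule plane_poly_monomial)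
  have "(\<lambda>x::real^2. complex_of_real (x $ 2)) = (\<lambda>x. (- \<i> / 2) * zc x ^ 1 * cnj (zc x) ^ 0 + (\<i> / 2) * zc x ^ 0 * cnj (zc x) ^ 1)"
    by (simp add: zc_def fun_eq_iff field_simps)
  then show "plane_poly (\<lambda>x. of_real (x $ 2))"
    by (simp only:) (rule plane_poly_add; rule plane_poly_monomial)
qed

lemma plane_poly_power: "plane_poly p \<Longrightarrow> plane_poly (\<lambda>x. p x ^ n)"
  by (induction n) (auto intro: plane_poly_const plane_poly_mult)

section \<open>Uniform approximation of test functions together with their gradients\<close>

text \<open>Polynomials in the real coordinates, the form in which Weierstrass approximation
  supplies them and in which they can be integrated in one coordinate;
  \<open>xy_poly_imp_plane_poly\<close> returns to \<open>z\<close> and its conjugate.\<close>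

inductive xy_poly :: "(real^2 \<Rightarrow> complex) \<Rightarrow> bool" where
  xy_poly_monomial: "xy_poly (\<lambda>x. c * of_real (x$1) ^ i * of_real (x$2) ^ j)"
| xy_poly_add: "xy_poly p \<Longrightarrow> xy_poly q \<Longrightarrow> xy_poly (\<lambda>x. p x + q x)"

lemma xy_poly_mult:
  assumes "xy_poly p" "xy_poly q"
  shows "xy_poly (\<lambda>x. p x * q x)"
  using assms(1)
proof induction
  case (xy_poly_monomial c i j)
  show ?case using assms(2)
  proof induction
    case (xy_poly_monomial c' i' j')
    have "(\<lambda>x::real^2. c * of_real (x$1) ^ i * of_real (x$2) ^ j * (c' * of_real (x$1) ^ i' * of_real (x$2) ^ j')) =
      (\<lambda>x. (c * c') * of_real (x$1) ^ (i + i') * of_real (x$2) ^ (j + j'))"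
      by (simp add: power_add mult_ac)
    then show ?case by (simp only:) (rule xy_poly.xy_poly_monomial)
  next
    case (xy_poly_add p q)
    then show ?case unfolding distrib_left by (intro xy_poly.xy_poly_add)
  qed
next
  case (xy_poly_add p q)
  then show ?case unfolding distrib_right by (intro xy_poly.xy_poly_add)
qed

lemma xy_poly_const: "xy_poly (\<lambda>_. c)"
  using xy_poly.intros(1)[of c 0 0] by simp

lemma xy_poly_of_real_polynomial:
  fixes q :: "real^2 \<Rightarrow> real"
  assumes "real_polynomial_function q"
  shows "xy_poly (\<lambda>x. of_real (q x))"
  using assms
proof induction
  case (linear f)
  then interpret bounded_linear f .
  have "f x = x$1 * f (axis 1 1) + x$2 * f (axis 2 1)" for x
  proof -
    have "x = x$1 *\<^sub>R axis 1 1 + x$2 *\<^sub>R axis 2 1"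
      by (auto simp: vec_eq_iff forall_2)
    then have "f x = f (x$1 *\<^sub>R axis 1 1 + x$2 *\<^sub>R axis 2 1)" by (rule arg_cong)
    then show ?thesis by (simp only: add scaleR real_scaleR_def)
  qed
  note f_eq = this
  have "(\<lambda>x. complex_of_real (f x)) = (\<lambda>x. of_real (f (axis 1 1)) * of_real (x$1) ^ 1 * of_real (x$2) ^ 0
      + of_real (f (axis 2 1)) * of_real (x$1) ^ 0 * of_real (x$2) ^ 1)"
    by (rule ext, subst f_eq) simp
  then show ?case by (simp only:) (rule xy_poly_add; rule xy_poly_monomial)
next
  case (const c)
  then show ?case by (rule xy_poly_const)
next
  case (add f g)
  then show ?case using xy_poly_add[of "\<lambda>x. of_real (f x)" "\<lambda>x. of_real (g x)"] by simp
next
  case (mult f g)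
  then show ?case using xy_poly_mult[of "\<lambda>x. of_real (f x)" "\<lambda>x. of_real (g x)"] by simp
qed

lemma xy_poly_imp_plane_poly: "xy_poly p \<Longrightarrow> plane_poly p"
  by (induction rule: xy_poly.induct)
     (intro plane_poly_mult plane_poly_const plane_poly_power plane_poly_coordinate, rule plane_poly_add)

lemma has_grad_coordinate:
  "has_grad (\<lambda>x. of_real (x$1)) (\<lambda>_. 1) (\<lambda>_. 0)" "has_grad (\<lambda>x. of_real (x$2)) (\<lambda>_. 0) (\<lambda>_. 1)"
  using has_grad_coord[OF DERIV_ident, of 1] has_grad_coord[OF DERIV_ident, of 2] by simp_all

text \<open>Integration in the first coordinate starting from the line \<open>x$1 = b\<close>, which
  explains the second monomial subtracted in the proof.\<close>

lemma xy_poly_antiderivative_1: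
  assumes "xy_poly q"
  shows "\<exists>p p2. xy_poly p \<and> has_grad p q p2 \<and> (\<forall>x. x$1 = b \<longrightarrow> p x = 0)"
  using assms
proof induction
  case (xy_poly_monomial c i j)
  let ?p = "\<lambda>x::real^2. (c / of_nat (Suc i)) * of_real (x$1) ^ Suc i * of_real (x$2) ^ j +
    (- c / of_nat (Suc i) * of_real b ^ Suc i) * of_real (x$1) ^ 0 * of_real (x$2) ^ j"
  have "has_grad ?p (\<lambda>x. (c / of_nat (Suc i)) * of_real (x$1) ^ Suc i * (of_nat j * of_real (x$2) ^ (j - 1) * 0) +
       (c / of_nat (Suc i)) * (of_nat (Suc i) * of_real (x$1) ^ (Suc i - 1) * 1) * of_real (x$2) ^ j
     + ((- c / of_nat (Suc i) * of_real b ^ Suc i) * of_real (x$1) ^ 0 * (of_nat j * of_real (x$2) ^ (j - 1) * 0) +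
       (- c / of_nat (Suc i) * of_real b ^ Suc i) * (of_nat 0 * of_real (x$1) ^ (0 - 1) * 1) * of_real (x$2) ^ j))
     (\<lambda>x. (c / of_nat (Suc i)) * of_real (x$1) ^ Suc i * (of_nat j * of_real (x$2) ^ (j - 1) * 1) +
       (c / of_nat (Suc i)) * (of_nat (Suc i) * of_real (x$1) ^ (Suc i - 1) * 0) * of_real (x$2) ^ j
     + ((- c / of_nat (Suc i) * of_real b ^ Suc i) * of_real (x$1) ^ 0 * (of_nat j * of_real (x$2) ^ (j - 1) * 1) +
       (- c / of_nat (Suc i) * of_real b ^ Suc i) * (of_nat 0 * of_real (x$1) ^ (0 - 1) * 0) * of_real (x$2) ^ j))"
    (is "has_grad _ ?g1 ?g2")
    by (intro has_grad_add has_grad_mult[OF has_grad_cmult[OF has_grad_power] has_grad_power] has_grad_coordinate)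
  moreover have "?g1 = (\<lambda>x. c * of_real (x$1) ^ i * of_real (x$2) ^ j)"
    by (simp add: fun_eq_iff del: of_nat_Suc)
  ultimately have "has_grad ?p (\<lambda>x. c * of_real (x$1) ^ i * of_real (x$2) ^ j) ?g2" by simp
  moreover have "xy_poly ?p" by (intro xy_poly.intros)
  moreover have "\<forall>x. x$1 = b \<longrightarrow> ?p x = 0" by simp
  ultimately show ?case by blast
next
  case (xy_poly_add q q')
  then obtain p p2 p' p2' where "xy_poly p" "has_grad p q p2" "\<And>x. x$1 = b \<Longrightarrow> p x = 0"
    "xy_poly p'" "has_grad p' q' p2'" "\<And>x. x$1 = b \<Longrightarrow> p' x = 0" by blast
  then show ?case
    by (intro exI[of _ "\<lambda>x. p x + p' x"] exI[of _ "\<lambda>x. p2 x + p2' x"]) (auto intro: xy_poly.intros has_grad_add)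
qed

lemma xy_poly_antiderivative_2:
  assumes "xy_poly q"
  shows "\<exists>p p1. xy_poly p \<and> has_grad p p1 q \<and> (\<forall>x. x$2 = b \<longrightarrow> p x = 0)"
  using assms
proof induction
  case (xy_poly_monomial c i j)
  let ?p = "\<lambda>x::real^2. (c / of_nat (Suc j)) * of_real (x$1) ^ i * of_real (x$2) ^ Suc j +
    (- c / of_nat (Suc j) * of_real b ^ Suc j) * of_real (x$1) ^ i * of_real (x$2) ^ 0"
  have "has_grad ?p (\<lambda>x. (c / of_nat (Suc j)) * of_real (x$1) ^ i * (of_nat (Suc j) * of_real (x$2) ^ (Suc j - 1) * 0) +
       (c / of_nat (Suc j)) * (of_nat i * of_real (x$1) ^ (i - 1) * 1) * of_real (x$2) ^ Suc j
     + ((- c / of_nat (Suc j) * of_real b ^ Suc j) * of_real (x$1) ^ i * (of_nat 0 * of_real (x$2) ^ (0 - 1) * 0) +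
       (- c / of_nat (Suc j) * of_real b ^ Suc j) * (of_nat i * of_real (x$1) ^ (i - 1) * 1) * of_real (x$2) ^ 0))
     (\<lambda>x. (c / of_nat (Suc j)) * of_real (x$1) ^ i * (of_nat (Suc j) * of_real (x$2) ^ (Suc j - 1) * 1) +
       (c / of_nat (Suc j)) * (of_nat i * of_real (x$1) ^ (i - 1) * 0) * of_real (x$2) ^ Suc j
     + ((- c / of_nat (Suc j) * of_real b ^ Suc j) * of_real (x$1) ^ i * (of_nat 0 * of_real (x$2) ^ (0 - 1) * 1) +
       (- c / of_nat (Suc j) * of_real b ^ Suc j) * (of_nat i * of_real (x$1) ^ (i - 1) * 0) * of_real (x$2) ^ 0))"
    (is "has_grad _ ?g1 ?g2")
    by (intro has_grad_add has_grad_mult[OF has_grad_cmult[OF has_grad_power] has_grad_power] has_grad_coordinate)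
  moreover have "?g2 = (\<lambda>x. c * of_real (x$1) ^ i * of_real (x$2) ^ j)"
    by (simp add: fun_eq_iff del: of_nat_Suc)
  ultimately have "has_grad ?p ?g1 (\<lambda>x. c * of_real (x$1) ^ i * of_real (x$2) ^ j)" by simp
  moreover have "xy_poly ?p" by (intro xy_poly.intros)
  moreover have "\<forall>x. x$2 = b \<longrightarrow> ?p x = 0" by simp
  ultimately show ?case by blast
next
  case (xy_poly_add q q')
  then obtain p p2 p' p2' where "xy_poly p" "has_grad p p2 q" "\<And>x. x$2 = b \<Longrightarrow> p x = 0"
    "xy_poly p'" "has_grad p' p2' q'" "\<And>x. x$2 = b \<Longrightarrow> p' x = 0" by blast
  then show ?case
    by (intro exI[of _ "\<lambda>x. p x + p' x"] exI[of _ "\<lambda>x. p2 x + p2' x"]) (auto intro: xy_poly.intros has_grad_add)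
qed

lemma xy_poly_approx:
  assumes "continuous_on UNIV f" "compact S" "\<epsilon> > 0"
  shows "\<exists>q. xy_poly q \<and> (\<forall>x\<in>S. norm (f x - q x) \<le> \<epsilon>)"
proof -
  have c: "continuous_on S (\<lambda>x. Re (f x))" "continuous_on S (\<lambda>x. Im (f x))"
    using assms(1) by (auto intro!: continuous_intros intro: continuous_on_subset)
  obtain a where a: "real_polynomial_function a" "\<And>x. x \<in> S \<Longrightarrow> \<bar>Re (f x) - a x\<bar> < \<epsilon> / 2"
    using Stone_Weierstrass_real_polynomial_function[OF assms(2) c(1), of "\<epsilon> / 2"] assms(3) by auto
  obtain b where b: "real_polynomial_function b" "\<And>x. x \<in> S \<Longrightarrow> \<bar>Im (f x) - b x\<bar> < \<epsilon> / 2"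
    using Stone_Weierstrass_real_polynomial_function[OF assms(2) c(2), of "\<epsilon> / 2"] assms(3) by auto
  let ?q = "\<lambda>x. of_real (a x) + \<i> * of_real (b x)"
  have "xy_poly ?q"
    by (intro xy_poly_add xy_poly_mult xy_poly_const xy_poly_of_real_polynomial a b)
  moreover have "norm (f x - ?q x) \<le> \<epsilon>" if "x \<in> S" for x
    using cmod_le[of "f x - ?q x"] a(2)[OF that] b(2)[OF that] by simp
  ultimately show ?thesis by blast
qed

text \<open>A square and not a disc: the axis-parallel segments from any of its points to the edges
  \<open>x$1 = - R\<close> and \<open>x$2 = - R\<close> stay inside.\<close>

definition box2 :: "real \<Rightarrow> (real^2) set" where
  "box2 R = {x. \<bar>x$1\<bar> \<le> R \<and> \<bar>x$2\<bar> \<le> R}"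

lemma convex_box2: "convex (box2 R)"
proof -
  have "box2 R = {x. axis 1 1 \<bullet> x \<le> R} \<inter> {x. axis 1 1 \<bullet> x \<ge> -R} \<inter> {x. axis 2 1 \<bullet> x \<le> R} \<inter> {x. axis 2 1 \<bullet> x \<ge> -R}"
    by (auto simp: box2_def inner_plane)
  then show ?thesis by (simp add: convex_Int convex_halfspace_le convex_halfspace_ge)
qed

lemma box_increment:
  assumes F: "has_grad F F1 F2" and x: "x \<in> box2 R" and y: "y \<in> box2 R"
    and C: "\<And>z. z \<in> box2 R \<Longrightarrow> norm (of_real ((y - x) $ 1) * F1 z + of_real ((y - x) $ 2) * F2 z) \<le> C"
  shows "norm (F y - F x) \<le> C"
proof -
  have "norm (F (x + (y - x)) - F x) \<le> C"
  proof (rule norm_increment_le[OF has_gradD[OF F]], rule C)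
    fix \<tau> :: real assume "0 < \<tau>" "\<tau> < 1"
    with convexD_alt[OF convex_box2 x y, of \<tau>] show "x + \<tau> *\<^sub>R (y - x) \<in> box2 R"
      by (simp add: algebra_simps)
  qed
  then show ?thesis by simp
qed

lemma box_increment_1:
  assumes F: "has_grad F F1 F2" and C: "\<And>x. x \<in> box2 R \<Longrightarrow> norm (F1 x) \<le> C"
    and "x \<in> box2 R" "y \<in> box2 R" "y$2 = x$2"
  shows "norm (F y - F x) \<le> C * \<bar>y$1 - x$1\<bar>"
proof (rule box_increment[OF F assms(3,4)])
  fix z assume "z \<in> box2 R"
  from mult_left_mono[OF C[OF this], of "\<bar>y$1 - x$1\<bar>"]
  have "norm (of_real ((y - x) $ 1) * F1 z) \<le> C * \<bar>y$1 - x$1\<bar>"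
    unfolding norm_mult by (simp add: mult.commute del: of_real_diff)
  then show "norm (of_real ((y - x) $ 1) * F1 z + of_real ((y - x) $ 2) * F2 z) \<le> C * \<bar>y$1 - x$1\<bar>"
    using assms(5) by simp
qed

lemma box_increment_2:
  assumes F: "has_grad F F1 F2" and C: "\<And>x. x \<in> box2 R \<Longrightarrow> norm (F2 x) \<le> C"
    and "x \<in> box2 R" "y \<in> box2 R" "y$1 = x$1"
  shows "norm (F y - F x) \<le> C * \<bar>y$2 - x$2\<bar>"
proof (rule box_increment[OF F assms(3,4)])
  fix z assume "z \<in> box2 R"
  from mult_left_mono[OF C[OF this], of "\<bar>y$2 - x$2\<bar>"]
  have "norm (of_real ((y - x) $ 2) * F2 z) \<le> C * \<bar>y$2 - x$2\<bar>"
    unfolding norm_mult by (simp add: mult.commute del: of_real_diff)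
  then show "norm (of_real ((y - x) $ 1) * F1 z + of_real ((y - x) $ 2) * F2 z) \<le> C * \<bar>y$2 - x$2\<bar>"
    using assms(5) by simp
qed

text \<open>The bound on \<open>D2\<close> integrates the increments of \<open>D1\<close> in the second variable, so that the
  symmetry of the mixed partial derivatives is not needed.\<close>

lemma box_C1_bound:
  assumes D: "has_grad D D1 D2" and D1: "has_grad D1 D11 D12"
    and \<epsilon>: "\<And>x. x \<in> box2 R \<Longrightarrow> norm (D12 x) \<le> \<epsilon>"
    and z2: "\<And>x. x$2 = - R \<Longrightarrow> D1 x = 0" and z1: "\<And>x. x$1 = - R \<Longrightarrow> D x = 0"
    and R: "R > 0" and x: "\<bar>x$1\<bar> < R" "\<bar>x$2\<bar> < R"
  shows "norm (D1 x) \<le> 2 * R * \<epsilon>" "norm (D x) \<le> 4 * R^2 * \<epsilon>" "norm (D2 x) \<le> 2 * R * \<epsilon>"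
proof -
  have e0: "\<epsilon> \<ge> 0"
    using order_trans[OF norm_ge_zero \<epsilon>[of 0]] R by (simp add: box2_def)
  have b1: "norm (D1 y) \<le> 2 * R * \<epsilon>" if y: "y \<in> box2 R" for y
  proof -
    define z where "z = ((\<chi> i. if i = 2 then - R else y$1) :: real^2)"
    have z: "z $ 1 = y $ 1" "z $ 2 = - R" by (simp_all add: z_def)
    have zb: "z \<in> box2 R" using y R z by (auto simp: box2_def)
    have "norm (D1 y) \<le> \<epsilon> * \<bar>y$2 + R\<bar>"
      using box_increment_2[OF D1 \<epsilon> zb y] z z2[OF z(2)] by simp
    also have "\<dots> \<le> \<epsilon> * (2 * R)" using y e0 by (intro mult_left_mono) (auto simp: box2_def)
    finally show ?thesis by (simp add: mult_ac)
  qed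
  have xb: "x \<in> box2 R" using x by (simp add: box2_def)
  show "norm (D1 x) \<le> 2 * R * \<epsilon>" by (rule b1[OF xb])
  define z where "z = ((\<chi> i. if i = 1 then - R else x$2) :: real^2)"
  have z: "z $ 1 = - R" "z $ 2 = x $ 2" by (simp_all add: z_def)
  have zb: "z \<in> box2 R" using xb R z by (auto simp: box2_def)
  have "norm (D x) \<le> 2 * R * \<epsilon> * \<bar>x$1 + R\<bar>"
    using box_increment_1[OF D b1 zb xb] z z1[OF z(1)] by simp
  also have "\<dots> \<le> 2 * R * \<epsilon> * (2 * R)" using x e0 R by (intro mult_left_mono) auto
  finally show "norm (D x) \<le> 4 * R^2 * \<epsilon>" by (simp add: power2_eq_square mult_ac)
  have inc: "norm ((D (s *\<^sub>R axis 2 1 + x) - D x) /\<^sub>R s) \<le> 2 * R * \<epsilon>" if s: "s \<noteq> 0" "\<bar>s\<bar> < R - \<bar>x$2\<bar>" for s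
  proof -
    let ?e = "s *\<^sub>R axis 2 1 :: real^2"
    let ?F = "\<lambda>y. D (?e + y) + (- 1) * D y"
    have sh: "has_grad (\<lambda>y. D (?e + y)) (\<lambda>y. D1 (?e + y)) (\<lambda>y. D2 (?e + y))"
      unfolding has_grad_def
    proof
      fix y
      show "((\<lambda>y. D (?e + y)) has_derivative (\<lambda>h. of_real (h$1) * D1 (?e + y) + of_real (h$2) * D2 (?e + y))) (at y)"
        by (rule has_derivative_compose[OF _ has_gradD[OF D], of "\<lambda>y. ?e + y" "\<lambda>h. h"]) (auto intro!: derivative_eq_intros)
    qed
    have F: "has_grad ?F (\<lambda>y. D1 (?e + y) + (- 1) * D1 y) (\<lambda>y. D2 (?e + y) + (- 1) * D2 y)"
      by (intro has_grad_add sh has_grad_cmult D)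
    have "norm (?F x - ?F z) \<le> \<epsilon> * \<bar>s\<bar> * \<bar>x$1 - z$1\<bar>"
    proof -
      have seg: "norm (D1 (?e + y) + (- 1) * D1 y) \<le> \<epsilon> * \<bar>s\<bar>" if y: "y \<in> box2 R" "y $ 2 = x $ 2" for y
        using box_increment_2[OF D1 \<epsilon> y(1), of "?e + y"] y s by (auto simp: box2_def)
      have "norm (?F (z + (x - z)) - ?F z) \<le> \<epsilon> * \<bar>s\<bar> * \<bar>x$1 - z$1\<bar>"
      proof (rule norm_increment_le[OF has_gradD[OF F]])
        fix \<tau> :: real assume t: "0 < \<tau>" "\<tau> < 1"
        have a: "0 < x$1 + R" using x by simp
        have "\<tau> * (x$1 + R) < x$1 + R" using mult_strict_right_mono[OF t(2) a] by (simp only: mult_1)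
        moreover have "0 \<le> \<tau> * (x$1 + R)" using a t by simp
        moreover have "\<tau> * (x$1 + R) = \<tau> * x$1 + \<tau> * R" by (simp add: distrib_left)
        ultimately have "z + \<tau> *\<^sub>R (x - z) \<in> box2 R" using x t z
          by (auto simp: box2_def)
        then have "norm (D1 (?e + (z + \<tau> *\<^sub>R (x - z))) + (- 1) * D1 (z + \<tau> *\<^sub>R (x - z))) \<le> \<epsilon> * \<bar>s\<bar>"
          by (rule seg) (use z in simp)
        from mult_left_mono[OF this, of "\<bar>x$1 - z$1\<bar>"]
        have "norm (of_real ((x - z) $ 1) * (D1 (?e + (z + \<tau> *\<^sub>R (x - z))) + (- 1) * D1 (z + \<tau> *\<^sub>R (x - z)))) \<le> \<epsilon> * \<bar>s\<bar> * \<bar>x$1 - z$1\<bar>"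
          unfolding norm_mult by (simp add: mult.commute del: of_real_diff)
        then show "norm (of_real ((x - z) $ 1) * (D1 (?e + (z + \<tau> *\<^sub>R (x - z))) + (- 1) * D1 (z + \<tau> *\<^sub>R (x - z)))
          + of_real ((x - z) $ 2) * (D2 (?e + (z + \<tau> *\<^sub>R (x - z))) + (- 1) * D2 (z + \<tau> *\<^sub>R (x - z)))) \<le> \<epsilon> * \<bar>s\<bar> * \<bar>x$1 - z$1\<bar>"
          using z by simp
      qed
      then show ?thesis by simp
    qed
    also have "?F z = 0" using z1[of z] z1[of "?e + z"] z by simp
    also have "\<epsilon> * \<bar>s\<bar> * \<bar>x$1 - z$1\<bar> \<le> \<epsilon> * \<bar>s\<bar> * (2 * R)" using x e0 z by (intro mult_left_mono) auto
    finally have "norm (D (?e + x) - D x) \<le> \<epsilon> * \<bar>s\<bar> * (2 * R)" by simp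
    then show ?thesis using s by (simp add: divide_simps) (simp add: mult_ac)
  qed
  have "((\<lambda>s. (D (s *\<^sub>R axis 2 1 + x) - D x) /\<^sub>R s) \<longlongrightarrow> D2 x) (at 0)"
    using has_derivative_directional_limit[OF has_gradD[OF D], of "axis 2 1" x] by simp
  then show "norm (D2 x) \<le> 2 * R * \<epsilon>"
  proof (rule Lim_norm_ubound[rotated])
    show "\<forall>\<^sub>F s in at 0. norm ((D (s *\<^sub>R axis 2 1 + x) - D x) /\<^sub>R s) \<le> 2 * R * \<epsilon>"
      unfolding eventually_at using inc x by (intro exI[of _ "R - \<bar>x$2\<bar>"]) auto
  qed simp
qed

text \<open>Approximating \<eta> alone would say nothing about its gradient. Instead the mixed
  derivative is approximated uniformly on a square outside which \<eta> vanishes, and the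
  approximating polynomial is integrated twice, once in each coordinate, from edges where \<eta> and
  its first derivative are zero.\<close>

lemma test_function_C1_approx:
  assumes "\<eta> \<in> test_functions (UNIV :: (real^2) set)" "\<epsilon> > 0"
  shows "\<exists>p p1 p2. plane_poly p \<and> has_grad p p1 p2 \<and> (\<forall>x. norm x \<le> B \<longrightarrow> norm (\<eta> x - p x) \<le> \<epsilon> \<and>
    norm (pd1 \<eta> x - p1 x) \<le> \<epsilon> \<and> norm (pd2 \<eta> x - p2 x) \<le> \<epsilon>)"
proof -
  let ?d1 = "pd1 :: (real^2 \<Rightarrow> complex) \<Rightarrow> _" and ?d2 = "pd2 :: (real^2 \<Rightarrow> complex) \<Rightarrow> _"
  have g: "has_grad \<eta> (?d1 \<eta>) (?d2 \<eta>)" by (rule test_functionD[OF assms(1)])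
  have c2: "Ck (Suc (Suc 0)) (?d1 \<eta>)" by (rule test_functionD[OF assms(1)])
  have g1: "has_grad (?d1 \<eta>) (?d1 (?d1 \<eta>)) (?d2 (?d1 \<eta>))" by (rule Ck_Suc_D[OF c2])
  have c: "continuous_on UNIV (?d2 (?d1 \<eta>))"
    using Ck_Suc_D(3)[OF c2] Ck_Suc_D(1)[of 0] has_grad_continuous by blast
  obtain R0 where R0: "\<And>x. norm x > R0 \<Longrightarrow> \<eta> x = 0" using test_functionD(5)[OF assms(1)] by blast
  define R where "R = max 1 (max R0 B + 1)"
  have R: "R \<ge> 1" "R > R0" "R > B" by (auto simp: R_def)
  have zero: "\<eta> x = 0 \<and> ?d1 \<eta> x = 0" if "\<bar>x$i\<bar> \<ge> R" for x i
  proof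
    have n: "norm x > R0" using component_le_norm_cart[of x i] that R by linarith
    then show "\<eta> x = 0" by (rule R0)
    have "((\<lambda>_. 0) has_derivative (\<lambda>_. 0)) (at x)" by simp
    then have "(\<eta> has_derivative (\<lambda>_. 0)) (at x)"
      by (rule has_derivative_transform_within_open[where s="- cball 0 R0"]) (use n R0 in auto)
    from fun_cong[OF has_derivative_unique[OF has_gradD[OF g] this], of "axis 1 1"]
    show "?d1 \<eta> x = 0" by simp
  qed
  \<comment> \<open>The largest constant in \<open>box_C1_bound\<close> is \<open>4 R^2\<close>; as
    \<open>R \<ge> 1\<close>, it also covers the constant \<open>2 R\<close> of the two gradient
    bounds.\<close>
  define \<delta> where "\<delta> = \<epsilon> / (4 * R^2)"
  have \<delta>: "\<delta> > 0" using assms(2) R by (simp add: \<delta>_def)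
  have "box2 R \<subseteq> cball 0 (R + R)"
  proof
    fix x assume "x \<in> box2 R"
    then show "x \<in> cball 0 (R + R)"
      using norm_le_l1_cart[of x] by (auto simp: box2_def UNIV_2)
  qed
  then obtain P where P: "xy_poly P" "\<And>x. x \<in> box2 R \<Longrightarrow> norm (?d2 (?d1 \<eta>) x - P x) \<le> \<delta>"
    using xy_poly_approx[OF c compact_cball \<delta>, of 0 "R + R"] by blast
  obtain Q Q1 where Q: "xy_poly Q" "has_grad Q Q1 P" "\<And>x. x$2 = -R \<Longrightarrow> Q x = 0"
    using xy_poly_antiderivative_2[OF P(1), of "- R"] by blast
  obtain p p2 where p: "xy_poly p" "has_grad p Q p2" "\<And>x. x$1 = -R \<Longrightarrow> p x = 0"
    using xy_poly_antiderivative_1[OF Q(1), of "- R"] by blast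
  have "norm (\<eta> x - p x) \<le> \<epsilon> \<and> norm (?d1 \<eta> x - Q x) \<le> \<epsilon> \<and> norm (?d2 \<eta> x - p2 x) \<le> \<epsilon>" if x: "norm x \<le> B" for x
  proof -
    have D: "has_grad (\<lambda>x. \<eta> x + (- 1) * p x) (\<lambda>x. ?d1 \<eta> x + (- 1) * Q x) (\<lambda>x. ?d2 \<eta> x + (- 1) * p2 x)"
      by (intro has_grad_add has_grad_cmult g p)
    have D1: "has_grad (\<lambda>x. ?d1 \<eta> x + (- 1) * Q x) (\<lambda>x. ?d1 (?d1 \<eta>) x + (- 1) * Q1 x) (\<lambda>x. ?d2 (?d1 \<eta>) x + (- 1) * P x)"
      by (intro has_grad_add has_grad_cmult g1 Q)
    have xR: "\<bar>x$1\<bar> < R" "\<bar>x$2\<bar> < R"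
      using component_le_norm_cart[of x 1] component_le_norm_cart[of x 2] x R by linarith+
    have *: "norm (?d2 (?d1 \<eta>) x + (- 1) * P x) \<le> \<delta>" if "x \<in> box2 R" for x using P(2)[OF that] by simp
    have z2: "?d1 \<eta> x + (- 1) * Q x = 0" if "x$2 = - R" for x using zero[of x 2] Q(3)[OF that] that R by simp
    have z1: "\<eta> x + (- 1) * p x = 0" if "x$1 = - R" for x using zero[of x 1] p(3)[OF that] that R by simp
    have "R > 0" using R by simp
    note b = box_C1_bound[OF D D1 * z2 z1 \<open>R > 0\<close> xR]
    have "4 * R^2 * \<delta> = \<epsilon>" using R by (simp add: \<delta>_def)
    moreover have "2 * R * \<delta> \<le> 4 * R^2 * \<delta>"
      using R \<delta> by (intro mult_right_mono) (auto simp: power2_eq_square)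
    ultimately show ?thesis using b by auto
  qed
  then show ?thesis using xy_poly_imp_plane_poly[OF p(1)] p(2) by blast
qed

section \<open>Weak derivatives\<close>

text \<open>Boxes are stable under intersection and generate the Borel sets, so the integral of
  \<open>g\<close> over every Borel set is zero by the argument for Dynkin systems.\<close>

lemma AE_zero_of_box_integrals:
  fixes g :: "'a::euclidean_space \<Rightarrow> complex"
  assumes g: "integrable lborel g" and box: "\<And>a b. (LINT x:box a b|lborel. g x) = 0"
  shows "AE x in lborel. g x = 0"
proof (rule sigma_finite_measure.density_zero[OF sigma_finite_lborel g])
  have int: "set_integrable lborel A g" if "A \<in> sets lborel" for A
    using g that unfolding set_integrable_def by (intro integrable_mult_indicator) auto
  \<comment> \<open>The whole space is needed for the complement case of the induction; it is
    exhausted by boxes.\<close>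
  have "(LINT x|lborel. g x) = 0"
  proof -
    have "(\<lambda>n. LINT x:box (- real n *\<^sub>R One) (real n *\<^sub>R One)|lborel. g x) \<longlonglongrightarrow> (LINT x|lborel. g x)"
      unfolding set_lebesgue_integral_def
    proof (rule integral_dominated_convergence[where w="\<lambda>x. norm (g x)"])
      show "AE x in lborel. (\<lambda>n. indicator (box (- real n *\<^sub>R One) (real n *\<^sub>R One)) x *\<^sub>R g x) \<longlonglongrightarrow> g x"
      proof (intro AE_I2)
        fix x :: 'a
        obtain N where N: "norm x < real N" using reals_Archimedean2 by blast
        have "x \<in> box (- real n *\<^sub>R One) (real n *\<^sub>R One)" if "n \<ge> N" for n
        proof -
          have "\<bar>x \<bullet> i\<bar> < real n" if "i \<in> Basis" for i
            using Basis_le_norm[OF that, of x] N \<open>n \<ge> N\<close> by linarith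
          then show ?thesis by (force simp: mem_box)
        qed
        then show "(\<lambda>n. indicator (box (- real n *\<^sub>R One) (real n *\<^sub>R One)) x *\<^sub>R g x) \<longlonglongrightarrow> g x"
          by (intro tendsto_eventually) (auto simp: eventually_sequentially intro!: exI[of _ N])
      qed
    qed (use g in \<open>auto simp: indicator_def\<close>)
    then show ?thesis unfolding box using LIMSEQ_unique tendsto_const by blast
  qed
  note total = this
  fix A :: "'a set" assume "A \<in> sets lborel"
  have "Int_stable (range (\<lambda>(a, b). box a b :: 'a set))"
    by (auto simp: Int_stable_def box_Int_box)
  moreover have "range (\<lambda>(a, b). box a b :: 'a set) \<subseteq> Pow UNIV" by auto
  moreover have "A \<in> sigma_sets UNIV (range (\<lambda>(a, b). box a b))"
    using \<open>A \<in> sets lborel\<close> by (simp add: borel_eq_box)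
  ultimately show "(LINT x:A|lborel. g x) = 0"
  proof (induction rule: sigma_sets_induct_disjoint)
    case (basic A)
    then show ?case using box by auto
  next
    case empty
    then show ?case by (simp add: set_lebesgue_integral_def)
  next
    case (compl A)
    then have A: "A \<in> sets lborel" by (simp add: borel_eq_box)
    have "(LINT x:UNIV - A|lborel. g x) = (LINT x|lborel. g x - indicator A x *\<^sub>R g x)"
      unfolding set_lebesgue_integral_def by (rule Bochner_Integration.integral_cong) (auto simp: indicator_def)
    also have "\<dots> = 0"
      using int[OF A] g total compl unfolding set_integrable_def set_lebesgue_integral_def by simp
    finally show ?case .
  next
    case (union A)
    have A: "A i \<in> sets lborel" for i using union(2) by (auto simp: borel_eq_box)
    show ?case
      using lebesgue_integral_countable_add[of A lborel g] union(1,3) A int[of "\<Union>i. A i"]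
      by (auto simp: disjoint_family_on_def)
  qed
qed

lemma flat_bound: "c > 0 \<Longrightarrow> 0 \<le> flat c 0 x \<and> flat c 0 x \<le> 1"
  by (auto simp: flat_def)

lemma flat_tendsto_1: "x > 0 \<Longrightarrow> (\<lambda>n. flat (1 / real (Suc n)) 0 x) \<longlonglongrightarrow> 1"
proof -
  assume x: "x > 0"
  have "(\<lambda>n. exp (- (1 / real (Suc n)) / x)) \<longlonglongrightarrow> exp (- 0 / x)"
    using LIMSEQ_inverse_real_of_nat x by (intro tendsto_intros) (auto simp: inverse_eq_divide)
  then show ?thesis using x by (simp add: flat_def)
qed

text \<open>Since \<open>exp (- 1 / ((n + 1) y))\<close> tends to 1 for every \<open>y > 0\<close>,
  these smooth functions converge pointwise to the indicator of the open box as \<open>n\<close>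
  grows.\<close>

definition box_bump :: "real^2 \<Rightarrow> real^2 \<Rightarrow> nat \<Rightarrow> real^2 \<Rightarrow> real" where
  "box_bump a b n x = (flat (1 / real (Suc n)) 0 (x$1 - a$1) * flat (1 / real (Suc n)) 0 (b$1 - x$1)) *
     (flat (1 / real (Suc n)) 0 (x$2 - a$2) * flat (1 / real (Suc n)) 0 (b$2 - x$2))"

lemma box_plane: "box a b = {x. a$1 < x$1 \<and> x$1 < b$1 \<and> a$2 < x$2 \<and> x$2 < b$2}" for a b :: "real^2"
  by (auto simp: mem_box_cart forall_2)

lemma box_bump_bounds: "0 \<le> box_bump a b n x" "box_bump a b n x \<le> 1"
  using flat_bound[of "1 / real (Suc n)"] unfolding box_bump_def
  by (auto intro!: mult_nonneg_nonneg mult_le_one simp del: of_nat_Suc)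

lemma box_bump_0: "x \<notin> box a b \<Longrightarrow> box_bump a b n x = 0"
  unfolding box_plane box_bump_def by (auto simp: flat_def)

lemma box_bump_test: "(\<lambda>x. complex_of_real (box_bump a b n x)) \<in> test_functions UNIV"
proof (rule smooth_plane_test_function[of _ "cbox a b"])
  let ?f = "flat (1 / real (Suc n)) 0"
  have s: "smooth_real (\<lambda>x. ?f (1 * x + q))" "smooth_real (\<lambda>x. ?f ((- 1) * x + q))" for q
    by (rule smooth_flat; simp)+
  have eq: "(\<lambda>x::real^2. complex_of_real (box_bump a b n x)) =
     (\<lambda>x. of_real ((\<lambda>y. ?f (1 * y + (- a$1)) * ?f ((- 1) * y + b$1)) (x$1)) *
          of_real ((\<lambda>y. ?f (1 * y + (- a$2)) * ?f ((- 1) * y + b$2)) (x$2)))"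
    by (simp add: box_bump_def fun_eq_iff)
  show "smooth_plane (\<lambda>x. complex_of_real (box_bump a b n x))"
    unfolding eq by (intro smooth_plane_mult smooth_plane_coord smooth_mult s)
  show "complex_of_real (box_bump a b n x) = 0" if "x \<notin> cbox a b" for x
    using that box_bump_0[of x a b n] box_subset_cbox by auto
qed auto

lemma test_function_continuous:
  fixes \<eta> :: "real^2 \<Rightarrow> complex"
  assumes "\<eta> \<in> test_functions UNIV"
  shows "continuous_on UNIV \<eta>" "continuous_on UNIV (pd1 \<eta>)" "continuous_on UNIV (pd2 \<eta>)"
  using test_functionD(2-4)[OF assms, of 0] by simp_all

lemma locally_integrable_cball:
  "locally_integrable f \<Longrightarrow> integrable lborel (\<lambda>x. indicator (cball 0 R) x *\<^sub>R f x)"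
  unfolding locally_integrable_def set_integrable_def by auto

lemma locally_integrable_measurable:
  fixes f :: "'a::euclidean_space \<Rightarrow> complex"
  assumes "locally_integrable f"
  shows "f \<in> borel_measurable lborel"
proof (rule borel_measurable_LIMSEQ_metric)
  show "(\<lambda>x. indicator (cball 0 (real n)) x *\<^sub>R f x) \<in> borel_measurable lborel" for n
    by (rule borel_measurable_integrable[OF locally_integrable_cball[OF assms]])
  fix x :: 'a
  obtain N where N: "norm x < real N" using reals_Archimedean2 by blast
  show "(\<lambda>n. indicator (cball 0 (real n)) x *\<^sub>R f x) \<longlonglongrightarrow> f x"
    by (intro tendsto_eventually) (use N in \<open>auto simp: eventually_sequentially indicator_def intro!: exI[of _ N]\<close>)
qed

lemma locally_integrable_mult_test:
  fixes f :: "'a::euclidean_space \<Rightarrow> complex"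
  assumes f: "locally_integrable f" and c: "continuous_on UNIV \<eta>" and R: "\<And>x. norm x > R \<Longrightarrow> \<eta> x = 0"
  shows "integrable lborel (\<lambda>x. f x * \<eta> x)"
proof -
  have "compact (\<eta> ` cball 0 R)"
    by (intro compact_continuous_image continuous_on_subset[OF c]) auto
  then obtain M where M: "\<forall>x\<in>cball 0 R. norm (\<eta> x) \<le> M"
    by (auto dest!: compact_imp_bounded simp: bounded_iff)
  have "integrable lborel (\<lambda>x. (indicator (cball 0 R) x *\<^sub>R f x) * \<eta> x)"
  proof (rule Bochner_Integration.integrable_bound)
    show "integrable lborel (\<lambda>x. norm (indicator (cball 0 R) x *\<^sub>R f x) * \<bar>M\<bar>)"
      by (intro integrable_mult_left impI integrable_norm locally_integrable_cball f)
    show "(\<lambda>x. (indicator (cball 0 R) x *\<^sub>R f x) * \<eta> x) \<in> borel_measurable lborel"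
      using borel_measurable_integrable[OF locally_integrable_cball[OF f]] borel_measurable_continuous_onI[OF c]
      by (intro borel_measurable_times) auto
    show "AE x in lborel. norm ((indicator (cball 0 R) x *\<^sub>R f x) * \<eta> x) \<le> norm (norm (indicator (cball 0 R) x *\<^sub>R f x) * \<bar>M\<bar>)"
    proof (intro AE_I2)
      fix x
      have "norm (\<eta> x) \<le> \<bar>M\<bar>" if "norm x \<le> R" using M that by force
      then show "norm ((indicator (cball 0 R) x *\<^sub>R f x) * \<eta> x) \<le> norm (norm (indicator (cball 0 R) x *\<^sub>R f x) * \<bar>M\<bar>)"
        by (auto simp: indicator_def norm_mult intro!: mult_left_mono)
    qed
  qed
  also have "(\<lambda>x. (indicator (cball 0 R) x *\<^sub>R f x) * \<eta> x) = (\<lambda>x. f x * \<eta> x)"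
    using R by (auto simp: fun_eq_iff indicator_def)
  finally show ?thesis .
qed

text \<open>The fundamental lemma of the calculus of variations. Testing with
  \<open>box_bump\<close> and passing to the limit shows that the integral of \<open>f\<close> over
  every box vanishes.\<close>

lemma weak_zero:
  fixes f :: "real^2 \<Rightarrow> complex"
  assumes f: "locally_integrable f" and z: "\<And>\<eta>. \<eta> \<in> test_functions UNIV \<Longrightarrow> (LINT x|lborel. f x * \<eta> x) = 0"
  shows "AE x in lborel. f x = 0"
proof -
  have box0: "(LINT x:box a b|lborel. f x) = 0" for a b :: "real^2"
  proof -
    have i: "integrable lborel (\<lambda>x. indicator (cbox a b) x *\<^sub>R f x)"
      using f unfolding locally_integrable_def set_integrable_def by auto
    have "(\<lambda>n. LINT x|lborel. f x * of_real (box_bump a b n x)) \<longlonglongrightarrow> (LINT x:box a b|lborel. f x)"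
      unfolding set_lebesgue_integral_def
    proof (rule integral_dominated_convergence[where w="\<lambda>x. norm (indicator (cbox a b) x *\<^sub>R f x)"])
      note [measurable] = locally_integrable_measurable[OF f]
      show "(\<lambda>x. indicator (box a b) x *\<^sub>R f x) \<in> borel_measurable lborel" by measurable
      show "(\<lambda>x. f x * of_real (box_bump a b n x)) \<in> borel_measurable lborel" for n
      proof -
        have [measurable]: "(\<lambda>x. complex_of_real (box_bump a b n x)) \<in> borel_measurable borel"
          by (rule borel_measurable_continuous_onI[OF test_function_continuous(1)[OF box_bump_test]])
        show ?thesis by measurable
      qed
      show "integrable lborel (\<lambda>x. norm (indicator (cbox a b) x *\<^sub>R f x))" using i by (rule integrable_norm)
      show "AE x in lborel. (\<lambda>n. f x * of_real (box_bump a b n x)) \<longlonglongrightarrow> indicator (box a b) x *\<^sub>R f x"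
      proof (intro AE_I2)
        fix x
        have "(\<lambda>n. box_bump a b n x) \<longlonglongrightarrow> indicator (box a b) x"
        proof (cases "x \<in> box a b")
          case True
          then have "(\<lambda>n. box_bump a b n x) \<longlonglongrightarrow> (1 * 1) * (1 * 1)"
            unfolding box_bump_def by (intro tendsto_mult flat_tendsto_1) (auto simp: box_plane)
          then show ?thesis using True by simp
        qed (simp add: box_bump_0)
        from tendsto_mult[OF tendsto_const[of "f x"] tendsto_of_real[OF this]]
        show "(\<lambda>n. f x * of_real (box_bump a b n x)) \<longlonglongrightarrow> indicator (box a b) x *\<^sub>R f x"
          by (simp add: scaleR_conv_of_real mult.commute)
      qed
      show "AE x in lborel. norm (f x * of_real (box_bump a b n x)) \<le> norm (indicator (cbox a b) x *\<^sub>R f x)" for n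
      proof (intro AE_I2)
        fix x
        show "norm (f x * of_real (box_bump a b n x)) \<le> norm (indicator (cbox a b) x *\<^sub>R f x)"
        proof (cases "x \<in> box a b")
          case True
          then have "x \<in> cbox a b" using box_subset_cbox by blast
          then show ?thesis using box_bump_bounds[of a b n x] mult_left_le[of "box_bump a b n x" "norm (f x)"]
            by (simp add: norm_mult)
        qed (simp add: box_bump_0)
      qed
    qed
    then show ?thesis using z[OF box_bump_test] LIMSEQ_unique[OF _ tendsto_const] by simp
  qed
  \<comment> \<open>\<open>f\<close> is only locally integrable, so
    \<open>AE_zero_of_box_integrals\<close> is applied to its restrictions to growing boxes.\<close>
  have "AE x in lborel. indicator (box (- real n *\<^sub>R One) (real n *\<^sub>R One)) x *\<^sub>R f x = 0" for n
  proof (rule AE_zero_of_box_integrals)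
    let ?B = "box (- real n *\<^sub>R One) (real n *\<^sub>R One) :: (real^2) set"
    have "set_integrable lborel (cbox (- real n *\<^sub>R One) (real n *\<^sub>R One) :: (real^2) set) f"
      using f unfolding locally_integrable_def by auto
    then have "set_integrable lborel ?B f"
      by (rule set_integrable_subset) (auto simp: box_subset_cbox)
    then show "integrable lborel (\<lambda>x. indicator ?B x *\<^sub>R f x)"
      by (simp add: set_integrable_def)
    show "(LINT x:box a b|lborel. indicator ?B x *\<^sub>R f x) = 0" for a b :: "real^2"
      using box0 unfolding set_lebesgue_integral_def
      by (simp add: indicator_inter_arith[symmetric] box_Int_box flip: of_real_mult)
  qed
  then have "AE x in lborel. \<forall>n. indicator (box (- real n *\<^sub>R One) (real n *\<^sub>R One)) x *\<^sub>R f x = 0"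
    unfolding AE_all_countable by blast
  then show ?thesis
  proof eventually_elim
    case (elim x)
    obtain N where N: "norm x < real N" using reals_Archimedean2 by blast
    have "x \<in> box (- real N *\<^sub>R One) (real N *\<^sub>R One)"
    proof -
      have "\<bar>x \<bullet> i\<bar> < real N" if "i \<in> Basis" for i
        using Basis_le_norm[OF that, of x] N by linarith
      then show ?thesis by (force simp: mem_box)
    qed
    then show "f x = 0" using elim[rule_format, of N] by simp
  qed
qed

lemma locally_integrable_continuous:
  fixes f :: "'a::euclidean_space \<Rightarrow> complex"
  assumes "continuous_on UNIV f"
  shows "locally_integrable f"
  unfolding locally_integrable_def set_integrable_def
  using borel_integrable_compact continuous_on_subset[OF assms] by blast

lemma locally_integrable_diff:
  assumes "locally_integrable f" "locally_integrable g"
  shows "locally_integrable (\<lambda>x. f x - g x)"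
  using assms unfolding locally_integrable_def by (auto intro: set_integral_diff)

lemma weak_deriv_unique:
  fixes f :: "real^2 \<Rightarrow> complex"
  assumes g: "has_weak_deriv b f g" and h: "has_weak_deriv b f h"
  shows "AE x in lborel. g x = h x"
proof -
  have l: "locally_integrable g" "locally_integrable h"
    using g h by (auto simp: has_weak_deriv_def)
  have "AE x in lborel. g x - h x = 0"
  proof (rule weak_zero[OF locally_integrable_diff[OF l]])
    fix \<eta> :: "real^2 \<Rightarrow> complex" assume \<eta>: "\<eta> \<in> test_functions UNIV"
    obtain R where R: "\<And>x. norm x > R \<Longrightarrow> \<eta> x = 0" using test_functionD(5)[OF \<eta>] by blast
    note i = locally_integrable_mult_test[OF _ test_function_continuous(1)[OF \<eta>] R]
    have "(LINT x|lborel. g x * \<eta> x) = (LINT x|lborel. h x * \<eta> x)"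
      using g h \<eta> unfolding has_weak_deriv_def by (metis add.inverse_inverse)
    then show "(LINT x|lborel. (g x - h x) * \<eta> x) = 0"
      using i[OF l(1)] i[OF l(2)] by (simp add: left_diff_distrib)
  qed
  then show ?thesis by simp
qed

lemma test_function_partial_support:
  fixes \<eta> :: "real^2 \<Rightarrow> complex"
  assumes \<eta>: "\<eta> \<in> test_functions UNIV"
  shows "\<exists>R. \<forall>x. norm x > R \<longrightarrow> \<eta> x = 0 \<and> pd1 \<eta> x = 0 \<and> pd2 \<eta> x = 0"
proof -
  obtain R where R: "\<And>x. norm x > R \<Longrightarrow> \<eta> x = 0" using test_functionD(5)[OF \<eta>] by blast
  have "partial_deriv b \<eta> x = 0" if x: "norm x > R" for b x
  proof -
    have "((\<lambda>_. 0) has_derivative (\<lambda>_. 0)) (at x)" by simp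
    then have "(\<eta> has_derivative (\<lambda>_. 0)) (at x)"
      by (rule has_derivative_transform_within_open[where s="- cball 0 R"]) (use x R in auto)
    from frechet_derivative_at[OF this] show ?thesis
      by (simp add: partial_deriv_def flip: fun_cong[OF frechet_derivative_at[OF \<open>(\<eta> has_derivative (\<lambda>_. 0)) (at x)\<close>]])
  qed
  then show ?thesis using R by blast
qed

lemma test_function_has_weak_deriv:
  fixes \<eta> :: "real^2 \<Rightarrow> complex"
  assumes \<eta>: "\<eta> \<in> test_functions UNIV" and b: "b \<in> Basis"
  shows "has_weak_deriv b \<eta> (partial_deriv b \<eta>)"
proof -
  have c: "continuous_on UNIV (partial_deriv b \<eta>)" if "\<eta> \<in> test_functions UNIV" for \<eta> :: "real^2 \<Rightarrow> complex"
    using b test_function_continuous[OF that] by (auto simp: Basis_plane)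
  have D: "(\<eta> has_derivative (frechet_derivative \<eta> (at x))) (at x)" if "\<eta> \<in> test_functions UNIV" for \<eta> :: "real^2 \<Rightarrow> complex" and x
    using has_grad_differentiable[OF test_functionD(1)[OF that]] frechet_derivative_works by blast
  have "(LINT x|lborel. \<eta> x * partial_deriv b \<zeta> x) = - (LINT x|lborel. partial_deriv b \<eta> x * \<zeta> x)"
    if \<zeta>: "\<zeta> \<in> test_functions UNIV" for \<zeta>
  proof -
    obtain R where R: "\<And>x. norm x > R \<Longrightarrow> \<zeta> x = 0 \<and> pd1 \<zeta> x = 0 \<and> pd2 \<zeta> x = 0"
      using test_function_partial_support[OF \<zeta>] by blast
    have R': "partial_deriv b \<zeta> x = 0" if "norm x > R" for x using R[OF that] b by (auto simp: Basis_plane)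
    note cont = test_function_continuous(1)[OF \<eta>] test_function_continuous(1)[OF \<zeta>] c[OF \<eta>] c[OF \<zeta>]
    have i: "integrable lborel (\<lambda>x. \<eta> x * partial_deriv b \<zeta> x)" "integrable lborel (\<lambda>x. partial_deriv b \<eta> x * \<zeta> x)"
      by (rule integrable_continuous_support[where R=R]; use cont R R' in \<open>auto intro!: continuous_intros\<close>)+
    have "(LINT x|lborel. \<eta> x * partial_deriv b \<zeta> x + partial_deriv b \<eta> x * \<zeta> x) = 0"
      unfolding partial_deriv_def
      by (rule integral_directional_derivative(2)[OF has_derivative_mult[OF D[OF \<eta>] D[OF \<zeta>]], where b=b and R=R])
         (use cont R in \<open>auto intro!: continuous_intros simp: partial_deriv_def\<close>)
    then show ?thesis using i by (simp add: eq_neg_iff_add_eq_0)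
  qed
  then show ?thesis
    unfolding has_weak_deriv_def
    using locally_integrable_continuous test_function_continuous(1)[OF \<eta>] c[OF \<eta>] by blast
qed

lemma has_weak_deriv_diff:
  fixes f g :: "real^2 \<Rightarrow> complex"
  assumes f: "has_weak_deriv b f f'" and g: "has_weak_deriv b g g'" and b: "b \<in> Basis"
  shows "has_weak_deriv b (\<lambda>x. f x - g x) (\<lambda>x. f' x - g' x)"
  unfolding has_weak_deriv_def
proof (intro conjI ballI)
  have l: "locally_integrable f" "locally_integrable f'" "locally_integrable g" "locally_integrable g'"
    using f g by (auto simp: has_weak_deriv_def)
  then show "locally_integrable (\<lambda>x. f x - g x)" "locally_integrable (\<lambda>x. f' x - g' x)"
    by (auto intro: locally_integrable_diff)
  fix \<eta> :: "real^2 \<Rightarrow> complex" assume \<eta>: "\<eta> \<in> test_functions UNIV"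
  obtain R where R: "\<And>x. norm x > R \<Longrightarrow> \<eta> x = 0 \<and> pd1 \<eta> x = 0 \<and> pd2 \<eta> x = 0"
    using test_function_partial_support[OF \<eta>] by blast
  have c: "continuous_on UNIV (partial_deriv b \<eta>)"
    using b test_function_continuous[OF \<eta>] by (auto simp: Basis_plane)
  have i: "integrable lborel (\<lambda>x. h x * \<eta> x)" "integrable lborel (\<lambda>x. h x * partial_deriv b \<eta> x)" if "locally_integrable h" for h
    by (rule locally_integrable_mult_test[OF that, where R=R]; use c test_function_continuous[OF \<eta>] R b in \<open>auto simp: Basis_plane\<close>)+
  show "(LINT x|lborel. (f x - g x) * partial_deriv b \<eta> x) = - (LINT x|lborel. (f' x - g' x) * \<eta> x)"
    using f g \<eta> i[OF l(1)] i[OF l(2)] i[OF l(3)] i[OF l(4)]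
    by (simp add: left_diff_distrib has_weak_deriv_def)
qed

text \<open>Membership in \<open>H1\<close> only provides some square integrable weak derivative;
  uniqueness up to null sets carries this over to the one selected by
  \<open>weak_deriv\<close>.\<close>

lemma H1_weak_deriv:
  fixes \<phi> :: "real^2 \<Rightarrow> complex"
  assumes "\<phi> \<in> H1" "b \<in> Basis"
  shows "has_weak_deriv b \<phi> (weak_deriv b \<phi>)" "square_integrable (weak_deriv b \<phi>)"
proof -
  obtain g where g: "has_weak_deriv b \<phi> g" "square_integrable g"
    using assms by (auto simp: H1_def)
  show w: "has_weak_deriv b \<phi> (weak_deriv b \<phi>)"
    unfolding weak_deriv_def by (rule someI[of "has_weak_deriv b \<phi>", OF g(1)])
  have m: "weak_deriv b \<phi> \<in> borel_measurable lborel"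
    using w locally_integrable_measurable by (auto simp: has_weak_deriv_def)
  have "integrable lborel (\<lambda>x. (norm (weak_deriv b \<phi> x))\<^sup>2) \<longleftrightarrow> integrable lborel (\<lambda>x. (norm (g x))\<^sup>2)"
  proof (rule integrable_cong_AE)
    show "AE x in lborel. (norm (weak_deriv b \<phi> x))\<^sup>2 = (norm (g x))\<^sup>2"
      using weak_deriv_unique[OF w g(1)] by eventually_elim simp
  qed (use m g in \<open>auto simp: square_integrable_def\<close>)
  then show "square_integrable (weak_deriv b \<phi>)"
    using m g by (auto simp: square_integrable_def)
qed

text \<open>\<open>H1_norm\<close> involves the selected weak derivative of the difference, which
  agrees almost everywhere with the weak derivative of \<phi> minus the classical one of
  \<eta>.\<close>

lemma H1_norm_diff_test:
  fixes \<phi> \<eta> :: "real^2 \<Rightarrow> complex"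
  assumes \<phi>: "\<phi> \<in> H1" and \<eta>: "\<eta> \<in> test_functions UNIV"
  shows "(H1_norm (\<lambda>x. \<phi> x - \<eta> x))\<^sup>2 = (LINT x|lborel. (norm (\<phi> x - \<eta> x))\<^sup>2) +
     (LINT x|lborel. (norm (weak_deriv (axis 1 1) \<phi> x - pd1 \<eta> x))\<^sup>2) +
     (LINT x|lborel. (norm (weak_deriv (axis 2 1) \<phi> x - pd2 \<eta> x))\<^sup>2)"
proof -
  have "(LINT x|lborel. (norm (weak_deriv b (\<lambda>x. \<phi> x - \<eta> x) x))\<^sup>2) =
      (LINT x|lborel. (norm (weak_deriv b \<phi> x - partial_deriv b \<eta> x))\<^sup>2)" if b: "b \<in> Basis" for b
  proof -
    have d: "has_weak_deriv b (\<lambda>x. \<phi> x - \<eta> x) (\<lambda>x. weak_deriv b \<phi> x - partial_deriv b \<eta> x)"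
      by (rule has_weak_deriv_diff[OF H1_weak_deriv(1)[OF \<phi> b] test_function_has_weak_deriv[OF \<eta> b] b])
    then have w: "has_weak_deriv b (\<lambda>x. \<phi> x - \<eta> x) (weak_deriv b (\<lambda>x. \<phi> x - \<eta> x))"
      unfolding weak_deriv_def by (rule someI[of "has_weak_deriv b (\<lambda>x. \<phi> x - \<eta> x)"])
    have m: "weak_deriv b (\<lambda>x. \<phi> x - \<eta> x) \<in> borel_measurable lborel"
      "(\<lambda>x. weak_deriv b \<phi> x - partial_deriv b \<eta> x) \<in> borel_measurable lborel"
      using w d locally_integrable_measurable by (auto simp: has_weak_deriv_def)
    show ?thesis
    proof (rule integral_cong_AE)
      show "AE x in lborel. (norm (weak_deriv b (\<lambda>x. \<phi> x - \<eta> x) x))\<^sup>2 = (norm (weak_deriv b \<phi> x - partial_deriv b \<eta> x))\<^sup>2"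
        using weak_deriv_unique[OF w d] by eventually_elim simp
    qed (use m in measurable)
  qed
  then show ?thesis
    unfolding H1_norm_def by (subst real_sqrt_pow2)
      (auto simp: Basis_plane axis_eq_axis intro!: add_nonneg_nonneg Bochner_Integration.integral_nonneg)
qed

lemma H1_0_approx:
  fixes \<phi> :: "real^2 \<Rightarrow> complex"
  assumes "\<phi> \<in> H1_0" "\<epsilon> > 0"
  shows "\<exists>\<eta>\<in>test_functions UNIV. (LINT x|lborel. (norm (\<phi> x - \<eta> x))\<^sup>2) \<le> \<epsilon> \<and>
     (LINT x|lborel. (norm (weak_deriv (axis 1 1) \<phi> x - pd1 \<eta> x))\<^sup>2) \<le> \<epsilon> \<and>
     (LINT x|lborel. (norm (weak_deriv (axis 2 1) \<phi> x - pd2 \<eta> x))\<^sup>2) \<le> \<epsilon>"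
proof -
  have \<phi>: "\<phi> \<in> H1" using assms by (simp add: H1_0_def)
  obtain \<eta> where \<eta>: "\<eta> \<in> test_functions UNIV" "H1_norm (\<lambda>x. \<phi> x - \<eta> x) < sqrt \<epsilon>"
    using assms unfolding H1_0_def by (auto dest: spec[of _ "sqrt \<epsilon>"])
  have "H1_norm (\<lambda>x. \<phi> x - \<eta> x) \<ge> 0"
    unfolding H1_norm_def by (auto intro!: add_nonneg_nonneg sum_nonneg Bochner_Integration.integral_nonneg)
  then have "(H1_norm (\<lambda>x. \<phi> x - \<eta> x))\<^sup>2 \<le> \<epsilon>"
    using power_mono[OF less_imp_le[OF \<eta>(2)], of 2] assms(2) by simp
  moreover have nn: "0 \<le> (LINT x|lborel. (norm (h x))\<^sup>2)" for h :: "real^2 \<Rightarrow> complex"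
    by (rule Bochner_Integration.integral_nonneg) simp
  ultimately show ?thesis
    using \<eta>(1) nn[of "\<lambda>x. \<phi> x - \<eta> x"] nn[of "\<lambda>x. weak_deriv (axis 1 1) \<phi> x - pd1 \<eta> x"]
      nn[of "\<lambda>x. weak_deriv (axis 2 1) \<phi> x - pd2 \<eta> x"]
    unfolding H1_norm_diff_test[OF \<phi> \<eta>(1)] by (intro bexI[OF _ \<eta>(1)]) linarith
qed

lemma square_integrable_diff:
  fixes f g :: "'a::euclidean_space \<Rightarrow> complex"
  assumes "square_integrable f" "square_integrable g"
  shows "square_integrable (\<lambda>x. f x - g x)"
  unfolding square_integrable_def
proof
  show m: "(\<lambda>x. f x - g x) \<in> borel_measurable lborel"
    using assms by (auto simp: square_integrable_def)
  show "integrable lborel (\<lambda>x. (norm (f x - g x))\<^sup>2)"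
  proof (rule Bochner_Integration.integrable_bound)
    show "integrable lborel (\<lambda>x. 2 * (norm (f x))\<^sup>2 + 2 * (norm (g x))\<^sup>2)"
      using assms by (auto simp: square_integrable_def)
    show "AE x in lborel. norm ((norm (f x - g x))\<^sup>2) \<le> norm (2 * (norm (f x))\<^sup>2 + 2 * (norm (g x))\<^sup>2)"
    proof (intro AE_I2)
      fix x
      have "(norm (f x - g x))\<^sup>2 \<le> (norm (f x) + norm (g x))\<^sup>2"
        by (intro power_mono norm_triangle_ineq4) auto
      also have "\<dots> \<le> 2 * (norm (f x))\<^sup>2 + 2 * (norm (g x))\<^sup>2"
        using sum_squares_bound[of "norm (f x)" "norm (g x)"] by (simp add: power2_sum)
      finally show "norm ((norm (f x - g x))\<^sup>2) \<le> norm (2 * (norm (f x))\<^sup>2 + 2 * (norm (g x))\<^sup>2)" by simp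
    qed
  qed (use m in measurable)
qed

lemma square_integrable_continuous_support:
  fixes f :: "'a::euclidean_space \<Rightarrow> complex"
  assumes "continuous_on UNIV f" "\<And>x. norm x > R \<Longrightarrow> f x = 0"
  shows "square_integrable f"
  unfolding square_integrable_def
  using borel_measurable_continuous_onI[OF assms(1)]
  by (auto intro!: integrable_continuous_support[where R=R] continuous_intros assms)

lemma test_function_square_integrable:
  fixes \<eta> :: "real^2 \<Rightarrow> complex"
  assumes "\<eta> \<in> test_functions UNIV"
  shows "square_integrable \<eta>" "square_integrable (pd1 \<eta>)" "square_integrable (pd2 \<eta>)"
proof -
  obtain R where R: "\<And>x. norm x > R \<Longrightarrow> \<eta> x = 0 \<and> pd1 \<eta> x = 0 \<and> pd2 \<eta> x = 0"
    using test_function_partial_support[OF assms] by blast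
  then show "square_integrable \<eta>" "square_integrable (pd1 \<eta>)" "square_integrable (pd2 \<eta>)"
    using test_function_continuous[OF assms] by (auto intro!: square_integrable_continuous_support[where R=R])
qed

section \<open>Hardy's inequality at the origin\<close>

lemma has_grad_radial_nonneg:
  assumes "\<And>t. t \<ge> 0 \<Longrightarrow> (h has_real_derivative h' t) (at t)"
  shows "has_grad (\<lambda>x. of_real (h (r2 x))) (\<lambda>x. of_real (h' (r2 x)) * of_real (2 * x$1))
    (\<lambda>x. of_real (h' (r2 x)) * of_real (2 * x$2))"
  unfolding has_grad_def
proof
  fix x :: "real^2"
  have "((\<lambda>x. h (r2 x)) has_derivative (\<lambda>k. h' (r2 x) * (2 * (x \<bullet> k)))) (at x)"
    by (rule has_derivative_radial) (simp add: assms)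
  from has_derivative_of_real[OF this]
  show "((\<lambda>x. complex_of_real (h (r2 x))) has_derivative
    (\<lambda>k. of_real (k $ 1) * (of_real (h' (r2 x)) * of_real (2 * x$1)) +
         of_real (k $ 2) * (of_real (h' (r2 x)) * of_real (2 * x$2)))) (at x)"
    by (rule has_derivative_eq_rhs) (auto simp: fun_eq_iff inner_plane algebra_simps)
qed

lemma has_grad_integral:
  assumes "has_grad F F1 F2" "\<And>x. norm x > R \<Longrightarrow> F x = 0"
  shows "continuous_on UNIV F1 \<Longrightarrow> integrable lborel F1" "continuous_on UNIV F1 \<Longrightarrow> (LINT x|lborel. F1 x) = 0"
    "continuous_on UNIV F2 \<Longrightarrow> integrable lborel F2" "continuous_on UNIV F2 \<Longrightarrow> (LINT x|lborel. F2 x) = 0"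
  using integral_directional_derivative[OF has_gradD[OF assms(1)] _ assms(2), where b="axis 1 1"]
    integral_directional_derivative[OF has_gradD[OF assms(1)] _ assms(2), where b="axis 2 1"]
  by simp_all

text \<open>\<open>D\<close> is the divergence of the field \<open>G(|x|^2) |\<eta>|^2 x\<close>. No
  cutoff at the origin is required here because \<open>G\<close> is continuously differentiable up
  to \<open>t = 0\<close>.\<close>

lemma divergence_radial_field:
  fixes \<eta> :: "real^2 \<Rightarrow> complex"
  assumes \<eta>: "\<eta> \<in> test_functions UNIV"
    and G: "\<And>t. t \<ge> 0 \<Longrightarrow> (G has_real_derivative G' t) (at t)" "continuous_on {0..} G'"
  defines "D \<equiv> \<lambda>x. 2 * (G (r2 x) + (r2 x) * G' (r2 x)) * (norm (\<eta> x))\<^sup>2 +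
    2 * G (r2 x) * Re (cnj (\<eta> x) * (of_real (x$1) * pd1 \<eta> x + of_real (x$2) * pd2 \<eta> x))"
  shows "integrable lborel D" "(LINT x|lborel. D x) = 0"
proof -
  let ?d1 = "pd1 \<eta>" and ?d2 = "pd2 \<eta>"
  obtain R where R: "\<And>x. norm x > R \<Longrightarrow> \<eta> x = 0" using test_functionD(5)[OF \<eta>] by blast
  note e = test_functionD(1)[OF \<eta>]
  note p = has_grad_mult[OF has_grad_radial_nonneg[OF G(1)] has_grad_mult[OF e has_grad_cnj[OF e]]]
  note f1 = has_grad_mult[OF has_grad_coordinate(1) p] and f2 = has_grad_mult[OF has_grad_coordinate(2) p]
  have cG: "continuous_on {0..} G"
    using G by (intro continuous_at_imp_continuous_on ballI) (auto intro: DERIV_isCont)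
  have c: "continuous_on UNIV (\<lambda>x::real^2. G (r2 x))" "continuous_on UNIV (\<lambda>x::real^2. G' (r2 x))"
    by (rule continuous_on_compose2[OF cG] continuous_on_compose2[OF G(2)]; auto intro!: continuous_intros)+
  note ce = test_function_continuous[OF \<eta>]
  have cc: "continuous_on UNIV (\<lambda>x::real^2. complex_of_real (x $ i))" for i by (intro continuous_intros)
  let ?E1 = "\<lambda>x. of_real (x$1) * (of_real (G (r2 x)) * (\<eta> x * cnj (?d1 x) + ?d1 x * cnj (\<eta> x)) +
      of_real (G' (r2 x)) * of_real (2 * x$1) * (\<eta> x * cnj (\<eta> x))) + 1 * (of_real (G (r2 x)) * (\<eta> x * cnj (\<eta> x)))"
  let ?E2 = "\<lambda>x. of_real (x$2) * (of_real (G (r2 x)) * (\<eta> x * cnj (?d2 x) + ?d2 x * cnj (\<eta> x)) +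
      of_real (G' (r2 x)) * of_real (2 * x$2) * (\<eta> x * cnj (\<eta> x))) + 1 * (of_real (G (r2 x)) * (\<eta> x * cnj (\<eta> x)))"
  have cE: "continuous_on UNIV ?E1" "continuous_on UNIV ?E2"
    using c ce by (auto intro!: continuous_intros)
  have E1: "integrable lborel ?E1" "(LINT x|lborel. ?E1 x) = 0"
    by (rule has_grad_integral(1,2)[OF f1 _ cE(1), where R=R]; simp add: R)+
  have E2: "integrable lborel ?E2" "(LINT x|lborel. ?E2 x) = 0"
    by (rule has_grad_integral(3,4)[OF f2 _ cE(2), where R=R]; simp add: R)+
  have E: "integrable lborel (\<lambda>x. ?E1 x + ?E2 x)" "(LINT x|lborel. ?E1 x + ?E2 x) = 0"
    using Bochner_Integration.integrable_add[OF E1(1) E2(1)] Bochner_Integration.integral_add[OF E1(1) E2(1)] E1(2) E2(2)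
    by (simp_all only: add_0)
  have D: "D x = Re (?E1 x + ?E2 x)" for x
    unfolding D_def cmod_power2 inner_plane by (simp add: power2_eq_square algebra_simps)
  show "integrable lborel D" "(LINT x|lborel. D x) = 0"
    using integrable_bounded_linear[OF bounded_linear_Re E(1)] integral_bounded_linear[OF bounded_linear_Re E(1)] E(2)
    by (simp_all only: D[abs_def] zero_complex.sel)
qed

text \<open>Behaves like \<open>- ln s\<close> near 0 and tends to 1 at infinity, and is at least 1
  on the positive half line, so a single formula serves both regimes.\<close>

definition log_factor :: "real \<Rightarrow> real" where "log_factor s = 1 + ln (1 + 1 / s)"

text \<open>The parameter \<open>d > 0\<close> regularizes the singularity at the origin.\<close>

definition hardy_weight :: "real \<Rightarrow> real \<Rightarrow> real" where
  "hardy_weight d t = t / ((t + d)^2 * (t + d + 1) * (log_factor (t + d))^2)"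

lemma log_factor_ge_1: "s > 0 \<Longrightarrow> log_factor s \<ge> 1"
  by (simp add: log_factor_def)

lemma hardy_weight_bounds:
  assumes "t \<ge> 0" "d > 0"
  shows "0 \<le> hardy_weight d t" "hardy_weight d t \<le> 1 / d"
proof -
  have l0: "log_factor (t + d) \<ge> 1" using log_factor_ge_1[of "t + d"] assms by simp
  then have l: "(log_factor (t + d))^2 \<ge> 1" by simp
  show "0 \<le> hardy_weight d t" using assms by (simp add: hardy_weight_def)
  have "(t + d)^2 * (t + d + 1) * (log_factor (t + d))^2 \<ge> (t + d)^2 * 1 * 1"
    using assms l by (intro mult_mono) auto
  then have "hardy_weight d t \<le> t / ((t + d)^2 * 1 * 1)"
    unfolding hardy_weight_def using assms l l0 by (intro divide_left_mono mult_pos_pos zero_less_power) auto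
  also have "\<dots> \<le> (t + d) / (t + d)^2" using assms by (simp add: divide_right_mono)
  also have "\<dots> = 1 / (t + d)" using assms by (simp add: power2_eq_square)
  also have "\<dots> \<le> 1 / d" using assms by (intro divide_left_mono) auto
  finally show "hardy_weight d t \<le> 1 / d" .
qed

text \<open>The field \<open>G(|x|^2) x\<close> with
  \<open>G = 1 / ((t + d) log_factor (t + d))\<close> has divergence at least twice the Hardy
  weight. By Young's inequality the gradient term in the identity of
  \<open>divergence_radial_field\<close> is at most \<open>(weight + 1) |\<eta>|^2\<close> plus the
  squared gradient, so one copy of the weight survives.\<close>

lemma hardy_smooth:
  fixes \<eta> :: "real^2 \<Rightarrow> complex"
  assumes \<eta>: "\<eta> \<in> test_functions UNIV" and d: "d > 0"
  shows "(LINT x|lborel. hardy_weight d (r2 x) * (norm (\<eta> x))\<^sup>2) \<le> (LINT x|lborel. (norm (\<eta> x))\<^sup>2) +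
     (LINT x|lborel. (norm (pd1 \<eta> x))\<^sup>2) + (LINT x|lborel. (norm (pd2 \<eta> x))\<^sup>2)"
    and "integrable lborel (\<lambda>x. hardy_weight d (r2 x) * (norm (\<eta> x))\<^sup>2)"
proof -
  let ?d1 = "pd1 \<eta>" and ?d2 = "pd2 \<eta>"
  define l where "l t = log_factor (t + d)" for t
  define G where "G t = 1 / ((t + d) * l t)" for t
  define G' where "G' t = - (l t - 1 / (t + d + 1)) / ((t + d) * l t)^2" for t
  have l1: "l t \<ge> 1" if "t \<ge> 0" for t using log_factor_ge_1[of "t + d"] that d by (simp add: l_def)
  have Dl: "(l has_real_derivative - 1 / ((t + d) * (t + d + 1))) (at t)" if "t \<ge> 0" for t
  proof -
    have pos: "t + d > 0" "1 + 1 / (t + d) > 0" using that d by (auto simp: add_pos_pos)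
    have "(l has_real_derivative (- 1 / (t + d)^2) / (1 + 1 / (t + d))) (at t)"
      unfolding l_def[abs_def] log_factor_def
      using pos by (auto intro!: derivative_eq_intros simp: power2_eq_square)
    moreover have "(- 1 / (t + d)^2) / (1 + 1 / (t + d)) = - 1 / ((t + d) * (t + d + 1))"
      using pos by (simp add: divide_simps power2_eq_square)
    ultimately show ?thesis by simp
  qed
  have DG: "(G has_real_derivative G' t) (at t)" if "t \<ge> 0" for t
  proof -
    have nz: "t + d \<noteq> 0" "l t \<noteq> 0" "t + d + 1 \<noteq> 0" using that d l1[OF that] by auto
    have "(G has_real_derivative - (l t + (t + d) * (- 1 / ((t + d) * (t + d + 1)))) / ((t + d) * l t)^2) (at t)"
      unfolding G_def[abs_def] using nz by (auto intro!: derivative_eq_intros Dl[OF that] simp: power2_eq_square)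
    moreover have "(t + d) * (- 1 / ((t + d) * (t + d + 1))) = - 1 / (t + d + 1)"
      using nz by (simp add: divide_simps)
    ultimately show ?thesis by (simp add: G'_def)
  qed
  have cl: "continuous_on {0..} l"
    using Dl by (intro continuous_at_imp_continuous_on ballI) (auto intro: DERIV_isCont)
  have cG': "continuous_on {0..} G'"
    unfolding G'_def[abs_def] using d l1 by (intro continuous_intros cl) force+
  note div = divergence_radial_field[OF \<eta> DG cG']
  \<comment> \<open>Twice \<open>G + t G'\<close> is the divergence of the field, and
    \<open>G^2 t\<close> is its squared length.\<close>
  have w1: "G t + t * G' t \<ge> hardy_weight d t" and w2: "(G t)^2 * t \<le> hardy_weight d t + 1" if t: "t \<ge> 0" for t
  proof -
    define s where "s = t + d"
    define k where "k = l t"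
    have s: "s > 0" "s \<ge> t" and k: "k \<ge> 1" using t d l1[OF t] by (auto simp: s_def k_def)
    have hw: "hardy_weight d t = t / (s^2 * (s + 1) * k^2)"
      by (simp add: hardy_weight_def s_def k_def l_def)
    \<comment> \<open>The first summand is the nonnegative effect of the regularization; for
      \<open>d = 0\<close> the weight would be attained exactly.\<close>
    have "G t + t * G' t = d / (s^2 * k) + t / (s^2 * (s + 1) * k^2)"
    proof -
      have "G t + t * G' t = 1 / (s * k) - t * (k - 1 / (s + 1)) / (s * k)^2"
        by (simp add: G_def G'_def s_def k_def minus_divide_left right_diff_distrib)
      also have "\<dots> = (s - t) / (s^2 * k) + t / (s^2 * (s + 1) * k^2)"
        using s k by (simp add: divide_simps) algebra
      finally show ?thesis by (simp add: s_def)
    qed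
    then show "G t + t * G' t \<ge> hardy_weight d t" using s k d by (simp add: hw)
    have "(G t)^2 * t = t / (s * k)^2" by (simp add: G_def s_def k_def power_divide)
    also have "\<dots> = t / (s^2 * (s + 1) * k^2) + (t / s) * (1 / ((s + 1) * k^2))"
      using s k by (simp add: divide_simps) algebra
    also have "(t / s) * (1 / ((s + 1) * k^2)) \<le> 1 * 1"
    proof (intro mult_mono)
      have "1 * 1 \<le> (s + 1) * k^2" using s k by (intro mult_mono) auto
      then show "1 / ((s + 1) * k^2) \<le> 1" by simp
    qed (use s k t in auto)
    finally show "(G t)^2 * t \<le> hardy_weight d t + 1" by (simp add: hw)
  qed
  note sq = test_function_square_integrable[OF \<eta>, unfolded square_integrable_def]
  have cw: "continuous_on UNIV (\<lambda>x::real^2. hardy_weight d (r2 x))"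
  proof -
    have "continuous_on {0..} (\<lambda>t. t / ((t + d)^2 * (t + d + 1) * (l t)^2))"
      using d l1 by (intro continuous_intros cl) force+
    then have *: "continuous_on {0..} (hardy_weight d)"
      by (simp add: hardy_weight_def[abs_def] l_def)
    show ?thesis
      by (rule continuous_on_compose2[OF *]) (auto intro!: continuous_intros)
  qed
  obtain R where R: "\<And>x. norm x > R \<Longrightarrow> \<eta> x = 0" using test_functionD(5)[OF \<eta>] by blast
  show iw: "integrable lborel (\<lambda>x. hardy_weight d (r2 x) * (norm (\<eta> x))\<^sup>2)"
    by (rule integrable_continuous_support[where R=R])
       (use cw R test_function_continuous(1)[OF \<eta>] in \<open>auto intro!: continuous_intros\<close>)
  have "(LINT x|lborel. hardy_weight d (r2 x) * (norm (\<eta> x))\<^sup>2 - (norm (\<eta> x))\<^sup>2 - (norm (?d1 x))\<^sup>2 - (norm (?d2 x))\<^sup>2) \<le>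
    (LINT x|lborel. 2 * (G (r2 x) + (r2 x) * G' (r2 x)) * (norm (\<eta> x))\<^sup>2 +
    2 * G (r2 x) * Re (cnj (\<eta> x) * (rdr ?d1 ?d2 x)))"
  proof (rule integral_mono[OF _ div(1)])
    show "integrable lborel (\<lambda>x. hardy_weight d (r2 x) * (norm (\<eta> x))\<^sup>2 - (norm (\<eta> x))\<^sup>2 - (norm (?d1 x))\<^sup>2 - (norm (?d2 x))\<^sup>2)"
      using iw sq by auto
    fix x :: "real^2"
    define t where "t = x \<bullet> x"
    have t: "t \<ge> 0" by (simp add: t_def)
    have G0: "G t \<ge> 0" using l1[OF t] t d by (simp add: G_def)
    have tx: "t = (x$1)^2 + (x$2)^2" by (simp add: t_def inner_plane power2_eq_square)
    define e where "e = norm (\<eta> x)"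
    define a where "a = norm (?d1 x)"
    define b where "b = norm (?d2 x)"
    have "\<bar>Re (cnj (\<eta> x) * (rdr ?d1 ?d2 x))\<bar> \<le>
        norm (cnj (\<eta> x) * (rdr ?d1 ?d2 x))" by (rule abs_Re_le_cmod)
    also have "\<dots> \<le> e * (\<bar>x$1\<bar> * a + \<bar>x$2\<bar> * b)"
      unfolding norm_mult e_def a_def b_def
      by (intro mult_mono order_trans[OF norm_triangle_ineq]) (auto simp: norm_mult)
    finally have "2 * G t * \<bar>Re (cnj (\<eta> x) * (rdr ?d1 ?d2 x))\<bar> \<le> 2 * G t * (e * (\<bar>x$1\<bar> * a + \<bar>x$2\<bar> * b))"
      using G0 by (intro mult_left_mono) auto
    also have "\<dots> = 2 * (G t * e * \<bar>x$1\<bar>) * a + 2 * (G t * e * \<bar>x$2\<bar>) * b" by (simp add: algebra_simps)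
    also have "\<dots> \<le> ((G t * e * \<bar>x$1\<bar>)^2 + a^2) + ((G t * e * \<bar>x$2\<bar>)^2 + b^2)"
      by (intro add_mono sum_squares_bound)
    also have "\<dots> = (G t)^2 * t * e^2 + a^2 + b^2" by (simp add: tx power_mult_distrib algebra_simps)
    also have "\<dots> \<le> (hardy_weight d t + 1) * e^2 + a^2 + b^2"
      using w2[OF t] by (intro add_mono mult_right_mono) auto
    finally have "\<bar>2 * G t * Re (cnj (\<eta> x) * (rdr ?d1 ?d2 x))\<bar> \<le> (hardy_weight d t + 1) * e^2 + a^2 + b^2"
      using G0 by (simp add: abs_mult)
    moreover have "2 * hardy_weight d t * e^2 \<le> 2 * (G t + t * G' t) * e^2"
      using w1[OF t] by (intro mult_right_mono) auto
    ultimately show "hardy_weight d (r2 x) * (norm (\<eta> x))\<^sup>2 - (norm (\<eta> x))\<^sup>2 - (norm (?d1 x))\<^sup>2 - (norm (?d2 x))\<^sup>2 \<le>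
     2 * (G (r2 x) + (r2 x) * G' (r2 x)) * (norm (\<eta> x))\<^sup>2 +
    2 * G (r2 x) * Re (cnj (\<eta> x) * (rdr ?d1 ?d2 x))"
      by (simp add: e_def a_def b_def distrib_right flip: t_def)
  qed
  also have "\<dots> = 0" by (rule div(2))
  also have "(LINT x|lborel. hardy_weight d (r2 x) * (norm (\<eta> x))\<^sup>2 - (norm (\<eta> x))\<^sup>2 - (norm (?d1 x))\<^sup>2 - (norm (?d2 x))\<^sup>2)
     = (LINT x|lborel. hardy_weight d (r2 x) * (norm (\<eta> x))\<^sup>2) - (LINT x|lborel. (norm (\<eta> x))\<^sup>2) -
       (LINT x|lborel. (norm (?d1 x))\<^sup>2) - (LINT x|lborel. (norm (?d2 x))\<^sup>2)"
    using iw sq by simp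
  finally show "(LINT x|lborel. hardy_weight d (r2 x) * (norm (\<eta> x))\<^sup>2) \<le> (LINT x|lborel. (norm (\<eta> x))\<^sup>2) +
     (LINT x|lborel. (norm (?d1 x))\<^sup>2) + (LINT x|lborel. (norm (?d2 x))\<^sup>2)" by simp
qed

lemma norm_square_sum_le: "(norm (x + y))\<^sup>2 \<le> 2 * (norm x)\<^sup>2 + 2 * (norm y)\<^sup>2" for x y :: complex
proof -
  have "(norm (x + y))\<^sup>2 \<le> (norm x + norm y)\<^sup>2" by (intro power_mono norm_triangle_ineq) auto
  also have "\<dots> \<le> 2 * (norm x)\<^sup>2 + 2 * (norm y)\<^sup>2"
    using sum_squares_bound[of "norm x" "norm y"] by (simp add: power2_sum)
  finally show ?thesis .
qed

lemma square_integral_le: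
  fixes f g :: "real^2 \<Rightarrow> complex"
  assumes "square_integrable f" "square_integrable g"
  shows "(LINT x|lborel. (norm (g x))\<^sup>2) \<le> 2 * (LINT x|lborel. (norm (f x))\<^sup>2) + 2 * (LINT x|lborel. (norm (f x - g x))\<^sup>2)"
proof -
  note d = square_integrable_diff[OF assms]
  have "(LINT x|lborel. (norm (g x))\<^sup>2) \<le> (LINT x|lborel. 2 * (norm (f x))\<^sup>2 + 2 * (norm (f x - g x))\<^sup>2)"
  proof (rule integral_mono)
    fix x
    show "(norm (g x))\<^sup>2 \<le> 2 * (norm (f x))\<^sup>2 + 2 * (norm (f x - g x))\<^sup>2"
      using norm_square_sum_le[of "f x" "g x - f x"] by (simp add: norm_minus_commute)
  qed (use assms d in \<open>auto simp: square_integrable_def\<close>)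
  then show ?thesis using assms d by (simp add: square_integrable_def)
qed

lemma hardy_weight_measurable [measurable]: "hardy_weight d \<in> borel_measurable borel"
  unfolding hardy_weight_def[abs_def] log_factor_def by measurable

text \<open>For fixed \<open>d > 0\<close> the weight is at most \<open>1 / d\<close>, so closeness
  in the square norm suffices to pass from test functions to \<phi>. The resulting bound does not
  depend on \<open>d\<close>, and Fatou's lemma removes the regularization.\<close>

lemma hardy:
  fixes \<phi> :: "real^2 \<Rightarrow> complex"
  assumes \<phi>: "\<phi> \<in> H1_0"
  shows "integrable lborel (\<lambda>x. hardy_weight 0 (r2 x) * (norm (\<phi> x))\<^sup>2)"
proof -
  let ?d1 = "pd1" and ?d2 = "pd2"
  let ?w1 = "weak_deriv (axis 1 1) \<phi>" and ?w2 = "weak_deriv (axis 2 1) \<phi>"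
  have H: "\<phi> \<in> H1" using \<phi> by (simp add: H1_0_def)
  have sq: "square_integrable \<phi>" "square_integrable ?w1" "square_integrable ?w2"
    using H H1_weak_deriv(2)[OF H] by (auto simp: H1_def Basis_plane)
  note [measurable] = sq(1)[unfolded square_integrable_def, THEN conjunct1]
  define I where "I f = (LINT x|lborel. (norm (f x))\<^sup>2)" for f :: "real^2 \<Rightarrow> complex"
  \<comment> \<open>Passing from \<phi> to \<eta> doubles each of the three integrals and adds at
    most 2; another factor 2 comes from splitting \<phi> into \<eta> and the remainder, and the
    remainder adds 2: \<open>2 * 6 + 2 = 14\<close>.\<close>
  define C where "C = 4 * (I \<phi> + I ?w1 + I ?w2) + 14"
  have bound: "integrable lborel (\<lambda>x. hardy_weight d (r2 x) * (norm (\<phi> x))\<^sup>2) \<and>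
     (LINT x|lborel. hardy_weight d (r2 x) * (norm (\<phi> x))\<^sup>2) \<le> C" if d: "d > 0" for d
  proof -
    have wi: "integrable lborel (\<lambda>x. hardy_weight d (r2 x) * (norm (f x))\<^sup>2)"
      "(LINT x|lborel. hardy_weight d (r2 x) * (norm (f x))\<^sup>2) \<le> 1 / d * I f"
      if "square_integrable f" for f :: "real^2 \<Rightarrow> complex"
    proof -
      note [measurable] = that[unfolded square_integrable_def, THEN conjunct1]
      have i: "integrable lborel (\<lambda>x. 1 / d * (norm (f x))\<^sup>2)" using that by (simp add: square_integrable_def)
      show "integrable lborel (\<lambda>x. hardy_weight d (r2 x) * (norm (f x))\<^sup>2)"
      proof (rule Bochner_Integration.integrable_bound[OF i])
        show "AE x in lborel. norm (hardy_weight d (r2 x) * (norm (f x))\<^sup>2) \<le> norm (1 / d * (norm (f x))\<^sup>2)"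
        proof (intro AE_I2)
          fix x
          show "norm (hardy_weight d (r2 x) * (norm (f x))\<^sup>2) \<le> norm (1 / d * (norm (f x))\<^sup>2)"
            using hardy_weight_bounds[of "x \<bullet> x" d] d mult_right_mono[of "hardy_weight d (r2 x)" "1 / d" "(norm (f x))\<^sup>2"]
            by simp
        qed
      qed measurable
      have "(LINT x|lborel. hardy_weight d (r2 x) * (norm (f x))\<^sup>2) \<le> (LINT x|lborel. 1 / d * (norm (f x))\<^sup>2)"
        by (rule integral_mono[OF \<open>integrable lborel (\<lambda>x. hardy_weight d (r2 x) * (norm (f x))\<^sup>2)\<close> i])
           (use hardy_weight_bounds d in \<open>intro mult_right_mono; simp\<close>)
      then show "(LINT x|lborel. hardy_weight d (r2 x) * (norm (f x))\<^sup>2) \<le> 1 / d * I f" by (simp add: I_def)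
    qed
    \<comment> \<open>\<open>\<epsilon> \<le> d\<close> compensates the bound \<open>1 / d\<close>
      of the weight on the remainder, and \<open>\<epsilon> \<le> 1\<close> keeps the constant free
      of \<open>d\<close>.\<close>
    define \<epsilon> where "\<epsilon> = min 1 d"
    have \<epsilon>: "\<epsilon> > 0" "\<epsilon> \<le> 1" "\<epsilon> \<le> d" using d by (auto simp: \<epsilon>_def)
    obtain \<eta> where \<eta>: "\<eta> \<in> test_functions UNIV" "I (\<lambda>x. \<phi> x - \<eta> x) \<le> \<epsilon>"
      "I (\<lambda>x. ?w1 x - ?d1 \<eta> x) \<le> \<epsilon>" "I (\<lambda>x. ?w2 x - ?d2 \<eta> x) \<le> \<epsilon>"
      using H1_0_approx[OF \<phi> \<epsilon>(1)] by (auto simp: I_def)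
    note sqe = test_function_square_integrable[OF \<eta>(1)]
    have e: "I \<eta> \<le> 2 * I \<phi> + 2 * \<epsilon>" "I (?d1 \<eta>) \<le> 2 * I ?w1 + 2 * \<epsilon>" "I (?d2 \<eta>) \<le> 2 * I ?w2 + 2 * \<epsilon>"
      using square_integral_le[OF sq(1) sqe(1)] square_integral_le[OF sq(2) sqe(2)] square_integral_le[OF sq(3) sqe(3)] \<eta>
      by (simp_all add: I_def)
    note df = square_integrable_diff[OF sq(1) sqe(1)]
    have "(LINT x|lborel. hardy_weight d (r2 x) * (norm (\<phi> x))\<^sup>2) \<le>
      (LINT x|lborel. 2 * (hardy_weight d (r2 x) * (norm (\<eta> x))\<^sup>2) + 2 * (hardy_weight d (r2 x) * (norm (\<phi> x - \<eta> x))\<^sup>2))"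
    proof (rule integral_mono[OF wi(1)[OF sq(1)]])
      show "integrable lborel (\<lambda>x. 2 * (hardy_weight d (r2 x) * (norm (\<eta> x))\<^sup>2) + 2 * (hardy_weight d (r2 x) * (norm (\<phi> x - \<eta> x))\<^sup>2))"
        using wi(1)[OF sqe(1)] wi(1)[OF df] by simp
      fix x
      show "hardy_weight d (r2 x) * (norm (\<phi> x))\<^sup>2 \<le>
        2 * (hardy_weight d (r2 x) * (norm (\<eta> x))\<^sup>2) + 2 * (hardy_weight d (r2 x) * (norm (\<phi> x - \<eta> x))\<^sup>2)"
        using mult_left_mono[OF norm_square_sum_le[of "\<eta> x" "\<phi> x - \<eta> x"] hardy_weight_bounds(1)[of "x \<bullet> x" d]] d
        by (simp add: algebra_simps)
    qed
    also have "\<dots> = 2 * (LINT x|lborel. hardy_weight d (r2 x) * (norm (\<eta> x))\<^sup>2) + 2 * (LINT x|lborel. hardy_weight d (r2 x) * (norm (\<phi> x - \<eta> x))\<^sup>2)"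
      using wi(1)[OF sqe(1)] wi(1)[OF df] by simp
    also have "\<dots> \<le> 2 * (I \<eta> + I (?d1 \<eta>) + I (?d2 \<eta>)) + 2 * (1 / d * I (\<lambda>x. \<phi> x - \<eta> x))"
      using hardy_smooth(1)[OF \<eta>(1) d] wi(2)[OF df] by (intro add_mono mult_left_mono) (auto simp: I_def)
    also have "1 / d * I (\<lambda>x. \<phi> x - \<eta> x) \<le> 1"
      using \<eta>(2) \<epsilon> d by (simp add: divide_simps)
    finally show ?thesis using e \<epsilon> wi(1)[OF sq(1)] by (auto simp: C_def)
  qed
  have "(\<integral>\<^sup>+x. ennreal (hardy_weight 0 (r2 x) * (norm (\<phi> x))\<^sup>2) \<partial>lborel) \<le>
     (\<integral>\<^sup>+x. liminf (\<lambda>n. ennreal (hardy_weight (1 / real (Suc n)) (r2 x) * (norm (\<phi> x))\<^sup>2)) \<partial>lborel)"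
  proof (rule nn_integral_mono)
    fix x :: "real^2"
    show "ennreal (hardy_weight 0 (r2 x) * (norm (\<phi> x))\<^sup>2) \<le> liminf (\<lambda>n. ennreal (hardy_weight (1 / real (Suc n)) (r2 x) * (norm (\<phi> x))\<^sup>2))"
    proof (cases "x = 0")
      case True then show ?thesis by (simp add: hardy_weight_def)
    next
      case False
      define t where "t = x \<bullet> x"
      have t: "t > 0" using False by (simp add: t_def)
      have inv: "(\<lambda>n. 1 / real (Suc n)) \<longlonglongrightarrow> 0" using LIMSEQ_inverse_real_of_nat by (simp add: inverse_eq_divide)
      have l: "(\<lambda>n. log_factor (t + 1 / real (Suc n))) \<longlonglongrightarrow> log_factor (t + 0)"
      proof -
        have "1 + 1 / (t + 0) > 0" using t by (simp add: add_pos_pos)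
        then show ?thesis
          unfolding log_factor_def using t by (intro tendsto_intros inv) auto
      qed
      have "(\<lambda>n. hardy_weight (1 / real (Suc n)) t) \<longlonglongrightarrow> hardy_weight 0 t"
        unfolding hardy_weight_def using t log_factor_ge_1[OF t]
        by (intro tendsto_divide tendsto_mult tendsto_power tendsto_add tendsto_const inv l) auto
      then have "(\<lambda>n. ennreal (hardy_weight (1 / real (Suc n)) t * (norm (\<phi> x))\<^sup>2)) \<longlonglongrightarrow> ennreal (hardy_weight 0 t * (norm (\<phi> x))\<^sup>2)"
        by (intro tendsto_ennrealI tendsto_mult tendsto_const)
      from lim_imp_Liminf[OF sequentially_bot this] show ?thesis
        by (simp del: of_nat_Suc add: t_def)
    qed
  qed
  also have "\<dots> \<le> liminf (\<lambda>n. \<integral>\<^sup>+x. ennreal (hardy_weight (1 / real (Suc n)) (r2 x) * (norm (\<phi> x))\<^sup>2) \<partial>lborel)"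
    by (rule nn_integral_liminf) measurable
  also have "\<dots> \<le> ennreal C"
  proof (rule Liminf_le)
    show "\<forall>\<^sub>F n in sequentially. (\<integral>\<^sup>+x. ennreal (hardy_weight (1 / real (Suc n)) (r2 x) * (norm (\<phi> x))\<^sup>2) \<partial>lborel) \<le> ennreal C"
    proof (intro always_eventually allI)
      fix n
      have "1 / real (Suc n) > 0" by simp
      note b = bound[OF this]
      have "(\<integral>\<^sup>+x. ennreal (hardy_weight (1 / real (Suc n)) (r2 x) * (norm (\<phi> x))\<^sup>2) \<partial>lborel)
        = ennreal (LINT x|lborel. hardy_weight (1 / real (Suc n)) (r2 x) * (norm (\<phi> x))\<^sup>2)"
        using b by (intro nn_integral_eq_integral) (auto intro!: AE_I2 mult_nonneg_nonneg hardy_weight_bounds)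
      then show "(\<integral>\<^sup>+x. ennreal (hardy_weight (1 / real (Suc n)) (r2 x) * (norm (\<phi> x))\<^sup>2) \<partial>lborel) \<le> ennreal C"
        using b by (simp add: ennreal_leI)
    qed
  qed simp
  finally have "(\<integral>\<^sup>+x. ennreal (hardy_weight 0 (r2 x) * (norm (\<phi> x))\<^sup>2) \<partial>lborel) < \<infinity>"
    by (simp add: le_less_trans)
  moreover have "(\<lambda>x. hardy_weight 0 (r2 x) * (norm (\<phi> x))\<^sup>2) \<in> borel_measurable lborel" by measurable
  moreover have "AE x in lborel. 0 \<le> hardy_weight 0 (r2 x) * (norm (\<phi> x))\<^sup>2"
    by (simp add: hardy_weight_def)
  ultimately show ?thesis by (intro integrableI_nonneg)
qed

section \<open>The cutoff argument\<close>

lemma Phi1_square: "(Phi1 r)\<^sup>2 = r\<^sup>2 / (r\<^sup>2 + 4)"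
  by (simp add: Phi1_def power_divide)

lemma deriv_Phi1: "deriv Phi1 r = 4 / ((r\<^sup>2 + 4) * sqrt (r\<^sup>2 + 4))"
proof (rule DERIV_imp_deriv)
  have p: "r\<^sup>2 + 4 > 0" by (simp add: add_nonneg_pos)
  then have s: "sqrt (r\<^sup>2 + 4) > 0" "sqrt (r\<^sup>2 + 4) * sqrt (r\<^sup>2 + 4) = r\<^sup>2 + 4" by auto
  have "(Phi1 has_real_derivative (sqrt (r\<^sup>2 + 4) - r * (r / sqrt (r\<^sup>2 + 4))) / (sqrt (r\<^sup>2 + 4) * sqrt (r\<^sup>2 + 4))) (at r)"
    unfolding Phi1_def[abs_def] using p s by (auto intro!: derivative_eq_intros simp: field_simps)
  also have "(sqrt (r\<^sup>2 + 4) - r * (r / sqrt (r\<^sup>2 + 4))) / (sqrt (r\<^sup>2 + 4) * sqrt (r\<^sup>2 + 4))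
      = ((r\<^sup>2 + 4) - r * r) / ((r\<^sup>2 + 4) * sqrt (r\<^sup>2 + 4))"
    using s by (simp add: divide_simps)
  finally show "(Phi1 has_real_derivative 4 / ((r\<^sup>2 + 4) * sqrt (r\<^sup>2 + 4))) (at r)"
    by (simp add: power2_eq_square)
qed

text \<open>The first line says that the drift is \<open>- 2 r W' / W\<close>, with
  \<open>W'\<close> the derivative in \<open>t\<close>, that is, minus the radial derivative of
  \<open>ln W\<close>. This is why multiplication by \<open>W\<close> turns the second-order part
  and the drift together into divergence form.\<close>

lemma L1_coefficients:
  assumes r: "r > 0"
  defines "t \<equiv> r\<^sup>2"
  shows "L1_drift r / r = - 8 / ((t + 4) * (t + 8))"
    "L1_rot r = - 4 * \<i> * of_real (W t / t)"
    "L1_pot r = Pot t" "L1_conj_pot r = Con t"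
proof -
  have t: "t > 0" using r by (simp add: t_def)
  have P: "(Phi1 r)\<^sup>2 = t / (t + 4)" by (simp add: Phi1_square t_def)
  have P4: "(Phi1 r)^4 = t\<^sup>2 / (t + 4)\<^sup>2"
    using arg_cong[OF P, of "\<lambda>z. z\<^sup>2"] by (simp add: power_divide)
  have D2: "(deriv Phi1 r)\<^sup>2 = 16 / (t + 4)^3"
  proof -
    have "(sqrt (r\<^sup>2 + 4))\<^sup>2 = r\<^sup>2 + 4" by (simp add: add_nonneg_nonneg)
    then show ?thesis
      by (simp add: deriv_Phi1 power_divide power_mult_distrib t_def power2_eq_square power3_eq_cube)
  qed
  have PD: "Phi1 r * deriv Phi1 r = 4 * r / (t + 4)\<^sup>2"
  proof -
    have "sqrt (r\<^sup>2 + 4) * sqrt (r\<^sup>2 + 4) = r\<^sup>2 + 4" by simp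
    then show ?thesis by (simp add: deriv_Phi1 Phi1_def t_def power2_eq_square mult_ac)
  qed
  have w: "2 - t / (t + 4) = (t + 8) / (t + 4)" using t by (simp add: field_simps)
  show "L1_drift r / r = - 8 / ((t + 4) * (t + 8))"
    using t r unfolding L1_drift_def P w mult.assoc PD by (simp add: divide_simps power2_eq_square)
  show "L1_rot r = - 4 * \<i> * of_real (W t / t)"
    unfolding L1_rot_def P w t_def[symmetric] by (simp add: W_def)
  show "L1_pot r = Pot t"
    unfolding L1_pot_def P P4 D2 w t_def[symmetric] Pot_def using t
    by (simp add: divide_simps) algebra
  show "L1_conj_pot r = Con t"
    unfolding L1_conj_pot_def P P4 D2 w t_def[symmetric] Con_def using t
    by (simp add: divide_simps) algebra
qed

text \<open>The integrand of \<^const>\<open>L1_pairing\<close> against \<open>k(r\<^sup>2)\<close> times the conjugate of \<open>q\<close>, with \<open>lam\<close> added to the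
  potential. Here \<open>ev\<close>, \<open>av\<close> are \<open>r \<partial>\<^sub>r v\<close>, \<open>\<partial>\<^sub>\<theta> v\<close>, and similarly for \<open>q\<close>.\<close>

definition dform :: "real \<Rightarrow> real \<Rightarrow> real \<Rightarrow> real \<Rightarrow> complex \<Rightarrow> complex \<Rightarrow> complex \<Rightarrow> complex \<Rightarrow> complex \<Rightarrow> complex \<Rightarrow> complex" where
  "dform k k' lam t v ev av q eq aq =
     of_real (k / t) * ev * cnj eq + of_real (2 * k' - 8 * k / ((t + 4) * (t + 8))) * ev * cnj q
     + of_real (k / t) * av * cnj aq + of_real (4 * (W t * k / t)) * (- \<i> * av) * cnj q
     + of_real ((Pot t + lam) * k) * v * cnj q + of_real (Con t * k) * cnj v * cnj q"

text \<open>The form is not complex linear in its first triple, because of \<open>cnj v\<close>, but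
  it is additive there, which is all that the splitting of \<phi> needs.\<close>

lemma dform_diff:
  "dform k k' lam t (v - q) (ev - eq) (av - aq) q eq aq = dform k k' lam t v ev av q eq aq - dform k k' lam t q eq aq q eq aq"
proof -
  have "a * (ev - eq) * e' + b * (ev - eq) * q' + a * (av - aq) * a' + c * (- \<i> * (av - aq)) * q' + d * (v - q) * q' + f * (cnj v - cnj q) * q' =
    (a * ev * e' + b * ev * q' + a * av * a' + c * (- \<i> * av) * q' + d * v * q' + f * cnj v * q') -
    (a * eq * e' + b * eq * q' + a * aq * a' + c * (- \<i> * aq) * q' + d * q * q' + f * cnj q * q')" for a b c d f e' q' a'
    by (simp add: algebra_simps)
  then show ?thesis unfolding dform_def complex_cnj_diff .
qed

lemma dform_bound:
  assumes "\<bar>k / t\<bar> \<le> B" "\<bar>2 * k' - 8 * k / ((t + 4) * (t + 8))\<bar> \<le> B" "\<bar>4 * (W t * k / t)\<bar> \<le> B"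
    "\<bar>(Pot t + lam) * k\<bar> \<le> B" "\<bar>Con t * k\<bar> \<le> B"
  shows "norm (dform k k' lam t v ev av q eq aq) \<le> 2 * B * (norm v + norm ev + norm av) * (norm q + norm eq + norm aq)"
proof -
  have B: "B \<ge> 0" using assms(1) by linarith
  have *: "norm (of_real c * y * z) \<le> B * norm y * norm z" if "\<bar>c\<bar> \<le> B" for c and y z :: complex
    using that by (simp add: norm_mult mult_right_mono)
  have "norm (dform k k' lam t v ev av q eq aq) \<le>
     B * norm ev * norm (cnj eq) + B * norm ev * norm (cnj q) + B * norm av * norm (cnj aq)
     + B * norm (- \<i> * av) * norm (cnj q) + B * norm v * norm (cnj q) + B * norm (cnj v) * norm (cnj q)"
    unfolding dform_def by (intro order_trans[OF norm_triangle_ineq] add_mono * assms)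
  also have "\<dots> = B * (norm ev * norm eq + norm ev * norm q + norm av * norm aq + norm av * norm q + 2 * (norm v * norm q))"
    by (simp add: norm_mult algebra_simps)
  also have "\<dots> \<le> B * (2 * (norm v + norm ev + norm av) * (norm q + norm eq + norm aq))"
  proof (rule mult_left_mono[OF _ B])
    have "0 \<le> norm ev * norm eq + norm ev * norm q + norm av * norm aq + norm av * norm q
      + 2 * (norm v * norm eq) + 2 * (norm v * norm aq) + 2 * (norm ev * norm aq) + 2 * (norm av * norm eq)"
      by (intro add_nonneg_nonneg mult_nonneg_nonneg) auto
    then show "norm ev * norm eq + norm ev * norm q + norm av * norm aq + norm av * norm q + 2 * (norm v * norm q)
      \<le> 2 * (norm v + norm ev + norm av) * (norm q + norm eq + norm aq)"
      by (simp add: algebra_simps)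
  qed
  finally show ?thesis by (simp add: mult_ac)
qed

text \<open>The localization identity: testing with \<open>c^2\<close> times the function gives the
  energy of \<open>c q\<close> minus the squared gradient of the cutoff, which for a function of
  \<open>r^2\<close> is \<open>4 t c'^2\<close>. The second argument of \<open>dform\<close> is the
  derivative of \<open>W c^2\<close>, as \<open>W' = 4 / (t + 8)^2\<close>.\<close>

lemma dform_diagonal:
  assumes t: "t > 0"
  shows "Re (dform (W t * c\<^sup>2) (8 * c\<^sup>2 / (2 * (t + 8)\<^sup>2) + 2 * W t * c * c') lam t q eq aq q eq aq) =
    energy_density t (of_real c * q) (of_real c * eq + of_real (2 * t * c') * q) (of_real c * aq)
     + (lam * W t * c\<^sup>2 - 4 * t * c'\<^sup>2 * W t) * (norm q)\<^sup>2"
proof -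
  \<comment> \<open>The derivative falling on \<open>W\<close> cancels the drift; only the
    derivative falling on the cutoff is left.\<close>
  have cancel: "2 * (8 * c\<^sup>2 / (2 * (t + 8)\<^sup>2) + 2 * W t * c * c') - 8 * (W t * c\<^sup>2) / ((t + 4) * (t + 8)) = 4 * W t * c * c'"
    using t by (simp add: W_def divide_simps) algebra
  show ?thesis
    unfolding dform_def cancel energy_density_def cmod_power2 using t
    by (simp add: field_simps power2_eq_square)
qed

text \<open>The pairing is complex bilinear, so the conjugate is put into the test function. The
  conditions on \<open>k\<close> and \<open>k'\<close> at 0 make both integrands vanish at the
  origin, where the coefficients have no meaning.\<close>

lemma L1_pairing_eq_dform:
  fixes \<phi> p :: "real^2 \<Rightarrow> complex"
  assumes p: "has_grad p p1 p2"
    and k: "\<And>t. (k has_real_derivative k' t) (at t)" "k 0 = 0" "k' 0 = 0"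
  defines "v1 \<equiv> weak_deriv (axis 1 1) \<phi>" and "v2 \<equiv> weak_deriv (axis 2 1) \<phi>"
  shows "L1_pairing \<phi> (\<lambda>x. of_real (k (r2 x)) * cnj (p x)) =
    (LINT x|lborel. dform (k (r2 x)) (k' (r2 x)) 0 (r2 x)
       (\<phi> x) (rdr v1 v2 x) (dth v1 v2 x)
       (p x) (rdr p1 p2 x) (dth p1 p2 x))"
  unfolding L1_pairing_def
proof (rule Bochner_Integration.integral_cong)
  let ?\<eta> = "\<lambda>x. of_real (k (r2 x)) * cnj (p x)"
  fix x :: "real^2"
  note g = has_grad_mult[OF has_grad_radial[OF k(1)] has_grad_cnj[OF p]]
  note pd = has_grad_partial_deriv[OF g]
  let ?ev = "rdr v1 v2 x" and ?av = "dth v1 v2 x"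
  let ?eq = "rdr p1 p2 x" and ?aq = "dth p1 p2 x"
  show "radial_deriv weak_deriv \<phi> x * radial_deriv partial_deriv ?\<eta> x +
     angular_deriv weak_deriv \<phi> x * angular_deriv partial_deriv ?\<eta> x / of_real ((norm x)\<^sup>2) + L1_lower \<phi> x * ?\<eta> x
    = dform (k (r2 x)) (k' (r2 x)) 0 (r2 x) (\<phi> x) ?ev ?av (p x) ?eq ?aq"
  proof (cases "x = 0")
    case True
    then show ?thesis by (simp add: radial_deriv_def angular_deriv_def dform_def k)
  next
    case False
    define r where "r = norm x"
    define t where "t = x \<bullet> x"
    have r: "r > 0" and tr: "t = r\<^sup>2" and t: "t > 0"
      using False by (auto simp: r_def t_def power2_norm_eq_inner)
    note co = L1_coefficients[OF r, folded tr]
    define K K' where "K = complex_of_real (k t)" and "K' = complex_of_real (k' t)"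
    have tt: "of_real (x$1) * of_real (x$1) + of_real (x$2) * of_real (x$2) = complex_of_real t"
      by (simp add: t_def inner_plane)
    have rad: "of_real (x$1) * pd1 ?\<eta> x + of_real (x$2) * pd2 ?\<eta> x
        = K * cnj ?eq + 2 * of_real t * K' * cnj (p x)"
    proof -
      have "of_real (x$1) * pd1 ?\<eta> x + of_real (x$2) * pd2 ?\<eta> x
        = K * cnj ?eq + 2 * (of_real (x$1) * of_real (x$1) + of_real (x$2) * of_real (x$2)) * K' * cnj (p x)"
        unfolding pd by (simp add: K_def K'_def t_def algebra_simps)
      then show ?thesis by (simp only: tt)
    qed
    have ang: "of_real (x$1) * pd2 ?\<eta> x - of_real (x$2) * pd1 ?\<eta> x = K * cnj ?aq"
      unfolding pd by (simp add: K_def K'_def t_def algebra_simps)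
    have rr: "complex_of_real r * complex_of_real r = of_real t" by (simp add: tr power2_eq_square)
    have T: "complex_of_real t \<noteq> 0" "complex_of_real r \<noteq> 0" using t r by auto
    have drift: "of_real (L1_drift r) * (?ev / of_real r) = of_real (- 8 / ((t + 4) * (t + 8))) * ?ev"
      unfolding co(1)[symmetric] by simp
    have "radial_deriv weak_deriv \<phi> x * radial_deriv partial_deriv ?\<eta> x = ?ev * (K * cnj ?eq + 2 * of_real t * K' * cnj (p x)) / of_real t"
      unfolding radial_deriv_def rad v1_def[symmetric] v2_def[symmetric] r_def[symmetric] by (simp add: rr)
    moreover have "angular_deriv weak_deriv \<phi> x * angular_deriv partial_deriv ?\<eta> x / of_real ((norm x)\<^sup>2) = ?av * (K * cnj ?aq) / of_real t"
      unfolding angular_deriv_def ang v1_def[symmetric] v2_def[symmetric] r_def[symmetric] tr by simp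
    moreover have "L1_lower \<phi> x * ?\<eta> x = (of_real (- 8 / ((t + 4) * (t + 8))) * ?ev - 4 * \<i> * of_real (W t / t) * ?av
        + of_real (Pot t) * \<phi> x + of_real (Con t) * cnj (\<phi> x)) * (K * cnj (p x))"
      unfolding L1_lower_def radial_deriv_def angular_deriv_def v1_def[symmetric] v2_def[symmetric] r_def[symmetric] drift co(2-4)
      by (simp add: K_def t_def)
    moreover have "E * (K * cnj Q + 2 * of_real t * K' * cnj q) / of_real t + A * (K * cnj R) / of_real t +
      (of_real (- 8 / ((t + 4) * (t + 8))) * E - 4 * \<i> * of_real (W t / t) * A + of_real (Pot t) * v + of_real (Con t) * cnj v) * (K * cnj q)
      = dform (k t) (k' t) 0 t v E A q Q R" for E A v q Q R
      unfolding dform_def K_def K'_def using T by (simp add: add_divide_distrib algebra_simps)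
    ultimately show ?thesis by (simp only: t_def[symmetric])
  qed
qed simp

section \<open>Polynomial approximation in the Sobolev norm on discs\<close>

lemma plane_poly_grad_continuous:
  assumes "plane_poly p" "has_grad p p1 p2"
  shows "continuous_on A p" "continuous_on A p1" "continuous_on A p2"
proof -
  obtain f1 f2 where f: "smooth_plane f1" "smooth_plane f2" "has_grad p f1 f2"
    using smooth_plane_grad plane_poly_smooth[OF assms(1)] by blast
  have "p1 = f1" "p2 = f2" using has_grad_unique[OF assms(2) f(3)] by auto
  then show "continuous_on A p" "continuous_on A p1" "continuous_on A p2"
    using smooth_plane_grad[OF f(1)] smooth_plane_grad[OF f(2)] has_grad_continuous assms(2) by blast+
qed

lemma set_integrable_square_diff:
  fixes f g :: "real^2 \<Rightarrow> complex"
  assumes "square_integrable f" "continuous_on UNIV g"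
  shows "set_integrable lborel (cball 0 B) (\<lambda>x. (norm (f x - g x))\<^sup>2)"
  unfolding set_integrable_def
proof (rule Bochner_Integration.integrable_bound)
  have "integrable lborel (\<lambda>x. indicator (cball 0 B) x *\<^sub>R (norm (g x))\<^sup>2)"
    by (rule borel_integrable_compact) (use assms(2) in \<open>auto intro!: continuous_intros intro: continuous_on_subset\<close>)
  then show "integrable lborel (\<lambda>x. 2 * (norm (f x))\<^sup>2 + 2 * (indicator (cball 0 B) x *\<^sub>R (norm (g x))\<^sup>2))"
    using assms(1) by (auto simp: square_integrable_def)
  show "(\<lambda>x. indicator (cball 0 B) x *\<^sub>R (norm (f x - g x))\<^sup>2) \<in> borel_measurable lborel"
    using assms borel_measurable_continuous_onI[OF assms(2)]
    by (intro borel_measurable_scaleR borel_measurable_indicator borel_measurable_power borel_measurable_norm borel_measurable_diff)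
       (auto simp: square_integrable_def)
  show "AE x in lborel. norm (indicator (cball 0 B) x *\<^sub>R (norm (f x - g x))\<^sup>2) \<le> norm (2 * (norm (f x))\<^sup>2 + 2 * (indicator (cball 0 B) x *\<^sub>R (norm (g x))\<^sup>2))"
  proof (intro AE_I2)
    fix x
    show "norm (indicator (cball 0 B) x *\<^sub>R (norm (f x - g x))\<^sup>2) \<le> norm (2 * (norm (f x))\<^sup>2 + 2 * (indicator (cball 0 B) x *\<^sub>R (norm (g x))\<^sup>2))"
      using norm_square_sum_le[of "f x" "- g x"] by (auto simp: indicator_def)
  qed
qed

lemma set_integral_square_diff_le:
  fixes f g h :: "real^2 \<Rightarrow> complex"
  assumes f: "square_integrable f" and g: "square_integrable g" and h: "continuous_on UNIV h"
    and close: "\<And>x. norm x \<le> B \<Longrightarrow> norm (g x - h x) \<le> \<delta>"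
  shows "(LINT x:cball 0 B|lborel. (norm (f x - h x))\<^sup>2) \<le>
    2 * (LINT x|lborel. (norm (f x - g x))\<^sup>2) + 2 * \<delta>\<^sup>2 * measure lborel (cball 0 B :: (real^2) set)"
proof -
  have i1: "integrable lborel (\<lambda>x. (norm (f x - g x))\<^sup>2)"
    using square_integrable_diff[OF f g] by (simp add: square_integrable_def)
  have i2: "integrable lborel (\<lambda>x::real^2. indicator (cball 0 B) x *\<^sub>R (2 * \<delta>\<^sup>2))"
    by (rule borel_integrable_compact) auto
  have "(LINT x:cball 0 B|lborel. (norm (f x - h x))\<^sup>2) \<le>
      (LINT x|lborel. 2 * (norm (f x - g x))\<^sup>2 + indicator (cball 0 B) x *\<^sub>R (2 * \<delta>\<^sup>2))"
    unfolding set_lebesgue_integral_def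
  proof (rule integral_mono)
    show "integrable lborel (\<lambda>x. indicator (cball 0 B) x *\<^sub>R (norm (f x - h x))\<^sup>2)"
      using set_integrable_square_diff[OF f h] by (simp add: set_integrable_def)
    show "integrable lborel (\<lambda>x. 2 * (norm (f x - g x))\<^sup>2 + indicator (cball 0 B) x *\<^sub>R (2 * \<delta>\<^sup>2))"
      using i1 i2 by simp
    fix x :: "real^2"
    show "indicator (cball 0 B) x *\<^sub>R (norm (f x - h x))\<^sup>2 \<le> 2 * (norm (f x - g x))\<^sup>2 + indicator (cball 0 B) x *\<^sub>R (2 * \<delta>\<^sup>2)"
      using norm_square_sum_le[of "f x - g x" "g x - h x"] power_mono[OF close, of x 2]
      by (auto simp: indicator_def)
  qed
  also have "\<dots> = 2 * (LINT x|lborel. (norm (f x - g x))\<^sup>2) + (LINT x|lborel. indicator (cball 0 B :: (real^2) set) x *\<^sub>R (2 * \<delta>\<^sup>2))"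
    using i1 i2 by simp
  also have "(LINT x|lborel. indicator (cball 0 B :: (real^2) set) x *\<^sub>R (2 * \<delta>\<^sup>2)) = 2 * \<delta>\<^sup>2 * measure lborel (cball 0 B :: (real^2) set)"
    by simp
  finally show ?thesis .
qed

lemma H1_0_poly_approx:
  fixes \<phi> :: "real^2 \<Rightarrow> complex"
  assumes \<phi>: "\<phi> \<in> H1_0" and \<epsilon>: "\<epsilon> > 0"
  shows "\<exists>p p1 p2. plane_poly p \<and> has_grad p p1 p2 \<and>
    (LINT x:cball 0 B|lborel. (norm (\<phi> x - p x))\<^sup>2) \<le> \<epsilon> \<and>
    (LINT x:cball 0 B|lborel. (norm (weak_deriv (axis 1 1) \<phi> x - p1 x))\<^sup>2) \<le> \<epsilon> \<and>
    (LINT x:cball 0 B|lborel. (norm (weak_deriv (axis 2 1) \<phi> x - p2 x))\<^sup>2) \<le> \<epsilon>"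
proof -
  define m where "m = measure lborel (cball 0 B :: (real^2) set)"
  \<comment> \<open>Chosen so that the uniform error contributes at most half of \<epsilon> on the
    disc; the other half is twice the error \<open>\<epsilon> / 4\<close> of the test function.
    Adding 1 to \<open>m\<close> avoids a division by zero.\<close>
  define \<delta> where "\<delta> = sqrt (\<epsilon> / (4 * (m + 1)))"
  have m: "m \<ge> 0" by (simp add: m_def)
  have \<delta>: "\<delta> > 0" using \<epsilon> m by (simp add: \<delta>_def)
  have \<delta>m: "2 * \<delta>\<^sup>2 * m \<le> \<epsilon> / 2"
  proof -
    have "\<delta>\<^sup>2 = \<epsilon> / (4 * (m + 1))" using \<epsilon> m by (simp add: \<delta>_def)
    then have "\<delta>\<^sup>2 * (4 * (m + 1)) = \<epsilon>" using m by simp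
    moreover have "\<delta>\<^sup>2 * (4 * (m + 1)) = 4 * \<delta>\<^sup>2 + 2 * (2 * \<delta>\<^sup>2 * m)" by (simp add: algebra_simps)
    moreover have "\<delta>\<^sup>2 \<ge> 0" by simp
    ultimately show ?thesis by linarith
  qed
  have H: "\<phi> \<in> H1" using \<phi> by (simp add: H1_0_def)
  have sq: "square_integrable \<phi>" "square_integrable (weak_deriv (axis 1 1) \<phi>)" "square_integrable (weak_deriv (axis 2 1) \<phi>)"
    using H H1_weak_deriv(2)[OF H] by (auto simp: H1_def Basis_plane)
  obtain \<eta> where \<eta>: "\<eta> \<in> test_functions UNIV" "(LINT x|lborel. (norm (\<phi> x - \<eta> x))\<^sup>2) \<le> \<epsilon> / 4"
     "(LINT x|lborel. (norm (weak_deriv (axis 1 1) \<phi> x - pd1 \<eta> x))\<^sup>2) \<le> \<epsilon> / 4"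
     "(LINT x|lborel. (norm (weak_deriv (axis 2 1) \<phi> x - pd2 \<eta> x))\<^sup>2) \<le> \<epsilon> / 4"
    using H1_0_approx[OF \<phi>, of "\<epsilon> / 4"] \<epsilon> by auto
  obtain p p1 p2 where p: "plane_poly p" "has_grad p p1 p2"
    "\<And>x. norm x \<le> B \<Longrightarrow> norm (\<eta> x - p x) \<le> \<delta>"
    "\<And>x. norm x \<le> B \<Longrightarrow> norm (pd1 \<eta> x - p1 x) \<le> \<delta>"
    "\<And>x. norm x \<le> B \<Longrightarrow> norm (pd2 \<eta> x - p2 x) \<le> \<delta>"
    using test_function_C1_approx[OF \<eta>(1) \<delta>, of B] by blast
  note c = plane_poly_grad_continuous[OF p(1,2)]
  note se = test_function_square_integrable[OF \<eta>(1)]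
  have "(LINT x:cball 0 B|lborel. (norm (\<phi> x - p x))\<^sup>2) \<le>
      2 * (LINT x|lborel. (norm (\<phi> x - \<eta> x))\<^sup>2) + 2 * \<delta>\<^sup>2 * m"
    unfolding m_def by (rule set_integral_square_diff_le[OF sq(1) se(1) c(1) p(3)])
  then have a1: "(LINT x:cball 0 B|lborel. (norm (\<phi> x - p x))\<^sup>2) \<le> \<epsilon>"
    using \<eta>(2) \<delta>m by linarith
  have "(LINT x:cball 0 B|lborel. (norm (weak_deriv (axis 1 1) \<phi> x - p1 x))\<^sup>2) \<le>
      2 * (LINT x|lborel. (norm (weak_deriv (axis 1 1) \<phi> x - pd1 \<eta> x))\<^sup>2) + 2 * \<delta>\<^sup>2 * m"
    unfolding m_def by (rule set_integral_square_diff_le[OF sq(2) se(2) c(2) p(4)])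
  then have a2: "(LINT x:cball 0 B|lborel. (norm (weak_deriv (axis 1 1) \<phi> x - p1 x))\<^sup>2) \<le> \<epsilon>"
    using \<eta>(3) \<delta>m by linarith
  have "(LINT x:cball 0 B|lborel. (norm (weak_deriv (axis 2 1) \<phi> x - p2 x))\<^sup>2) \<le>
      2 * (LINT x|lborel. (norm (weak_deriv (axis 2 1) \<phi> x - pd2 \<eta> x))\<^sup>2) + 2 * \<delta>\<^sup>2 * m"
    unfolding m_def by (rule set_integral_square_diff_le[OF sq(3) se(3) c(3) p(5)])
  then have a3: "(LINT x:cball 0 B|lborel. (norm (weak_deriv (axis 2 1) \<phi> x - p2 x))\<^sup>2) \<le> \<epsilon>"
    using \<eta>(4) \<delta>m by linarith
  show ?thesis using p(1,2) a1 a2 a3 by blast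
qed

lemma bounded_of_annulus:
  fixes f :: "real \<Rightarrow> real"
  assumes "continuous_on {0<..} f" "d > 0" "\<And>t. t < d \<or> t > T \<Longrightarrow> f t = 0"
  shows "\<exists>B. \<forall>t. \<bar>f t\<bar> \<le> B"
proof -
  have "compact (f ` {d..T})"
    by (intro compact_continuous_image continuous_on_subset[OF assms(1)]) (use assms(2) in auto)
  then obtain B where "\<forall>t\<in>{d..T}. norm (f t) \<le> B"
    by (auto dest!: compact_imp_bounded simp: bounded_iff)
  then have B: "\<bar>f t\<bar> \<le> B" if "t \<in> {d..T}" for t using that by simp
  have "\<bar>f t\<bar> \<le> max B 0" for t
    using assms(3)[of t] B[of t] by (cases "t \<in> {d..T}") auto
  then show ?thesis by blast
qed

lemma le_of_le_linear:
  fixes x a b :: real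
  assumes "\<And>e. e > 0 \<Longrightarrow> x \<le> a * e + b" "a \<ge> 0"
  shows "x \<le> b"
proof (rule ccontr)
  assume "\<not> x \<le> b"
  then have "(x - b) / (2 * (a + 1)) > 0" using assms(2) by simp
  from assms(1)[OF this] have "x \<le> a * ((x - b) / (2 * (a + 1))) + b" .
  also have "a * ((x - b) / (2 * (a + 1))) \<le> (x - b) / 2"
    using \<open>\<not> x \<le> b\<close> assms(2) by (simp add: divide_simps)
  finally show False using \<open>\<not> x \<le> b\<close> by (simp add: field_simps)
qed

lemma norm_polar_le:
  fixes a b :: complex and x :: "real^2"
  assumes "norm x \<le> \<rho>" "\<rho> \<ge> 1"
  shows "norm c + norm (of_real (x$1) * a + of_real (x$2) * b) + norm (of_real (x$1) * b - of_real (x$2) * a)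
    \<le> 2 * \<rho> * (norm c + norm a + norm b)"
proof -
  have x: "\<bar>x$1\<bar> \<le> \<rho>" "\<bar>x$2\<bar> \<le> \<rho>"
    using component_le_norm_cart[of x 1] component_le_norm_cart[of x 2] assms by linarith+
  have m: "norm (of_real (x$i) * z) \<le> \<rho> * norm z" for i :: 2 and z :: complex
    using x exhaust_2[of i] by (auto simp: norm_mult intro!: mult_right_mono)
  have "norm (of_real (x$1) * a + of_real (x$2) * b) \<le> \<rho> * norm a + \<rho> * norm b"
    by (intro order_trans[OF norm_triangle_ineq] add_mono m)
  moreover have "norm (of_real (x$1) * b - of_real (x$2) * a) \<le> \<rho> * norm b + \<rho> * norm a"
    by (intro order_trans[OF norm_triangle_ineq4] add_mono m)
  moreover have "norm c \<le> 2 * \<rho> * norm c" using assms(2) mult_right_mono[of 1 "2 * \<rho>" "norm c"] by simp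
  ultimately show ?thesis by (simp add: algebra_simps)
qed

lemma square_of_sum3_le: "(a + b + c)\<^sup>2 \<le> 3 * (a\<^sup>2 + b\<^sup>2 + c\<^sup>2)" for a b c :: real
proof -
  have "0 \<le> (a - b)\<^sup>2 + (b - c)\<^sup>2 + (a - c)\<^sup>2" by (intro add_nonneg_nonneg) auto
  then show ?thesis by (simp add: power2_eq_square algebra_simps)
qed

text \<open>Write \<open>\<phi> = p + e\<close> with a polynomial \<open>p\<close>. The equation
  makes the form of \<phi> against \<open>p\<close> vanish, so the form of \<open>p\<close> against
  itself is minus that of \<open>e\<close> against \<open>p\<close>. By
  \<open>dform_diagonal\<close> and the nonnegativity of the energy, the weighted integral of
  \<open>|p|^2\<close> is then bounded by the error, which tends to zero as \<open>p\<close>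
  approaches \<phi>.\<close>

lemma cutoff_inequality:
  fixes \<phi> :: "real^2 \<Rightarrow> complex"
  assumes \<phi>: "\<phi> \<in> H1_0" and eig: "L1_eigen_eq \<phi> (- lam)"
    and k: "smooth_real k" "\<And>t. t > 0 \<Longrightarrow> k t = W t * (c t)\<^sup>2"
    and c: "smooth_real c" "\<And>t. (c has_real_derivative c' t) (at t)"
    and d: "d > 0" "\<And>t. t < d \<or> t > T \<Longrightarrow> c t = 0" "\<And>t. t < d \<or> t > T \<Longrightarrow> k t = 0"
  shows "integrable lborel (\<lambda>x. (lam * W (r2 x) * (c (r2 x))\<^sup>2 - 4 * (r2 x) * (c' (r2 x))\<^sup>2 * W (r2 x)) * (norm (\<phi> x))\<^sup>2)"
    "(LINT x|lborel. (lam * W (r2 x) * (c (r2 x))\<^sup>2 - 4 * (r2 x) * (c' (r2 x))\<^sup>2 * W (r2 x)) * (norm (\<phi> x))\<^sup>2) \<le> 0"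
proof -
  define v1 v2 where "v1 = weak_deriv (axis 1 1) \<phi>" and "v2 = weak_deriv (axis 2 1) \<phi>"
  have H: "\<phi> \<in> H1" using \<phi> by (simp add: H1_0_def)
  have sq: "square_integrable \<phi>" "square_integrable v1" "square_integrable v2"
    using H H1_weak_deriv(2)[OF H] by (auto simp: H1_def Basis_plane v1_def v2_def)
  have meas: "\<phi> \<in> borel_measurable lborel" "v1 \<in> borel_measurable lborel" "v2 \<in> borel_measurable lborel"
    using sq by (auto simp: square_integrable_def)
  obtain c1 where c1: "smooth_real c1" "\<And>t. (c has_real_derivative c1 t) (at t)" using smooth_real_deriv[OF c(1)] by blast
  have "c' = c1" using DERIV_unique[OF c(2) c1(2)] by (auto simp: fun_eq_iff)
  obtain c'' where c'': "smooth_real c''" "\<And>t. (c' has_real_derivative c'' t) (at t)"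
    using smooth_real_deriv[OF c1(1)] \<open>c' = c1\<close> by blast
  obtain k' where k': "smooth_real k'" "\<And>t. (k has_real_derivative k' t) (at t)" using smooth_real_deriv[OF k(1)] by blast
  have cont: "continuous_on A f" if "smooth_real f" for f and A :: "real set"
    using smooth_real_deriv[OF that] by (meson DERIV_continuous_on has_field_derivative_at_within)
  have z: "f' t = 0" if "\<And>t. (f has_real_derivative f' t) (at t)" "\<And>t. t < d \<or> t > T \<Longrightarrow> f t = 0" "t < d \<or> t > T" for f f' :: "real \<Rightarrow> real" and t
  proof -
    have "(f has_real_derivative 0) (at t)"
      by (rule has_field_derivative_transform_within_open[where S="{..<d} \<union> {T<..}" and f="\<lambda>_. 0"])
         (use that in auto)
    then show ?thesis using that(1) DERIV_unique by blast
  qed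
  note c'0 = z[OF c(2) d(2)] and k'0 = z[OF k'(2) d(3)]
  have k'_eq: "k' t = 8 * (c t)\<^sup>2 / (2 * (t + 8)\<^sup>2) + 2 * W t * c t * c' t" if t: "t > 0" for t
  proof -
    have "((\<lambda>t. W t * (c t)\<^sup>2) has_real_derivative 8 * (c t)\<^sup>2 / (2 * (t + 8)\<^sup>2) + 2 * W t * c t * c' t) (at t)"
      unfolding W_def using t
      by (auto intro!: derivative_eq_intros c(2)) (simp add: divide_simps, algebra)
    then have "(k has_real_derivative 8 * (c t)\<^sup>2 / (2 * (t + 8)\<^sup>2) + 2 * W t * c t * c' t) (at t)"
      by (rule has_field_derivative_transform_within_open[where S="{0<..}"]) (use t k(2) in auto)
    then show ?thesis using k'(2) DERIV_unique by blast
  qed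
  define wt where "wt t = lam * W t * (c t)\<^sup>2 - 4 * t * (c' t)\<^sup>2 * W t" for t
  note cp = C1_pos_continuous[OF C1_pos_W] C1_pos_continuous[OF C1_pos_Pot] C1_pos_continuous[OF C1_pos_Con]
  \<comment> \<open>The coefficients are continuous for \<open>t > 0\<close>, and the cutoffs with
    their derivatives vanish outside \<open>{d..T}\<close>, so one constant bounds all
    products.\<close>
  have "\<exists>B. (\<forall>t. \<bar>k t / t\<bar> \<le> B) \<and> (\<forall>t. \<bar>2 * k' t - 8 * k t / ((t + 4) * (t + 8))\<bar> \<le> B) \<and> (\<forall>t. \<bar>4 * (W t * k t / t)\<bar> \<le> B) \<and>
      (\<forall>t. \<bar>(Pot t + lam) * k t\<bar> \<le> B) \<and> (\<forall>t. \<bar>(Pot t + 0) * k t\<bar> \<le> B) \<and> (\<forall>t. \<bar>Con t * k t\<bar> \<le> B) \<and> (\<forall>t. \<bar>wt t\<bar> \<le> B)"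
  proof -
    have "\<exists>B. \<forall>t. \<bar>k t / t\<bar> \<le> B" "\<exists>B. \<forall>t. \<bar>2 * k' t - 8 * k t / ((t + 4) * (t + 8))\<bar> \<le> B" "\<exists>B. \<forall>t. \<bar>4 * (W t * k t / t)\<bar> \<le> B"
      "\<exists>B. \<forall>t. \<bar>(Pot t + lam) * k t\<bar> \<le> B" "\<exists>B. \<forall>t. \<bar>(Pot t + 0) * k t\<bar> \<le> B" "\<exists>B. \<forall>t. \<bar>Con t * k t\<bar> \<le> B" "\<exists>B. \<forall>t. \<bar>wt t\<bar> \<le> B"
      by (rule bounded_of_annulus[OF _ d(1), where T=T];
          use d c'0 k'0 cp cont[OF k(1)] cont[OF k'(1)] cont[OF c(1)] cont[OF c1(1)] \<open>c' = c1\<close> in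
          \<open>auto simp: wt_def intro!: continuous_intros\<close>)+
    then obtain B1 B2 B3 B4 B5 B6 B7 where "\<forall>t. \<bar>k t / t\<bar> \<le> B1" "\<forall>t. \<bar>2 * k' t - 8 * k t / ((t + 4) * (t + 8))\<bar> \<le> B2"
      "\<forall>t. \<bar>4 * (W t * k t / t)\<bar> \<le> B3" "\<forall>t. \<bar>(Pot t + lam) * k t\<bar> \<le> B4" "\<forall>t. \<bar>(Pot t + 0) * k t\<bar> \<le> B5" "\<forall>t. \<bar>Con t * k t\<bar> \<le> B6" "\<forall>t. \<bar>wt t\<bar> \<le> B7"
      by metis
    then show ?thesis
      by (intro exI[of _ "max B1 (max B2 (max B3 (max B4 (max B5 (max B6 B7)))))"]) (auto simp: le_max_iff_disj)
  qed
  then obtain B where B: "\<And>t. \<bar>k t / t\<bar> \<le> B" "\<And>t. \<bar>2 * k' t - 8 * k t / ((t + 4) * (t + 8))\<bar> \<le> B" "\<And>t. \<bar>4 * (W t * k t / t)\<bar> \<le> B"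
      "\<And>t. \<bar>(Pot t + lam) * k t\<bar> \<le> B" "\<And>t. \<bar>(Pot t + 0) * k t\<bar> \<le> B" "\<And>t. \<bar>Con t * k t\<bar> \<le> B" "\<And>t. \<bar>wt t\<bar> \<le> B"
    by blast
  have B0: "B \<ge> 0" using B(1)[of 0] by simp
  define \<rho> where "\<rho> = sqrt \<bar>T\<bar> + 1"
  have \<rho>: "\<rho> \<ge> 1" by (simp add: \<rho>_def)
  define S where "S = (cball 0 \<rho> :: (real^2) set)"
  have out: "x \<bullet> x > T" if "x \<notin> S" for x
  proof -
    have "norm x > sqrt \<bar>T\<bar>" using that by (simp add: S_def \<rho>_def)
    then have "x \<bullet> x > \<bar>T\<bar>" by (simp add: norm_eq_sqrt_inner)
    then show ?thesis by simp
  qed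
  have km[measurable]: "k \<in> borel_measurable borel" "k' \<in> borel_measurable borel" "c \<in> borel_measurable borel" "c' \<in> borel_measurable borel"
    using cont[OF k(1)] cont[OF k'(1)] cont[OF c(1)] cont[OF c1(1)] \<open>c' = c1\<close>
    by (auto intro!: borel_measurable_continuous_onI)
  have Wm[measurable]: "W \<in> borel_measurable borel" "Pot \<in> borel_measurable borel" "Con \<in> borel_measurable borel"
    unfolding W_def[abs_def] Pot_def[abs_def] Con_def[abs_def] by measurable
  define Dm where "Dm l u u1 u2 p p1 p2 x = dform (k (r2 x)) (k' (r2 x)) l (r2 x)
       (u x) (rdr u1 u2 x) (dth u1 u2 x)
       (p x) (rdr p1 p2 x) (dth p1 p2 x)"
    for l and u u1 u2 p p1 p2 :: "real^2 \<Rightarrow> complex" and x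
  define n3 where "n3 u u1 u2 x = norm (u x) + norm (u1 x) + norm (u2 x)" for u u1 u2 :: "real^2 \<Rightarrow> complex" and x
  have n3_nn: "n3 u u1 u2 x \<ge> 0" for u u1 u2 x by (simp add: n3_def)
  have Dm_bound: "norm (Dm l u u1 u2 p p1 p2 x) \<le> indicator S x * (8 * B * \<rho>\<^sup>2 * n3 u u1 u2 x * n3 p p1 p2 x)"
    if l: "l = lam \<or> l = 0" for l u u1 u2 p p1 p2 x
  proof (cases "x \<in> S")
    case True
    then have x: "norm x \<le> \<rho>" by (simp add: S_def)
    have "\<bar>(Pot t + l) * k t\<bar> \<le> B" for t using l B(4,5) by auto
    from dform_bound[OF B(1-3) this B(6)]
    have "norm (Dm l u u1 u2 p p1 p2 x) \<le> 2 * B * (norm (u x) + norm (rdr u1 u2 x) + norm (dth u1 u2 x))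
      * (norm (p x) + norm (rdr p1 p2 x) + norm (dth p1 p2 x))"
      unfolding Dm_def .
    also have "\<dots> \<le> 2 * B * (2 * \<rho> * n3 u u1 u2 x) * (2 * \<rho> * n3 p p1 p2 x)"
      unfolding n3_def using B0 \<rho> by (intro mult_mono norm_polar_le x \<rho> order_refl) (auto intro!: mult_nonneg_nonneg add_nonneg_nonneg)
    finally show ?thesis using True by (simp add: power2_eq_square mult_ac)
  next
    case False
    have "k (r2 x) = 0" "k' (r2 x) = 0" using out[OF False] d(3) k'0 by auto
    then show ?thesis using False by (simp add: Dm_def dform_def)
  qed
  have n3_sq_int: "integrable lborel (\<lambda>x. (n3 u u1 u2 x)\<^sup>2)"
    if "square_integrable u" "square_integrable u1" "square_integrable u2" for u u1 u2
  proof (rule Bochner_Integration.integrable_bound)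
    show "integrable lborel (\<lambda>x. 3 * ((norm (u x))\<^sup>2 + (norm (u1 x))\<^sup>2 + (norm (u2 x))\<^sup>2))"
      using that by (simp add: square_integrable_def)
    show "AE x in lborel. norm ((n3 u u1 u2 x)\<^sup>2) \<le> norm (3 * ((norm (u x))\<^sup>2 + (norm (u1 x))\<^sup>2 + (norm (u2 x))\<^sup>2))"
      using square_of_sum3_le by (auto simp: n3_def)
    note [measurable] = that[unfolded square_integrable_def, THEN conjunct1]
    show "(\<lambda>x. (n3 u u1 u2 x)\<^sup>2) \<in> borel_measurable lborel" unfolding n3_def by measurable
  qed
  have Vint: "integrable lborel (\<lambda>x. (n3 \<phi> v1 v2 x)\<^sup>2)" by (rule n3_sq_int[OF sq])
  define V where "V = (LINT x|lborel. (n3 \<phi> v1 v2 x)\<^sup>2)"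
  define \<Lambda> where "\<Lambda> = (LINT x|lborel. wt (r2 x) * (norm (\<phi> x))\<^sup>2)"
  have \<Lambda>int: "integrable lborel (\<lambda>x. wt (r2 x) * (norm (\<phi> x))\<^sup>2)"
  proof (rule Bochner_Integration.integrable_bound)
    show "integrable lborel (\<lambda>x. B * (norm (\<phi> x))\<^sup>2)" using sq(1) by (simp add: square_integrable_def)
    show "AE x in lborel. norm (wt (r2 x) * (norm (\<phi> x))\<^sup>2) \<le> norm (B * (norm (\<phi> x))\<^sup>2)"
      using B(7) B0 by (intro AE_I2) (auto simp: abs_mult intro!: mult_right_mono)
    show "(\<lambda>x. wt (r2 x) * (norm (\<phi> x))\<^sup>2) \<in> borel_measurable lborel" unfolding wt_def using meas(1) by measurable
  qed
  \<comment> \<open>The first summand pays for replacing \<phi> by \<open>p\<close> in the weighted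
    integral, the second for the error in the form; in the latter each triple of polar derivatives
    costs a factor \<open>2 \<rho>\<close>.\<close>
  define C where "C = 2 * B + 8 * B * \<rho>\<^sup>2"
  have C: "C \<ge> 0" using B0 by (simp add: C_def)
  have main: "\<Lambda> \<le> C * ((1 + 1 / \<delta>) * (9 * \<epsilon>) + \<delta> * V)" if \<delta>: "\<delta> > 0" and \<epsilon>: "\<epsilon> > 0" for \<delta> \<epsilon>
  proof -
    obtain p p1 p2 where p: "plane_poly p" "has_grad p p1 p2"
      "(LINT x:S|lborel. (norm (\<phi> x - p x))\<^sup>2) \<le> \<epsilon>" "(LINT x:S|lborel. (norm (v1 x - p1 x))\<^sup>2) \<le> \<epsilon>"
      "(LINT x:S|lborel. (norm (v2 x - p2 x))\<^sup>2) \<le> \<epsilon>"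
      using H1_0_poly_approx[OF \<phi> \<epsilon>, of \<rho>] unfolding S_def v1_def v2_def by blast
    note pc = plane_poly_grad_continuous[OF p(1,2)]
    note [measurable] = meas borel_measurable_continuous_onI[OF pc(1)] borel_measurable_continuous_onI[OF pc(2)] borel_measurable_continuous_onI[OF pc(3)]
    have [measurable]: "S \<in> sets borel" by (simp add: S_def)
    define e e1 e2 where "e x = \<phi> x - p x" and "e1 x = v1 x - p1 x" and "e2 x = v2 x - p2 x" for x
    define ne where "ne = n3 e e1 e2"
    define nv where "nv = n3 \<phi> v1 v2"
    have nn: "ne x \<ge> 0" "nv x \<ge> 0" for x by (simp_all add: ne_def nv_def n3_nn)
    have nq: "n3 p p1 p2 x \<le> ne x + nv x" for x
    proof -
      have "norm (p x) \<le> norm (e x) + norm (\<phi> x)" "norm (p1 x) \<le> norm (e1 x) + norm (v1 x)" "norm (p2 x) \<le> norm (e2 x) + norm (v2 x)"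
        unfolding e_def e1_def e2_def
        by (metis norm_minus_commute norm_triangle_sub add.commute)+
      then show ?thesis by (simp add: ne_def nv_def n3_def)
    qed
    have es: "set_integrable lborel S (\<lambda>x. (norm (e x))\<^sup>2)" "set_integrable lborel S (\<lambda>x. (norm (e1 x))\<^sup>2)" "set_integrable lborel S (\<lambda>x. (norm (e2 x))\<^sup>2)"
      unfolding S_def e_def e1_def e2_def by (intro set_integrable_square_diff sq pc)+
    have nem: "ne \<in> borel_measurable borel" "nv \<in> borel_measurable borel"
      unfolding ne_def nv_def n3_def[abs_def] e_def e1_def e2_def by measurable
    note [measurable] = nem
    have ei: "integrable lborel (\<lambda>x. indicator S x * (3 * ((norm (e x))\<^sup>2 + (norm (e1 x))\<^sup>2 + (norm (e2 x))\<^sup>2)))"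
    proof -
      have "integrable lborel (\<lambda>x. 3 * (indicator S x *\<^sub>R (norm (e x))\<^sup>2 + indicator S x *\<^sub>R (norm (e1 x))\<^sup>2 + indicator S x *\<^sub>R (norm (e2 x))\<^sup>2))"
        using es unfolding set_integrable_def by (intro integrable_mult_right impI Bochner_Integration.integrable_add)
      then show ?thesis by (simp add: algebra_simps)
    qed
    have ne_int: "integrable lborel (\<lambda>x. indicator S x * (ne x)\<^sup>2)"
    proof (rule Bochner_Integration.integrable_bound[OF ei])
      show "AE x in lborel. norm (indicator S x * (ne x)\<^sup>2) \<le> norm (indicator S x * (3 * ((norm (e x))\<^sup>2 + (norm (e1 x))\<^sup>2 + (norm (e2 x))\<^sup>2)))"
        using square_of_sum3_le by (auto simp: ne_def n3_def indicator_def)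
    qed measurable
    have ne_le: "(LINT x|lborel. indicator S x * (ne x)\<^sup>2) \<le> 9 * \<epsilon>"
    proof -
      have "(LINT x|lborel. indicator S x * (ne x)\<^sup>2) \<le> (LINT x|lborel. indicator S x * (3 * ((norm (e x))\<^sup>2 + (norm (e1 x))\<^sup>2 + (norm (e2 x))\<^sup>2)))"
        by (rule integral_mono[OF ne_int ei]) (use square_of_sum3_le in \<open>auto simp: ne_def n3_def indicator_def\<close>)
      also have "\<dots> = (LINT x|lborel. 3 * (indicator S x *\<^sub>R (norm (e x))\<^sup>2 + indicator S x *\<^sub>R (norm (e1 x))\<^sup>2 + indicator S x *\<^sub>R (norm (e2 x))\<^sup>2))"
        by (rule Bochner_Integration.integral_cong) (auto simp: indicator_def)
      also have "\<dots> = 3 * ((LINT x:S|lborel. (norm (e x))\<^sup>2) + (LINT x:S|lborel. (norm (e1 x))\<^sup>2) + (LINT x:S|lborel. (norm (e2 x))\<^sup>2))"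
        using es unfolding set_integrable_def set_lebesgue_integral_def by simp
      also have "\<dots> \<le> 9 * \<epsilon>" using p(3-5) by (simp add: e_def e1_def e2_def)
      finally show ?thesis .
    qed
    define Q where "Q x = indicator S x * ((1 + 1 / \<delta>) * (ne x)\<^sup>2 + \<delta> * (nv x)\<^sup>2)" for x
    have nvS: "integrable lborel (\<lambda>x. indicator S x * (nv x)\<^sup>2)"
      using integrable_real_mult_indicator[of S lborel "\<lambda>x. (nv x)\<^sup>2"] Vint by (simp add: nv_def mult.commute)
    have Qint: "integrable lborel Q"
    proof -
      have "integrable lborel (\<lambda>x. (1 + 1 / \<delta>) * (indicator S x * (ne x)\<^sup>2) + \<delta> * (indicator S x * (nv x)\<^sup>2))"
        using ne_int nvS by simp
      then show ?thesis by (simp add: Q_def[abs_def] algebra_simps)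
    qed
    have Qle: "(LINT x|lborel. Q x) \<le> (1 + 1 / \<delta>) * (9 * \<epsilon>) + \<delta> * V"
    proof -
      have "(LINT x|lborel. Q x) = (LINT x|lborel. (1 + 1 / \<delta>) * (indicator S x * (ne x)\<^sup>2) + \<delta> * (indicator S x * (nv x)\<^sup>2))"
        by (rule Bochner_Integration.integral_cong) (auto simp: Q_def algebra_simps)
      also have "\<dots> = (1 + 1 / \<delta>) * (LINT x|lborel. indicator S x * (ne x)\<^sup>2) + \<delta> * (LINT x|lborel. indicator S x * (nv x)\<^sup>2)"
        using ne_int nvS by simp
      also have "\<dots> \<le> (1 + 1 / \<delta>) * (9 * \<epsilon>) + \<delta> * V"
      proof (intro add_mono mult_left_mono ne_le)
        show "(LINT x|lborel. indicator S x * (nv x)\<^sup>2) \<le> V"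
          unfolding V_def nv_def[symmetric] by (rule integral_mono[OF nvS]) (use Vint in \<open>auto simp: nv_def indicator_def\<close>)
      qed (use \<delta> in auto)
      finally show ?thesis .
    qed
    \<comment> \<open>Young's inequality with parameter \<delta>: the large factor
      \<open>1 / \<delta>\<close> goes to the small quantity \<open>ne\<close>, the small factor
      \<delta> to the fixed quantity \<open>nv\<close>.\<close>
    have Qb: "indicator S x * (ne x * (ne x + 2 * nv x)) \<le> Q x" for x
    proof -
      have "2 * ((ne x / sqrt \<delta>) * (sqrt \<delta> * nv x)) \<le> (ne x / sqrt \<delta>)\<^sup>2 + (sqrt \<delta> * nv x)\<^sup>2"
        using sum_squares_bound[of "ne x / sqrt \<delta>" "sqrt \<delta> * nv x"] by (simp only: mult.assoc)
      then have "2 * ne x * nv x \<le> (ne x)\<^sup>2 / \<delta> + \<delta> * (nv x)\<^sup>2"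
        using \<delta> by (simp add: power_divide power_mult_distrib)
      then show ?thesis by (auto simp: Q_def indicator_def algebra_simps power2_eq_square)
    qed
    have Dm_int: "integrable lborel (Dm l u u1 u2 p p1 p2)"
      if "l = lam \<or> l = 0" "u \<in> borel_measurable borel" "u1 \<in> borel_measurable borel" "u2 \<in> borel_measurable borel"
        "\<And>x. n3 u u1 u2 x \<le> ne x + nv x" for l u u1 u2
    proof (rule Bochner_Integration.integrable_bound)
      show "integrable lborel (\<lambda>x. (8 * B * \<rho>\<^sup>2) * (2 * (indicator S x * (ne x)\<^sup>2) + 2 * (indicator S x * (nv x)\<^sup>2)))"
        using ne_int nvS by simp
      note [measurable] = that(2-4)
      have [measurable]: "cnj \<in> borel_measurable borel"
        by (intro borel_measurable_continuous_onI continuous_intros)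
      show "Dm l u u1 u2 p p1 p2 \<in> borel_measurable lborel"
        unfolding Dm_def[abs_def] dform_def by measurable
      show "AE x in lborel. norm (Dm l u u1 u2 p p1 p2 x) \<le> norm ((8 * B * \<rho>\<^sup>2) * (2 * (indicator S x * (ne x)\<^sup>2) + 2 * (indicator S x * (nv x)\<^sup>2)))"
      proof (intro AE_I2)
        fix x
        have "n3 u u1 u2 x * n3 p p1 p2 x \<le> (ne x + nv x) * (ne x + nv x)"
          using that(5) nq n3_nn nn by (intro mult_mono) (auto intro: add_nonneg_nonneg)
        also have "\<dots> \<le> 2 * (ne x)\<^sup>2 + 2 * (nv x)\<^sup>2"
          using sum_squares_bound[of "ne x" "nv x"] by (simp add: power2_eq_square algebra_simps)
        finally have "indicator S x * (8 * B * \<rho>\<^sup>2 * (n3 u u1 u2 x * n3 p p1 p2 x)) \<le> indicator S x * (8 * B * \<rho>\<^sup>2 * (2 * (ne x)\<^sup>2 + 2 * (nv x)\<^sup>2))"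
          using B0 by (intro mult_left_mono) auto
        with Dm_bound[OF that(1), of u u1 u2 p p1 p2 x]
        have "norm (Dm l u u1 u2 p p1 p2 x) \<le> (8 * B * \<rho>\<^sup>2) * (2 * (indicator S x * (ne x)\<^sup>2) + 2 * (indicator S x * (nv x)\<^sup>2))"
          by (simp add: algebra_simps)
        then show "norm (Dm l u u1 u2 p p1 p2 x) \<le> norm ((8 * B * \<rho>\<^sup>2) * (2 * (indicator S x * (ne x)\<^sup>2) + 2 * (indicator S x * (nv x)\<^sup>2)))"
          by simp
      qed
    qed
    have em: "e \<in> borel_measurable borel" "e1 \<in> borel_measurable borel" "e2 \<in> borel_measurable borel"
      unfolding e_def[abs_def] e1_def[abs_def] e2_def[abs_def] by measurable
    have Dphi: "integrable lborel (Dm l \<phi> v1 v2 p p1 p2)" if "l = lam \<or> l = 0" for l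
      by (rule Dm_int[OF that]) (use nn in \<open>auto simp: nv_def\<close>)
    have De: "integrable lborel (Dm lam e e1 e2 p p1 p2)"
      by (rule Dm_int) (use nn em in \<open>auto simp: ne_def\<close>)
    \<comment> \<open>The only use of the eigenvalue equation; adding \<open>lam\<close> to the
      potential turns it into the vanishing of the form.\<close>
    have Dphi0: "(LINT x|lborel. Dm lam \<phi> v1 v2 p p1 p2 x) = 0"
    proof -
      let ?\<eta> = "\<lambda>x. of_real (k (r2 x)) * cnj (p x)"
      let ?K = "{x::real^2. d \<le> x \<bullet> x \<and> x \<bullet> x \<le> T}"
      have \<eta>: "?\<eta> \<in> test_functions (- {0})"
      proof (rule smooth_plane_test_function[of _ ?K])
        show "smooth_plane ?\<eta>"
          using plane_poly_smooth[OF p(1)] by (intro smooth_plane_mult smooth_plane_radial k(1)) auto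
        show "closed ?K"
          by (intro closed_Collect_conj closed_Collect_le continuous_intros)
        have "?K \<subseteq> S" using out by force
        then show "bounded ?K" using bounded_subset by (auto simp: S_def)
        show "?K \<subseteq> - {0}" using d(1) by auto
        show "?\<eta> x = 0" if "x \<notin> ?K" for x using d(3)[of "x \<bullet> x"] that by auto
      qed
      have k0: "k 0 = 0" "k' 0 = 0" using d k'0 by auto
      have "L1_pairing \<phi> ?\<eta> = of_real (- lam) * (LINT x|lborel. \<phi> x * ?\<eta> x)"
        using eig \<eta> unfolding L1_eigen_eq_def by blast
      moreover have "L1_pairing \<phi> ?\<eta> = (LINT x|lborel. Dm 0 \<phi> v1 v2 p p1 p2 x)"
        unfolding Dm_def v1_def v2_def by (rule L1_pairing_eq_dform[OF p(2) k'(2) k0])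
      moreover have eq: "Dm lam \<phi> v1 v2 p p1 p2 x - Dm 0 \<phi> v1 v2 p p1 p2 x = of_real lam * (\<phi> x * ?\<eta> x)" for x
        by (simp add: Dm_def dform_def algebra_simps)
      have "(LINT x|lborel. of_real lam * (\<phi> x * ?\<eta> x)) = (LINT x|lborel. Dm lam \<phi> v1 v2 p p1 p2 x) - (LINT x|lborel. Dm 0 \<phi> v1 v2 p p1 p2 x)"
        unfolding eq[symmetric] by (rule Bochner_Integration.integral_diff) (use Dphi in auto)
      ultimately show ?thesis by simp
    qed
    have Re_diag: "wt (r2 x) * (norm (p x))\<^sup>2 = Re (Dm lam p p1 p2 p p1 p2 x) - energy_density (r2 x) (of_real (c (r2 x)) * p x)
      (of_real (c (r2 x)) * (rdr p1 p2 x) + of_real (2 * (r2 x) * c' (r2 x)) * p x)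
      (of_real (c (r2 x)) * (dth p1 p2 x))" for x
    proof (cases "x = 0")
      case True
      then show ?thesis using d(1) d(2,3)[of 0] c'0[of 0] by (simp add: wt_def Dm_def dform_def energy_density_def)
    next
      case False
      then have t: "x \<bullet> x > 0" by simp
      show ?thesis
        unfolding Dm_def k(2)[OF t] k'_eq[OF t] dform_diagonal[OF t] wt_def by simp
    qed
    have c''c: "continuous_on UNIV c''" by (rule cont[OF c''(1)])
    have d2: "\<And>t. t < d \<Longrightarrow> c t = 0" "\<And>t. t > T \<Longrightarrow> c t = 0" using d(2) by auto
    note en = energy_cutoff_nonneg[OF p(1,2) c(2) c''(2) c''c d(1) d2]
    have diff: "Dm lam p p1 p2 p p1 p2 x = Dm lam \<phi> v1 v2 p p1 p2 x - Dm lam e e1 e2 p p1 p2 x" for x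
    proof -
      have "Dm lam e e1 e2 p p1 p2 x = Dm lam \<phi> v1 v2 p p1 p2 x - Dm lam p p1 p2 p p1 p2 x"
        unfolding Dm_def dform_diff[symmetric] by (simp add: e_def e1_def e2_def algebra_simps)
      then show ?thesis by simp
    qed
    have Dp: "integrable lborel (Dm lam p p1 p2 p p1 p2)"
      unfolding diff[abs_def] using Dphi[of lam] De by simp
    have wp_int: "integrable lborel (\<lambda>x. wt (r2 x) * (norm (p x))\<^sup>2)"
      unfolding Re_diag by (intro Bochner_Integration.integrable_diff integrable_bounded_linear[OF bounded_linear_Re Dp] en(1))
    \<comment> \<open>The energy of the cut-off polynomial is dropped because it is
      nonnegative.\<close>
    have "(LINT x|lborel. wt (r2 x) * (norm (p x))\<^sup>2) \<le> (LINT x|lborel. Re (Dm lam p p1 p2 p p1 p2 x))"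
      unfolding Re_diag using en by (subst Bochner_Integration.integral_diff) (auto intro!: integrable_bounded_linear[OF bounded_linear_Re Dp])
    also have "\<dots> = Re (LINT x|lborel. Dm lam p p1 p2 p p1 p2 x)" by (rule integral_bounded_linear[OF bounded_linear_Re Dp])
    also have "(LINT x|lborel. Dm lam p p1 p2 p p1 p2 x) = - (LINT x|lborel. Dm lam e e1 e2 p p1 p2 x)"
      unfolding diff using Dphi[of lam] De Dphi0 by simp
    also have "Re (- (LINT x|lborel. Dm lam e e1 e2 p p1 p2 x)) \<le> norm (LINT x|lborel. Dm lam e e1 e2 p p1 p2 x)"
      using complex_Re_le_cmod[of "- (LINT x|lborel. Dm lam e e1 e2 p p1 p2 x)"] by simp
    also have "\<dots> \<le> (LINT x|lborel. norm (Dm lam e e1 e2 p p1 p2 x))" by (rule integral_norm_bound)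
    also have "\<dots> \<le> (LINT x|lborel. 8 * B * \<rho>\<^sup>2 * Q x)"
    proof (rule integral_mono)
      show "integrable lborel (\<lambda>x. norm (Dm lam e e1 e2 p p1 p2 x))" using De by (rule integrable_norm)
      show "integrable lborel (\<lambda>x. 8 * B * \<rho>\<^sup>2 * Q x)" using Qint by simp
      fix x
      have "ne x * n3 p p1 p2 x \<le> ne x * (ne x + 2 * nv x)" using nq[of x] nn[of x] by (intro mult_left_mono) auto
      then have "indicator S x * (8 * B * \<rho>\<^sup>2 * (ne x * n3 p p1 p2 x)) \<le> indicator S x * (8 * B * \<rho>\<^sup>2 * (ne x * (ne x + 2 * nv x)))"
      proof -
        assume "ne x * n3 p p1 p2 x \<le> ne x * (ne x + 2 * nv x)"
        from mult_left_mono[OF this, of "indicator S x * (8 * B * \<rho>\<^sup>2)"] show ?thesis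
          using B0 by (simp add: mult_ac)
      qed
      also have "\<dots> \<le> 8 * B * \<rho>\<^sup>2 * Q x"
        using mult_left_mono[OF Qb[of x], of "8 * B * \<rho>\<^sup>2"] B0 by (simp add: mult_ac)
      finally show "norm (Dm lam e e1 e2 p p1 p2 x) \<le> 8 * B * \<rho>\<^sup>2 * Q x"
        using Dm_bound[of lam e e1 e2 p p1 p2 x] by (simp add: ne_def mult_ac)
    qed
    finally have wp: "(LINT x|lborel. wt (r2 x) * (norm (p x))\<^sup>2) \<le> 8 * B * \<rho>\<^sup>2 * (LINT x|lborel. Q x)" by simp
    have "\<Lambda> \<le> (LINT x|lborel. wt (r2 x) * (norm (p x))\<^sup>2 + 2 * B * Q x)"
      unfolding \<Lambda>_def
    proof (rule integral_mono[OF \<Lambda>int])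
      show "integrable lborel (\<lambda>x. wt (r2 x) * (norm (p x))\<^sup>2 + 2 * B * Q x)" using wp_int Qint by simp
      fix x :: "real^2"
      have "\<bar>(norm (\<phi> x))\<^sup>2 - (norm (p x))\<^sup>2\<bar> \<le> ne x * (ne x + 2 * nv x)"
      proof -
        have "(norm (\<phi> x))\<^sup>2 - (norm (p x))\<^sup>2 = (norm (\<phi> x) - norm (p x)) * (norm (\<phi> x) + norm (p x))"
          by (simp add: power2_eq_square algebra_simps)
        moreover have "\<bar>norm (\<phi> x) - norm (p x)\<bar> \<le> ne x"
          using norm_triangle_ineq3[of "\<phi> x" "p x"] norm_ge_zero[of "e1 x"] norm_ge_zero[of "e2 x"]
          unfolding ne_def n3_def e_def by linarith
        moreover have "norm (\<phi> x) + norm (p x) \<le> ne x + 2 * nv x"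
          using nq[of x] by (simp add: nv_def n3_def) (smt (verit) norm_ge_zero)
        ultimately show ?thesis by (simp add: abs_mult mult_mono)
      qed
      from mult_mono[OF B(7)[of "x \<bullet> x"] this B0 abs_ge_zero]
      have "wt (r2 x) * ((norm (\<phi> x))\<^sup>2 - (norm (p x))\<^sup>2) \<le> B * (ne x * (ne x + 2 * nv x))"
        unfolding abs_mult[symmetric] by (rule order_trans[OF abs_ge_self])
      moreover have "wt (r2 x) = 0" if "x \<notin> S" using out[OF that] d(2) c'0 by (simp add: wt_def)
      ultimately have "wt (r2 x) * ((norm (\<phi> x))\<^sup>2 - (norm (p x))\<^sup>2) \<le> B * (indicator S x * (ne x * (ne x + 2 * nv x)))"
        by (cases "x \<in> S") auto
      also have "\<dots> \<le> B * Q x" using Qb B0 by (intro mult_left_mono) auto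
      also have "\<dots> \<le> 2 * B * Q x"
      proof -
        have "0 \<le> Q x" using \<delta> by (simp add: Q_def)
        then show ?thesis using B0 mult_nonneg_nonneg[of B "Q x"] by linarith
      qed
      finally show "wt (r2 x) * (norm (\<phi> x))\<^sup>2 \<le> wt (r2 x) * (norm (p x))\<^sup>2 + 2 * B * Q x"
        by (simp add: right_diff_distrib)
    qed
    also have "\<dots> = (LINT x|lborel. wt (r2 x) * (norm (p x))\<^sup>2) + 2 * B * (LINT x|lborel. Q x)"
      using wp_int Qint by simp
    also have "\<dots> \<le> C * (LINT x|lborel. Q x)" using wp by (simp add: C_def distrib_right)
    also have "\<dots> \<le> C * ((1 + 1 / \<delta>) * (9 * \<epsilon>) + \<delta> * V)" by (rule mult_left_mono[OF Qle C])
    finally show ?thesis .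
  qed
  have V: "V \<ge> 0" unfolding V_def by (rule Bochner_Integration.integral_nonneg) simp
  \<comment> \<open>The order of the limits matters: \<epsilon> tends to 0 with \<delta> fixed,
    since its coefficient contains \<open>1 / \<delta>\<close>, and only then does \<delta> tend to
    0.\<close>
  have step: "\<Lambda> \<le> C * V * \<delta>" if \<delta>: "\<delta> > 0" for \<delta>
  proof (rule le_of_le_linear)
    show "\<Lambda> \<le> (C * (1 + 1 / \<delta>) * 9) * \<epsilon> + C * V * \<delta>" if "\<epsilon> > 0" for \<epsilon>
      using main[OF \<delta> that] by (simp add: algebra_simps)
    show "0 \<le> C * (1 + 1 / \<delta>) * 9" using C \<delta> by simp
  qed
  have "\<Lambda> \<le> 0"
  proof (rule le_of_le_linear)
    show "\<Lambda> \<le> C * V * \<delta> + 0" if "\<delta> > 0" for \<delta> using step[OF that] by simp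
    show "0 \<le> C * V" using C V by simp
  qed
  then show "integrable lborel (\<lambda>x. (lam * W (r2 x) * (c (r2 x))\<^sup>2 - 4 * (r2 x) * (c' (r2 x))\<^sup>2 * W (r2 x)) * (norm (\<phi> x))\<^sup>2)"
    "(LINT x|lborel. (lam * W (r2 x) * (c (r2 x))\<^sup>2 - 4 * (r2 x) * (c' (r2 x))\<^sup>2 * W (r2 x)) * (norm (\<phi> x))\<^sup>2) \<le> 0"
    using \<Lambda>int by (simp_all add: \<Lambda>_def wt_def)
qed

section \<open>Logarithmic cutoffs and the limit\<close>

text \<open>The factors \<open>1\<close> and \<open>- 1\<close> are kept so that the arguments have
  the affine shape demanded by \<open>smooth_flat\<close>.\<close>

definition bump :: "real \<Rightarrow> real" where
  "bump y = flat 1 0 (1 * y + 1) * flat 1 0 ((- 1) * y + 1)"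

definition log_cutoff :: "real \<Rightarrow> real \<Rightarrow> real" where
  "log_cutoff L t = (if t > 0 then bump (ln t / L) else 0)"

lemma smooth_bump: "smooth_real bump" "smooth_real (\<lambda>y. bump (y / L))"
proof -
  show "smooth_real bump"
    unfolding bump_def[abs_def] by (intro smooth_mult smooth_flat) auto
  have "(\<lambda>y. bump (y / L)) = (\<lambda>y. flat 1 0 ((1 / L) * y + 1) * flat 1 0 ((- 1 / L) * y + 1))"
    by (simp add: bump_def fun_eq_iff)
  then show "smooth_real (\<lambda>y. bump (y / L))"
    by (simp only:) (intro smooth_mult smooth_flat; simp)
qed

lemma bump_support: "\<bar>y\<bar> > 1 \<Longrightarrow> bump y = 0"
  by (auto simp: bump_def flat_def)

lemma bump_bounds: "0 \<le> bump y" "bump y \<le> 1"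
  using flat_bound[of 1] by (auto simp: bump_def intro!: mult_nonneg_nonneg mult_le_one)

lemma log_cutoff_support:
  assumes "L > 0" "t < exp (- L) \<or> t > exp L"
  shows "log_cutoff L t = 0"
proof (cases "t > 0")
  case True
  have "ln t < - L \<or> ln t > L"
    using assms(2) True by (metis exp_less_cancel_iff exp_ln)
  then have "\<bar>ln t / L\<bar> > 1" using assms(1) by (auto simp: field_simps abs_if)
  then show ?thesis using True bump_support by (simp add: log_cutoff_def)
qed (simp add: log_cutoff_def)

lemma smooth_log_cutoff:
  assumes "L > 0"
  shows "smooth_real (log_cutoff L)" "\<exists>k. smooth_real k \<and> (\<forall>t>0. k t = W t * (log_cutoff L t)\<^sup>2) \<and> (\<forall>t\<le>0. k t = 0)"
proof -
  have z: "bump (y / L) = 0" if "y < - L" for y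
    using that assms by (intro bump_support) (simp add: field_simps abs_if)
  have eq: "log_cutoff L = (\<lambda>t. if t > 0 then bump (ln t / L) / (t ^ 0 * (t + 8) ^ 0) else 0)"
    by (simp add: log_cutoff_def fun_eq_iff)
  show "smooth_real (log_cutoff L)"
    unfolding eq by (rule smooth_ln[OF smooth_bump(2) z])
  have s: "smooth_real (\<lambda>t. if t > 0 then (bump (ln t / L) * bump (ln t / L)) / (t ^ 0 * (t + 8) ^ m) else 0)" for m
    by (rule smooth_ln[OF smooth_mult[OF smooth_bump(2) smooth_bump(2)]]) (use z in auto)
  \<comment> \<open>\<open>W t = 1 - 4 / (t + 8)\<close> exhibits \<open>W\<close> times the squared
    cutoff as a sum of two members of the class; the pole at \<open>- 8\<close> lies where the
    function is set to 0.\<close>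
  let ?k = "\<lambda>t. (if t > 0 then (bump (ln t / L) * bump (ln t / L)) / (t ^ 0 * (t + 8) ^ 0) else 0)
    + (- 4) * (if t > 0 then (bump (ln t / L) * bump (ln t / L)) / (t ^ 0 * (t + 8) ^ 1) else 0)"
  have "smooth_real ?k" by (intro smooth_add smooth_mult[OF smooth_const] s)
  moreover have "?k t = W t * (log_cutoff L t)\<^sup>2" if "t > 0" for t
    using that by (simp add: W_def log_cutoff_def power2_eq_square field_simps)
  ultimately show "\<exists>k. smooth_real k \<and> (\<forall>t>0. k t = W t * (log_cutoff L t)\<^sup>2) \<and> (\<forall>t\<le>0. k t = 0)"
    by (intro exI[of _ ?k]) auto
qed

lemma log_cutoff_deriv:
  assumes "L > 0" "\<And>y. (bump has_real_derivative b' y) (at y)"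
  shows "(log_cutoff L has_real_derivative (if t > 0 then b' (ln t / L) / (L * t) else 0)) (at t)"
proof (cases "t > 0")
  case True
  have "((\<lambda>t. ln t / L) has_real_derivative 1 / (L * t)) (at t)"
    using True assms(1) by (auto intro!: derivative_eq_intros simp: field_simps)
  from DERIV_chain2[OF assms(2) this]
  have "((\<lambda>t. bump (ln t / L)) has_real_derivative b' (ln t / L) / (L * t)) (at t)" by simp
  then show ?thesis
    using True by (auto intro: has_field_derivative_transform_within_open[where S="{0<..}"] simp: log_cutoff_def)
next
  case False
  have "(log_cutoff L has_real_derivative 0) (at t)"
    by (rule has_field_derivative_transform_within_open[where S="{..<exp (- L)}" and f="\<lambda>_. 0"])
       (use False log_cutoff_support[OF assms(1)] in \<open>auto intro: le_less_trans[OF _ exp_gt_zero]\<close>)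
  then show ?thesis using False by simp
qed

text \<open>The left side is the size of the squared gradient of the logarithmic cutoff at scale
  \<open>L\<close>, on the set where that cutoff lives. Dominating it independently of
  \<open>L\<close> is the purpose of Hardy's inequality here. For \<open>t < 1\<close> one has
  \<open>t + 1 \<le> 2\<close> and \<open>log_factor t \<le> 2 + L \<le> 3 L\<close>, whence
  \<open>18 = 2 * 3^2\<close>; for \<open>t \<ge> 1\<close> the summand 1 suffices.\<close>

lemma hardy_weight_lower_bound:
  assumes t: "t > 0" and L: "L \<ge> 1" "\<bar>ln t\<bar> \<le> L"
  shows "1 / (L\<^sup>2 * t) \<le> 1 + 18 * hardy_weight 0 t"
proof (cases "t \<ge> 1")
  case True
  have "1 * 1 \<le> L\<^sup>2 * t" using L True by (intro mult_mono) auto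
  then have "1 / (L\<^sup>2 * t) \<le> 1" by simp
  moreover have "0 \<le> hardy_weight 0 t" using t by (simp add: hardy_weight_def)
  ultimately show ?thesis by linarith
next
  case False
  have "ln (1 + 1 / t) \<le> ln (2 / t)" using False t by (intro ln_mono) (auto simp: field_simps)
  also have "\<dots> = ln 2 - ln t" using t by (simp add: ln_div)
  also have "\<dots> \<le> 1 + L" using L ln_2_less_1 by linarith
  finally have l: "log_factor t \<le> 3 * L" using L by (simp add: log_factor_def)
  have l1: "log_factor t \<ge> 1" by (rule log_factor_ge_1[OF t])
  have "(t + 1) * (log_factor t)\<^sup>2 \<le> 2 * (3 * L)\<^sup>2"
    using False t l l1 by (intro mult_mono power_mono) auto
  then have "t * ((t + 1) * (log_factor t)\<^sup>2) \<le> t * (18 * L\<^sup>2)"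
    using t by (intro mult_left_mono) (auto simp: power_mult_distrib)
  then have "18 / (t * (18 * L\<^sup>2)) \<le> 18 / (t * ((t + 1) * (log_factor t)\<^sup>2))"
    using t L l1 by (intro divide_left_mono) auto
  also have "18 / (t * (18 * L\<^sup>2)) = 1 / (L\<^sup>2 * t)" using t L by simp
  also have "18 / (t * ((t + 1) * (log_factor t)\<^sup>2)) = 18 * hardy_weight 0 t"
    using t by (simp add: hardy_weight_def power2_eq_square)
  finally show ?thesis by simp
qed

theorem lemma18:
  fixes \<phi> :: "real^2 \<Rightarrow> complex" and lam :: real
  assumes "lam > 0"
    and "\<phi> \<in> H1_0"
    and "L1_eigen_eq \<phi> (- lam)"
  shows "AE x in lborel. \<phi> x = 0"
proof -
  obtain b' where b': "smooth_real b'" "\<And>y. (bump has_real_derivative b' y) (at y)"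
    using smooth_real_deriv[OF smooth_bump(1)] by blast
  have contb: "continuous_on UNIV b'"
    using smooth_real_deriv[OF b'(1)] by (meson DERIV_continuous_on has_field_derivative_at_within)
  have b'0: "b' y = 0" if "\<bar>y\<bar> > 1" for y
  proof -
    have "(bump has_real_derivative 0) (at y)"
      by (rule has_field_derivative_transform_within_open[where S="- {-1..1}" and f="\<lambda>_. 0"])
         (use that bump_support in auto)
    then show ?thesis using b'(2) DERIV_unique by blast
  qed
  have "compact (b' ` {-1..1})"
    by (intro compact_continuous_image continuous_on_subset[OF contb]) auto
  then obtain M where M: "\<forall>y\<in>{-1..1}. norm (b' y) \<le> M"
    by (auto dest!: compact_imp_bounded simp: bounded_iff)
  then have M0: "M \<ge> 0" using order_trans[OF norm_ge_zero, of "b' 0" M] by simp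
  have b'_le: "\<bar>b' y\<bar> \<le> M" for y
  proof (cases "\<bar>y\<bar> > 1")
    case True
    then show ?thesis using b'0 M0 by simp
  next
    case False
    then have "y \<in> {-1..1}" by auto
    with M show ?thesis by simp
  qed
  define L where "L n = real (Suc n)" for n
  have L: "L n > 0" "L n \<ge> 1" for n by (simp_all add: L_def)
  define c' where "c' n t = (if t > 0 then b' (ln t / L n) / (L n * t) else 0)" for n t
  define f where "f n x = (lam * W (r2 x) * (log_cutoff (L n) (r2 x))\<^sup>2 - 4 * (r2 x) * (c' n (r2 x))\<^sup>2 * W (r2 x)) * (norm (\<phi> x))\<^sup>2"
    for n and x :: "real^2"
  have fn: "integrable lborel (f n)" "(LINT x|lborel. f n x) \<le> 0" for n
  proof -
    obtain k where k: "smooth_real k" "\<And>t. t > 0 \<Longrightarrow> k t = W t * (log_cutoff (L n) t)\<^sup>2" "\<And>t. t \<le> 0 \<Longrightarrow> k t = 0"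
      using smooth_log_cutoff(2)[OF L(1)] by blast
    have s: "t < exp (- L n) \<or> t > exp (L n) \<Longrightarrow> log_cutoff (L n) t = 0" for t
      by (rule log_cutoff_support[OF L(1)])
    have "t < exp (- L n) \<or> t > exp (L n) \<Longrightarrow> k t = 0" for t
      using s[of t] k(2)[of t] k(3)[of t] by (cases "t > 0") auto
    note ci = cutoff_inequality[OF assms(2,3) k(1,2) smooth_log_cutoff(1)[OF L(1)] log_cutoff_deriv[OF L(1) b'(2)] exp_gt_zero s this]
    show "integrable lborel (f n)" "(LINT x|lborel. f n x) \<le> 0"
      unfolding f_def c'_def by (rule ci; simp)+
  qed
  have H: "\<phi> \<in> H1" using assms(2) by (simp add: H1_0_def)
  have sq: "integrable lborel (\<lambda>x. (norm (\<phi> x))\<^sup>2)" and m[measurable]: "\<phi> \<in> borel_measurable lborel"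
    using H by (auto simp: H1_def square_integrable_def)
  have Wm[measurable]: "W \<in> borel_measurable borel" unfolding W_def[abs_def] by measurable
  have W1: "0 < W t" "W t \<le> 1" if "t \<ge> 0" for t using that by (auto simp: W_def)
  \<comment> \<open>The pointwise limit away from the origin: the argument \<open>ln t / L\<close>
    of the bump tends to 0, and the gradient term is of size \<open>1 / L^2\<close> for fixed
    \<open>t\<close>.\<close>
  define g where "g x = lam * W (r2 x) * (bump 0)\<^sup>2 * (norm (\<phi> x))\<^sup>2" for x :: "real^2"
  have "(\<lambda>n. LINT x|lborel. f n x) \<longlonglongrightarrow> (LINT x|lborel. g x)"
  proof (rule integral_dominated_convergence)
    show "g \<in> borel_measurable lborel" unfolding g_def by measurable
    show "f n \<in> borel_measurable lborel" for n using fn(1) by (rule borel_measurable_integrable)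
    \<comment> \<open>The majorant is independent of \<open>n\<close>: \<open>4 M^2\<close> bounds
      the factor \<open>4 b'^2\<close> from the gradient of the cutoff, and
      \<open>72 = 4 * 18\<close> with the constant of
      \<open>hardy_weight_lower_bound\<close>.\<close>
    show "integrable lborel (\<lambda>x. (lam + 4 * M\<^sup>2) * (norm (\<phi> x))\<^sup>2 + 72 * M\<^sup>2 * (hardy_weight 0 (r2 x) * (norm (\<phi> x))\<^sup>2))"
      using sq hardy[OF assms(2)] by simp
    show "AE x in lborel. (\<lambda>n. f n x) \<longlonglongrightarrow> g x"
    proof (rule AE_mp[OF AE_lborel_singleton[of 0]], intro AE_I2 impI)
      fix x :: "real^2" assume "x \<noteq> 0"
      define t where "t = x \<bullet> x"
      have t: "t > 0" using \<open>x \<noteq> 0\<close> by (simp add: t_def)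
      have inv: "(\<lambda>n. 1 / L n) \<longlonglongrightarrow> 0"
        using LIMSEQ_inverse_real_of_nat by (simp add: inverse_eq_divide L_def)
      have y: "(\<lambda>n. ln t / L n) \<longlonglongrightarrow> 0"
        using tendsto_mult_right[OF inv, of "ln t"] by simp
      have "(\<lambda>n. bump (ln t / L n)) \<longlonglongrightarrow> bump 0"
        by (rule isCont_tendsto_compose[OF DERIV_isCont[OF b'(2)] y])
      then have 1: "(\<lambda>n. log_cutoff (L n) t) \<longlonglongrightarrow> bump 0" using t by (simp add: log_cutoff_def)
      have 2: "(\<lambda>n. c' n t) \<longlonglongrightarrow> 0"
      proof (rule Lim_null_comparison)
        show "\<forall>\<^sub>F n in sequentially. norm (c' n t) \<le> M / t * (1 / L n)"
        proof (intro always_eventually allI)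
          fix n
          have "norm (c' n t) = \<bar>b' (ln t / L n)\<bar> / (L n * t)"
            using t L(1)[of n] by (simp add: c'_def abs_mult)
          also have "\<dots> \<le> M / (L n * t)" using t L(1)[of n] b'_le by (intro divide_right_mono) auto
          finally show "norm (c' n t) \<le> M / t * (1 / L n)" by (simp add: mult.commute)
        qed
        show "(\<lambda>n. M / t * (1 / L n)) \<longlonglongrightarrow> 0" using tendsto_mult_right_zero[OF inv] .
      qed
      have "(\<lambda>n. (lam * W t * (log_cutoff (L n) t)\<^sup>2 - 4 * t * (c' n t)\<^sup>2 * W t) * (norm (\<phi> x))\<^sup>2)
        \<longlonglongrightarrow> (lam * W t * (bump 0)\<^sup>2 - 4 * t * 0\<^sup>2 * W t) * (norm (\<phi> x))\<^sup>2"
        by (intro tendsto_intros 1 2)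
      then show "(\<lambda>n. f n x) \<longlonglongrightarrow> g x" by (simp add: f_def g_def flip: t_def)
    qed
    fix n
    show "AE x in lborel. norm (f n x) \<le> (lam + 4 * M\<^sup>2) * (norm (\<phi> x))\<^sup>2 + 72 * M\<^sup>2 * (hardy_weight 0 (r2 x) * (norm (\<phi> x))\<^sup>2)"
    proof (rule AE_mp[OF AE_lborel_singleton[of 0]], intro AE_I2 impI)
      fix x :: "real^2" assume "x \<noteq> 0"
      define t where "t = x \<bullet> x"
      have t: "t > 0" using \<open>x \<noteq> 0\<close> by (simp add: t_def)
      have w: "0 < W t" "W t \<le> 1" using W1 t by auto
      have hw: "0 \<le> hardy_weight 0 t" using t by (simp add: hardy_weight_def)
      have "\<bar>lam * W t * (log_cutoff (L n) t)\<^sup>2\<bar> \<le> lam * 1 * 1"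
        using assms(1) w bump_bounds t
        by (simp add: log_cutoff_def abs_mult power_le_one mult_le_one)
      moreover have "\<bar>4 * t * (c' n t)\<^sup>2 * W t\<bar> \<le> 4 * M\<^sup>2 * (1 + 18 * hardy_weight 0 t)"
      proof (cases "\<bar>ln t\<bar> \<le> L n")
        case True
        have "(b' (ln t / L n))\<^sup>2 \<le> M\<^sup>2" using b'_le M0 by (metis abs_le_square_iff abs_of_nonneg)
        have "4 * t * (c' n t)\<^sup>2 * W t = 4 * (b' (ln t / L n))\<^sup>2 * (1 / ((L n)\<^sup>2 * t)) * W t"
          using t L(1)[of n] by (simp add: c'_def power2_eq_square)
        also have "\<dots> \<le> 4 * M\<^sup>2 * (1 + 18 * hardy_weight 0 t) * 1"
          using hardy_weight_lower_bound[OF t L(2) True] \<open>(b' (ln t / L n))\<^sup>2 \<le> M\<^sup>2\<close> w hw t L(1)[of n]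
          by (intro mult_mono mult_nonneg_nonneg) auto
        finally show ?thesis using t w by simp
      next
        case False
        then have "\<bar>ln t / L n\<bar> > 1" using L(1)[of n] by simp
        then have "c' n t = 0" using b'0 by (simp add: c'_def)
        then show ?thesis using hw by simp
      qed
      ultimately have bound: "\<bar>lam * W t * (log_cutoff (L n) t)\<^sup>2 - 4 * t * (c' n t)\<^sup>2 * W t\<bar> \<le> lam + 4 * M\<^sup>2 * (1 + 18 * hardy_weight 0 t)"
        by linarith
      have "norm (f n x) = \<bar>lam * W t * (log_cutoff (L n) t)\<^sup>2 - 4 * t * (c' n t)\<^sup>2 * W t\<bar> * (norm (\<phi> x))\<^sup>2"
        by (simp add: f_def abs_mult flip: t_def)
      also have "\<dots> \<le> (lam + 4 * M\<^sup>2 * (1 + 18 * hardy_weight 0 t)) * (norm (\<phi> x))\<^sup>2"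
        by (rule mult_right_mono[OF bound]) simp
      also have "\<dots> = (lam + 4 * M\<^sup>2) * (norm (\<phi> x))\<^sup>2 + 72 * M\<^sup>2 * (hardy_weight 0 (r2 x) * (norm (\<phi> x))\<^sup>2)"
        by (simp add: t_def algebra_simps)
      finally show "norm (f n x) \<le> (lam + 4 * M\<^sup>2) * (norm (\<phi> x))\<^sup>2 + 72 * M\<^sup>2 * (hardy_weight 0 (r2 x) * (norm (\<phi> x))\<^sup>2)" .
    qed
  qed
  then have g0: "(LINT x|lborel. g x) \<le> 0"
    by (rule LIMSEQ_le_const2) (use fn(2) in auto)
  have g_nn: "0 \<le> g x" for x using assms(1) W1(1)[of "x \<bullet> x"] by (simp add: g_def)
  have gint: "integrable lborel g"
  proof (rule Bochner_Integration.integrable_bound)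
    show "integrable lborel (\<lambda>x. lam * (bump 0)\<^sup>2 * (norm (\<phi> x))\<^sup>2)" using sq by simp
    show "g \<in> borel_measurable lborel" unfolding g_def by measurable
    show "AE x in lborel. norm (g x) \<le> norm (lam * (bump 0)\<^sup>2 * (norm (\<phi> x))\<^sup>2)"
    proof (intro AE_I2)
      fix x :: "real^2"
      have "W (r2 x) * (lam * (bump 0)\<^sup>2 * (norm (\<phi> x))\<^sup>2) \<le> 1 * (lam * (bump 0)\<^sup>2 * (norm (\<phi> x))\<^sup>2)"
        using W1[of "x \<bullet> x"] assms(1) by (intro mult_right_mono) auto
      then show "norm (g x) \<le> norm (lam * (bump 0)\<^sup>2 * (norm (\<phi> x))\<^sup>2)"
        using g_nn[of x] assms(1) by (simp add: g_def mult_ac)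
    qed
  qed
  have "(LINT x|lborel. g x) = 0"
    by (intro antisym g0 Bochner_Integration.integral_nonneg g_nn)
  then have "AE x in lborel. g x = 0"
    using integral_nonneg_eq_0_iff_AE[OF gint] g_nn by simp
  then show ?thesis
  proof eventually_elim
    case (elim x)
    \<comment> \<open>The cutoffs tend to the constant \<open>bump 0 = exp (- 2)\<close> and not to
      1; positivity is all that is needed.\<close>
    have "bump 0 > 0" by (simp add: bump_def flat_def)
    then show "\<phi> x = 0" using elim assms(1) W1(1)[of "x \<bullet> x"] by (simp add: g_def)
  qed
qed

end
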